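(* Let $n,d\ge 1$, let $\mathcal{G}=\{G_1,\dots,G_m\}\subseteq\mathcal{S}_n(\mathbb{R}[X])$ be a finite set, and let $G\subseteq\mathbb{R}[X]$ be a finite set such that $\mathbf{K}_{\mathcal{G}}=K_G$ and $(T_G)^n\subseteq\mathcal{T}_{\mathcal{G}}$. Let $\mathbf{D}=D(d_1,\dots,d_r)$, $r\le n$, be an $n\times n$ diagonal polynomial matrix in $\mathcal{S}_n(\mathbb{R}[X])$. Assume: (1) $\mathbf{K}_{\mathcal{G}}$ is compact; (2) $\mathbf{D}\succcurlyeq\mathbf{0}$ on $\mathbf{K}_{\mathcal{G}}$, and each $d_i$ ($1\le i\le r$) has only finitely many zeros in $\mathbf{K}_{\mathcal{G}}$; (3) at each zero $p$ of each $d_i$ in $\mathbf{K}_{\mathcal{G}}$, $d_i\in(\widehat{T_G})_p\subseteq\mathbb{R}[[X-p]]$. Then $\mathbf{D}\in(T_G)^n\subseteq\mathcal{T}_{\mathcal{G}}$.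
   Context: $\mathbb{R}[X]=\mathbb{R}[x_1,\dots,x_d]$. For a commutative unital ring $R$, $\mathcal{M}_n(R)$ is the ring of $n\times n$ matrices over $R$, $\mathcal{S}_n(R)$ its subset of symmetric matrices, $\mathbf{I}_n$ the identity matrix. A quadratic module in $\mathcal{M}_n(R)$ is a set $\mathcal{M}\subseteq\mathcal{S}_n(R)$ with $\mathbf{I}_n\in\mathcal{M}$, $\mathcal{M}+\mathcal{M}\subseteq\mathcal{M}$, and $A^T\mathcal{M}A\subseteq\mathcal{M}$ for all $A\in\mathcal{M}_n(R)$. A preordering in $\mathcal{M}_n(R)$ is a quadratic module $\mathcal{T}$ such that $\mathcal{T}\cap(R\cdot\mathbf{I}_n)$ is closed under multiplication. $\mathcal{T}_{\mathcal{G}}$ denotes the smallest preordering in $\mathcal{M}_n(\mathbb{R}[X])$ containing $\mathcal{G}$. A preordering of a commutative ring $R$ is a subset closed under addition and multiplication and containing all squares; $T_G$ denotes the smallest preordering of $\mathbb{R}[X]$ containing $G$. For $p\in\mathbb{R}^d$, $\mathbb{R}[[X-p]]$ is the ring of formal power series in $x_1-p_1,\dots,x_d-p_d$, in which $\mathbb{R}[X]$ embeds by Taylor expansion at $p$, and $(\widehat{T_G})_p$ is the preordering of $\mathbb{R}[[X-p]]$ generated by $G$. For a quadratic module $M\subseteq\mathbb{R}[X]$ (in particular $M=T_G$), $M^n$ denotes the set of all finite sums $\sum_i m_iA_i^TA_i$ with $m_i\in M$, $A_i\in\mathcal{M}_n(\mathbb{R}[X])$. $\mathbf{K}_{\mathcal{G}}=\{x\in\mathbb{R}^d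 : \mathbf{G}(x)\succcurlyeq\mathbf{0}\ \forall\,\mathbf{G}\in\mathcal{G}\}$ and $K_G=\{x\in\mathbb{R}^d: g(x)\ge 0\ \forall g\in G\}$. $D(d_1,\dots,d_r)$ is the $n\times n$ diagonal matrix with diagonal entries $d_1,\dots,d_r,0,\dots,0$. "$\succcurlyeq\mathbf 0$ on a set" means positive semidefinite at each point of the set. *)

theory Defs
  imports
    "HOL-Analysis.Analysis"
    "HOL-Library.Poly_Mapping"
    "Jordan_Normal_Form.Matrix"
begin

no_notation Matrix.vec_index (infixl "$" 100)

section \<open>Polynomials\<close>

text \<open>The polynomial ring in the variables \<open>x\<^sub>i\<close>, \<open>i :: 'd\<close>, with \<open>d = CARD('d)\<close>. A polynomial
  maps each monomial, given by its exponents, to its coefficient; the ring structure is the one of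
  \<^theory>\<open>HOL-Library.Poly_Mapping\<close>.\<close>

type_synonym ('d, 'a) mpoly = "('d \<Rightarrow>\<^sub>0 nat) \<Rightarrow>\<^sub>0 'a"

text \<open>Replace each variable \<open>x\<^sub>i\<close> by \<open>s i\<close> and each coefficient \<open>a\<close> by \<open>c a\<close>.\<close>

definition subst ::
  "('a::zero \<Rightarrow> 'b::comm_ring_1) \<Rightarrow> ('d::finite \<Rightarrow> 'b) \<Rightarrow> ('d, 'a) mpoly \<Rightarrow> 'b" where
  "subst c s f =
     (\<Sum>m\<in>Poly_Mapping.keys f. c (Poly_Mapping.lookup f m) *
        (\<Prod>i\<in>UNIV. s i ^ Poly_Mapping.lookup m i))"

definition peval :: "('d::finite, real) mpoly \<Rightarrow> real ^ 'd \<Rightarrow> real" where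
  "peval f x = subst (\<lambda>a. a) (\<lambda>i. x $ i) f"

section \<open>Formal power series\<close>

text \<open>Power series in finitely many indeterminates \<open>Y\<^sub>i\<close>, \<open>i :: 'd\<close>.\<close>

typedef ('d, 'a) mfps = "UNIV :: (('d \<Rightarrow>\<^sub>0 nat) \<Rightarrow> 'a) set"
  morphisms mfps_coeff Abs_mfps ..

setup_lifting type_definition_mfps

lemma mfps_eqI: "(\<And>m. mfps_coeff f m = mfps_coeff g m) \<Longrightarrow> f = g"
  by (simp add: mfps_coeff_inject[symmetric] fun_eq_iff)

lemma finite_exponents_split:
  fixes m :: "'d::finite \<Rightarrow>\<^sub>0 nat"
  shows "finite {(a, b). a + b = m}"
proof -
  have fin: "finite {a :: 'd \<Rightarrow>\<^sub>0 nat. \<forall>i. Poly_Mapping.lookup a i \<le> Poly_Mapping.lookup m i}"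
    (is "finite ?A")
  proof (rule finite_imageD)
    have "Poly_Mapping.lookup ` ?A \<subseteq> Pi\<^sub>E UNIV (\<lambda>i. {..Poly_Mapping.lookup m i})"
      by auto
    moreover have "finite (Pi\<^sub>E (UNIV :: 'd set) (\<lambda>i. {..Poly_Mapping.lookup m i}))"
      by (rule finite_PiE) auto
    ultimately show "finite (Poly_Mapping.lookup ` ?A)"
      by (rule finite_subset)
    show "inj_on Poly_Mapping.lookup ?A"
      by (simp add: inj_on_def poly_mapping.lookup_inject)
  qed
  have "{(a, b). a + b = m} \<subseteq> ?A \<times> ?A"
    by (auto simp: Poly_Mapping.lookup_add)
  then show ?thesis
    by (rule finite_subset) (intro finite_cartesian_product fin)
qed

instantiation mfps :: (finite, comm_ring_1) comm_ring_1
begin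

lift_definition zero_mfps :: "('a, 'b) mfps" is "\<lambda>_. 0" .
lift_definition one_mfps :: "('a, 'b) mfps" is "\<lambda>m. if m = 0 then 1 else 0" .
lift_definition plus_mfps :: "('a, 'b) mfps \<Rightarrow> ('a, 'b) mfps \<Rightarrow> ('a, 'b) mfps"
  is "\<lambda>f g m. f m + g m" .
lift_definition minus_mfps :: "('a, 'b) mfps \<Rightarrow> ('a, 'b) mfps \<Rightarrow> ('a, 'b) mfps"
  is "\<lambda>f g m. f m - g m" .
lift_definition uminus_mfps :: "('a, 'b) mfps \<Rightarrow> ('a, 'b) mfps" is "\<lambda>f m. - f m" .
lift_definition times_mfps :: "('a, 'b) mfps \<Rightarrow> ('a, 'b) mfps \<Rightarrow> ('a, 'b) mfps"
  is "\<lambda>f g m. \<Sum>(a, b)\<in>{(a, b). a + b = m}. f a * g b" .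

instance
proof
  fix f g h :: "('a, 'b) mfps"
  show "f * g * h = f * (g * h)"
  proof (rule mfps_eqI)
    fix m
    let ?F = "mfps_coeff f" and ?G = "mfps_coeff g" and ?H = "mfps_coeff h"
    let ?P = "\<lambda>m. {(a, b). a + b = m} :: (('a \<Rightarrow>\<^sub>0 nat) \<times> ('a \<Rightarrow>\<^sub>0 nat)) set"
    have "mfps_coeff (f * g * h) m =
        (\<Sum>u\<in>?P m. \<Sum>v\<in>?P (fst u). ?F (fst v) * ?G (snd v) * ?H (snd u))"
      by (simp add: times_mfps.rep_eq case_prod_beta sum_distrib_right)
    also have "\<dots> = (\<Sum>(u, v)\<in>(SIGMA u:?P m. ?P (fst u)). ?F (fst v) * ?G (snd v) * ?H (snd u))"
      by (rule sum.Sigma) (auto simp: finite_exponents_split)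
    also have "\<dots> = (\<Sum>(u, v)\<in>(SIGMA u:?P m. ?P (snd u)). ?F (fst u) * (?G (fst v) * ?H (snd v)))"
      by (rule sum.reindex_bij_witness[where
            i = "\<lambda>((a, bc), (b, c)). ((a + b, c), (a, b))" and
            j = "\<lambda>((ab, c), (a, b)). ((a, b + c), (b, c))"])
        (auto simp: add.assoc mult.assoc)
    also have "\<dots> = (\<Sum>u\<in>?P m. \<Sum>v\<in>?P (snd u). ?F (fst u) * (?G (fst v) * ?H (snd v)))"
      by (rule sum.Sigma[symmetric]) (auto simp: finite_exponents_split)
    also have "\<dots> = mfps_coeff (f * (g * h)) m"
      by (simp add: times_mfps.rep_eq case_prod_beta sum_distrib_left)
    finally show "mfps_coeff (f * g * h) m = mfps_coeff (f * (g * h)) m" .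
  qed
  show "f * g = g * f"
    by (rule mfps_eqI, simp add: times_mfps.rep_eq,
        rule sum.reindex_bij_witness[where i = prod.swap and j = prod.swap])
      (auto simp: add.commute mult.commute)
  show "1 * f = f"
  proof (rule mfps_eqI)
    fix m
    have "mfps_coeff (1 * f) m =
        (\<Sum>(a, b)\<in>{(a, b). a + b = m}. (if a = 0 then 1 else 0) * mfps_coeff f b)"
      by (simp add: times_mfps.rep_eq one_mfps.rep_eq)
    also have "\<dots> = (\<Sum>(a, b)\<in>{(0 :: 'a \<Rightarrow>\<^sub>0 nat, m)}. (if a = 0 then 1 else 0) * mfps_coeff f b)"
      by (rule sum.mono_neutral_right) (auto simp: finite_exponents_split split: if_splits)
    finally show "mfps_coeff (1 * f) m = mfps_coeff f m" by simp
  qed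
  show "(f + g) * h = f * h + g * h"
    by (rule mfps_eqI)
      (simp add: times_mfps.rep_eq plus_mfps.rep_eq case_prod_beta distrib_right sum.distrib)
  show "(0 :: ('a, 'b) mfps) \<noteq> 1"
    by (metis one_mfps.rep_eq zero_mfps.rep_eq zero_neq_one)
qed (transfer; simp add: fun_eq_iff algebra_simps)+

end

lift_definition mfps_const :: "'a::zero \<Rightarrow> ('d, 'a) mfps" is
  "\<lambda>c m. if m = 0 then c else 0" .

lift_definition mfps_var :: "'d \<Rightarrow> ('d, 'a::zero_neq_one) mfps" is
  "\<lambda>i m. if m = Poly_Mapping.single i 1 then 1 else 0" .

text \<open>The power series in \<open>x\<^sub>i - p\<^sub>i\<close> are represented with \<open>Y\<^sub>i\<close> standing for \<open>x\<^sub>i - p\<^sub>i\<close>.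
  The Taylor expansion at \<open>p\<close> then substitutes \<open>x\<^sub>i = p\<^sub>i + Y\<^sub>i\<close>.\<close>

definition taylor :: "real ^ 'd \<Rightarrow> ('d::finite, real) mpoly \<Rightarrow> ('d, real) mfps" where
  "taylor p f = subst mfps_const (\<lambda>i. mfps_const (p $ i) + mfps_var i) f"

section \<open>Preorderings of commutative rings\<close>

definition preordering :: "'a::comm_ring_1 set \<Rightarrow> bool" where
  "preordering T \<longleftrightarrow>
     (\<forall>a\<in>T. \<forall>b\<in>T. a + b \<in> T) \<and> (\<forall>a\<in>T. \<forall>b\<in>T. a * b \<in> T) \<and> (\<forall>a. a\<^sup>2 \<in> T)"

definition preordering_gen :: "'a::comm_ring_1 set \<Rightarrow> 'a set" where
  "preordering_gen G = \<Inter>{T. preordering T \<and> G \<subseteq> T}"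

definition nonneg_set :: "('d::finite, real) mpoly set \<Rightarrow> (real ^ 'd) set" where
  "nonneg_set G = {x. \<forall>g\<in>G. peval g x \<ge> 0}"

section \<open>Matrices\<close>

definition sym_mats :: "nat \<Rightarrow> 'a mat set" where
  "sym_mats n = {A \<in> carrier_mat n n. A\<^sup>T = A}"

definition mat_quadratic_module :: "nat \<Rightarrow> 'a::comm_ring_1 mat set \<Rightarrow> bool" where
  "mat_quadratic_module n M \<longleftrightarrow>
     M \<subseteq> sym_mats n \<and> 1\<^sub>m n \<in> M \<and> (\<forall>B\<in>M. \<forall>C\<in>M. B + C \<in> M) \<and>
     (\<forall>A\<in>carrier_mat n n. \<forall>B\<in>M. A\<^sup>T * B * A \<in> M)"

definition scalar_mats :: "nat \<Rightarrow> 'a::comm_ring_1 mat set" where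
  "scalar_mats n = {c \<cdot>\<^sub>m 1\<^sub>m n | c. True}"

definition mat_preordering :: "nat \<Rightarrow> 'a::comm_ring_1 mat set \<Rightarrow> bool" where
  "mat_preordering n T \<longleftrightarrow> mat_quadratic_module n T \<and>
     (\<forall>B\<in>T \<inter> scalar_mats n. \<forall>C\<in>T \<inter> scalar_mats n. B * C \<in> T \<inter> scalar_mats n)"

definition mat_preordering_gen :: "nat \<Rightarrow> 'a::comm_ring_1 mat set \<Rightarrow> 'a mat set" where
  "mat_preordering_gen n \<G> = \<Inter>{T. mat_preordering n T \<and> \<G> \<subseteq> T}"

text \<open>The set \<open>M\<^sup>n\<close> of all finite sums of matrices \<open>m A\<^sup>T A\<close> with \<open>m \<in> M\<close>.\<close>

definition mat_power :: "nat \<Rightarrow> 'a::comm_ring_1 set \<Rightarrow> 'a mat set" where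
  "mat_power n M =
     {foldr (+) (map (\<lambda>(m, A). m \<cdot>\<^sub>m (A\<^sup>T * A)) mAs) (0\<^sub>m n n) | mAs.
        set mAs \<subseteq> M \<times> carrier_mat n n}"

definition psd :: "real mat \<Rightarrow> bool" where
  "psd A \<longleftrightarrow> A \<in> sym_mats (dim_row A) \<and>
     (\<forall>v\<in>carrier_vec (dim_row A). Matrix.scalar_prod v (A *\<^sub>v v) \<ge> 0)"

definition psd_at :: "('d::finite, real) mpoly mat \<Rightarrow> real ^ 'd \<Rightarrow> bool" where
  "psd_at F x \<longleftrightarrow> psd (map_mat (\<lambda>f. peval f x) F)"

definition psd_set :: "('d::finite, real) mpoly mat set \<Rightarrow> (real ^ 'd) set" where
  "psd_set \<G> = {x. \<forall>F\<in>\<G>. psd_at F x}"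

text \<open>The \<open>n \<times> n\<close> matrix \<open>D(d\<^sub>1,\<dots>,d\<^sub>r)\<close>; the remaining diagonal entries are zero.\<close>

definition diag_mat_of :: "nat \<Rightarrow> 'a::zero list \<Rightarrow> 'a mat" where
  "diag_mat_of n ds = mat_diag n (\<lambda>i. if i < length ds then ds ! i else 0)"

end

theory Submission
  imports
    Defs
    "HOL-Algebra.Algebraic_Closure_Type"
    "HOL-Computational_Algebra.Fraction_Field"
    "Jordan_Normal_Form.Char_Poly"
begin

text \<open>
  It suffices to show \<open>d\<^sub>i \<in> T\<^sub>G\<close> for each diagonal entry, which is Scheiderer's local-global principle.

  The algebraic input is the Positivstellensatz. If no identity certifies that \<open>\<phi>\<close> vanishes on \<open>K\<^sub>G\<close>,
  then by Zorn's lemma \<open>T\<^sub>G\<close> extends to a prime cone with \<open>\<phi>\<close> outside its support; its residue field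
  embeds into a real closed field, and the Cohen-Hoermander elimination moves the sign pattern of
  \<open>G\<close> and \<open>\<phi>\<close> from that field to a real point. Woermann's argument then makes \<open>T\<^sub>G\<close> archimedean when
  \<open>K\<^sub>G\<close> is compact, and Schmuedgen's theorem follows.

  Let \<open>f \<ge> 0\<close> on \<open>K\<^sub>G\<close> with finite zero set \<open>Z\<close>. The preordering \<open>T' = T\<^sub>G - f\<^sup>2 T\<^sub>G\<close> defines \<open>Z\<close>, so by
  the Positivstellensatz its support contains a product of powers of the maximal ideals of the points of
  \<open>Z\<close>. Truncating the power series certificates and gluing them by the Chinese remainder theorem gives
  \<open>f \<in> T'\<close>, i.e. \<open>f + t f\<^sup>2 \<in> T\<^sub>G\<close> with \<open>t \<in> T\<^sub>G\<close>, and the term \<open>t f\<^sup>2\<close> can be removed because \<open>T\<^sub>G\<close>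
  is archimedean.
\<close>

text \<open>Elimination works without formulas. It compares two homomorphisms from one coefficient
  ring into two real closed fields, and finds finitely many elements of that ring whose signs decide
  which sign patterns occur as one variable moves. This is enough, because only a single point with
  prescribed signs has to be moved. The real closure takes one use of Zorn's lemma inside the
  algebraic closure: a cone \<open>P\<close> carries its field \<open>P - P\<close> along, so that
  field and order grow together.

  Why the square of \<open>f\<close> is adjoined: gluing leaves an error known only to vanish to
  high order on Z. No element of T_G controls the sign of such an error, whereas in a support it has
  no sign to be controlled. The price is a term \<open>t f^2\<close>, of second order on purpose:
  \<open>f + t f^2 = f (1 + t f)\<close>, and the second factor is congruent to 1 modulo
  \<open>f\<close>. Hence the equation that recovers \<open>f\<close> from this product and from
  \<open>f^2\<close> can be solved with polynomial multipliers, and taking them from a long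
  geometric series makes them nonnegative on K_G.\<close>

hide_const (open)
  Polynomials.degree Polynomials.lead_coeff
  Module.module.smult Coset.order up_ring.coeff up_ring.monom

section \<open>Real closed fields and sign diagrams\<close>

text \<open>A class axiom cannot mention \<open>poly\<close> over the class type, so polynomials are given by their
  coefficient lists.\<close>

class rcf = linordered_field +
  assumes rcf_ivt_list: "a < b \<Longrightarrow> foldr (\<lambda>c v. c + a * v) cs 0 < 0 \<Longrightarrow>
    0 < foldr (\<lambda>c v. c + b * v) cs 0 \<Longrightarrow> \<exists>x>a. x < b \<and> foldr (\<lambda>c v. c + x * v) cs 0 = 0"

lemma foldr_eq_poly: "foldr (\<lambda>c v. c + x * v) cs 0 = poly (Poly cs) (x :: 'a::comm_semiring_0)"
  by (induction cs) auto

lemma rcf_ivt: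
  fixes p :: "'f::rcf poly"
  shows "a < b \<Longrightarrow> poly p a < 0 \<Longrightarrow> 0 < poly p b \<Longrightarrow> \<exists>c>a. c < b \<and> poly p c = 0"
  using rcf_ivt_list[of a b "coeffs p"] by (simp add: foldr_eq_poly)

instance real :: rcf
  by standard (unfold foldr_eq_poly, rule poly_IVT_pos)

section \<open>Rolle's theorem and monotonicity over a real closed field\<close>

lemma rcf_ivt_sgn:
  fixes p :: "'f::rcf poly"
  assumes "a < b" "poly p a * poly p b < 0"
  shows "\<exists>c>a. c < b \<and> poly p c = 0"
proof (cases "poly p a < 0")
  case True
  then show ?thesis using assms rcf_ivt[of a b p] by (simp add: mult_less_0_iff)
next
  case False
  then have "poly (-p) a < 0" "0 < poly (-p) b" using assms by (auto simp: mult_less_0_iff)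
  from rcf_ivt[OF assms(1) this] show ?thesis by simp
qed

lemma no_root_same_sgn:
  fixes p :: "'f::rcf poly"
  assumes "a \<le> b" "\<And>x. a \<le> x \<Longrightarrow> x \<le> b \<Longrightarrow> poly p x \<noteq> 0"
  shows "poly p a * poly p b > 0"
proof (cases "a = b")
  case True
  then show ?thesis using assms by (simp add: zero_less_mult_iff) (meson linorder_neqE order_refl)
next
  case False
  then have "a < b" using assms by simp
  have "\<not> poly p a * poly p b < 0"
    using rcf_ivt_sgn[OF \<open>a < b\<close>] assms(2) by (meson less_imp_le)
  moreover have "poly p a * poly p b \<noteq> 0" using assms by simp
  ultimately show ?thesis by (meson linorder_neqE)
qed

text \<open>A general real closed field offers no extremum to differentiate at, so the proof is
  algebraic. With p = (x-a)^(m+1) (x-b)^(n+1) q the derivative is (x-a)^m (x-b)^n r. The values of r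
  at a and b are positive multiples of (a-b) q(a) and (b-a) q(b), and q keeps its sign on [a,b], so
  r changes sign.\<close>

lemma rolle_consecutive:
  fixes p :: "'f::rcf poly"
  assumes "a < b" "poly p a = 0" "poly p b = 0" "p \<noteq> 0"
    and nz: "\<And>x. a < x \<Longrightarrow> x < b \<Longrightarrow> poly p x \<noteq> 0"
  shows "\<exists>c>a. c < b \<and> poly (pderiv p) c = 0"
proof -
  obtain q1 where q1: "p = [:-a,1:] ^ Polynomial.order a p * q1" "\<not> [:-a,1:] dvd q1"
    using Polynomial.order_decomp[OF \<open>p \<noteq> 0\<close>] by blast
  have "q1 \<noteq> 0" using q1(2) by auto
  obtain q where q: "q1 = [:-b,1:] ^ Polynomial.order b q1 * q" "\<not> [:-b,1:] dvd q"
    using Polynomial.order_decomp[OF \<open>q1 \<noteq> 0\<close>] by blast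
  have qa: "poly q a \<noteq> 0"
    using q1(2) q(1) by (metis dvd_mult poly_eq_0_iff_dvd)
  have qb: "poly q b \<noteq> 0" using q(2) by (simp add: poly_eq_0_iff_dvd)
  have "Polynomial.order a p \<noteq> 0" using assms Polynomial.order_root by blast
  then obtain m where m: "Polynomial.order a p = Suc m" using not0_implies_Suc by blast
  have "poly q1 b = 0" using q1(1) \<open>poly p b = 0\<close> \<open>a < b\<close>
    by (metis (no_types, lifting) add.commute diff_add_cancel eq_iff_diff_eq_0 less_irrefl mult_eq_0_iff
        mult.right_neutral poly_mult poly_pCons poly_power poly_0 power_eq_0_iff uminus_add_conv_diff add_0_right mult_zero_right)
  then have "Polynomial.order b q1 \<noteq> 0" using \<open>q1 \<noteq> 0\<close> Polynomial.order_root by blast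
  then obtain n where n: "Polynomial.order b q1 = Suc n" using not0_implies_Suc by blast
  define A where "A = [:-a,1:]"
  define B where "B = [:-b,1:]"
  have p: "p = A ^ Suc m * (B ^ Suc n * q)" using q1(1) q(1) m n by (simp add: A_def B_def)
  define r where "r = smult (of_nat (Suc m)) (B * q) + smult (of_nat (Suc n)) (A * q) + A * B * pderiv q"
  have "pderiv A = 1" "pderiv B = 1" by (simp_all add: A_def B_def pderiv_pCons one_pCons)
  then have dp: "pderiv p = A ^ m * B ^ n * r"
    unfolding p r_def pderiv_mult pderiv_power_Suc by (simp add: algebra_simps del: of_nat_Suc)
  have "poly q a * poly q b > 0"
  proof (rule no_root_same_sgn)
    show "poly q x \<noteq> 0" if "a \<le> x" "x \<le> b" for x
    proof (cases "x = a \<or> x = b")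
      case True then show ?thesis using qa qb by auto
    next
      case False
      then have "poly p x \<noteq> 0" using that nz by auto
      then show ?thesis unfolding p by auto
    qed
  qed (use assms in simp)
  moreover have ra: "poly r a = of_nat (Suc m) * (a - b) * poly q a"
    unfolding r_def by (simp add: A_def B_def algebra_simps del: of_nat_Suc)
  moreover have rb: "poly r b = of_nat (Suc n) * (b - a) * poly q b"
    unfolding r_def by (simp add: A_def B_def algebra_simps del: of_nat_Suc)
  have "poly r a * poly r b = - (of_nat (Suc m) * of_nat (Suc n) * ((b-a) * (b - a))) * (poly q a * poly q b)"
    unfolding ra rb by (simp add: algebra_simps)
  moreover have "(of_nat (Suc m) * of_nat (Suc n) * ((b-a) * (b - a))) > 0"
    using \<open>a < b\<close> by (intro mult_pos_pos) (auto simp del: of_nat_Suc)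
  ultimately have "poly r a * poly r b < 0" by (simp add: mult_neg_pos del: of_nat_Suc)
  from rcf_ivt_sgn[OF \<open>a < b\<close> this] obtain c where "c > a" "c < b" "poly r c = 0" by blast
  then show ?thesis unfolding dp by auto
qed

lemma rolle:
  fixes p :: "'f::rcf poly"
  assumes "a < b" "poly p a = 0" "poly p b = 0"
  shows "\<exists>c>a. c < b \<and> poly (pderiv p) c = 0"
proof (cases "p = 0")
  case True
  then show ?thesis using dense[OF \<open>a < b\<close>] by auto
next
  case False
  \<comment> \<open>The smallest root beyond \<open>a\<close> is consecutive to \<open>a\<close>;
    including \<open>b\<close> makes the set nonempty.\<close>
  define Z where "Z = {x. poly p x = 0 \<and> a < x \<and> x \<le> b}"
  have "finite Z" unfolding Z_def using poly_roots_finite[OF False] by (rule finite_subset[rotated]) auto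
  moreover have "b \<in> Z" using assms by (simp add: Z_def)
  ultimately have *: "Min Z \<in> Z" "\<And>z. z \<in> Z \<Longrightarrow> Min Z \<le> z" by (auto intro: Min_in)
  have "\<exists>c>a. c < Min Z \<and> poly (pderiv p) c = 0"
  proof (rule rolle_consecutive)
    show "poly p x \<noteq> 0" if "a < x" "x < Min Z" for x
      using that *(2)[of x] *(1) unfolding Z_def by force
  qed (use assms * False Z_def in auto)
  moreover have "Min Z \<le> b" using * \<open>b \<in> Z\<close> by blast
  ultimately show ?thesis by force
qed

lemma rcf_mvt:
  fixes p :: "'f::rcf poly"
  assumes "a < b"
  shows "\<exists>c>a. c < b \<and> poly p b - poly p a = (b - a) * poly (pderiv p) c"
proof -
  define k where "k = (poly p b - poly p a) / (b - a)"
  define q where "q = p - [:poly p a - k * a, k:]"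
  have "b - a \<noteq> 0" using assms by simp
  then have k: "k * (b - a) = poly p b - poly p a" by (simp add: k_def)
  have "poly q a = 0" by (simp add: q_def)
  moreover have "poly q b = 0" using k by (simp add: q_def algebra_simps)
  ultimately obtain c where c: "c > a" "c < b" "poly (pderiv q) c = 0" using rolle[OF assms] by blast
  have "pderiv q = pderiv p - [:k:]" by (simp add: q_def pderiv_diff pderiv_pCons)
  then have "poly (pderiv p) c = k" using c(3) by simp
  then show ?thesis using c k by (auto simp: mult.commute)
qed

lemma poly_strict_mono:
  fixes p :: "'f::rcf poly"
  assumes "a < b" "\<And>x. a < x \<Longrightarrow> x < b \<Longrightarrow> poly (pderiv p) x > 0"
  shows "poly p a < poly p b"
  using rcf_mvt[OF assms(1), of p] assms by (metis diff_gt_0_iff_gt mult_pos_pos)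

lemma poly_strict_antimono:
  fixes p :: "'f::rcf poly"
  assumes "a < b" "\<And>x. a < x \<Longrightarrow> x < b \<Longrightarrow> poly (pderiv p) x < 0"
  shows "poly p b < poly p a"
  using poly_strict_mono[OF assms(1), of "-p"] assms(2) by (simp add: pderiv_minus)

lemma poly_const_on:
  fixes p :: "'f::rcf poly"
  assumes "a < b" "\<And>x. a < x \<Longrightarrow> x < b \<Longrightarrow> poly (pderiv p) x = 0"
  shows "poly p b = poly p a"
  using rcf_mvt[OF assms(1), of p] assms by (metis eq_iff_diff_eq_0 mult_zero_right)

text \<open>A uniform bound \<open>k\<close> instead of mere positivity makes the induction on
  coefficients work: once \<open>x\<close> exceeds \<open>(|a| + 1) / k\<close>, the term
  \<open>x * poly p x\<close> outweighs the new constant coefficient \<open>a\<close> by at least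
  1.\<close>

lemma poly_ge_at_top:
  fixes p :: "'f::linordered_field poly"
  shows "Polynomial.lead_coeff p > 0 \<Longrightarrow> \<exists>k>0. \<exists>M. \<forall>x\<ge>M. poly p x \<ge> k"
proof (induction p)
  case 0
  then show ?case by simp
next
  case (pCons a p)
  show ?case
  proof (cases "p = 0")
    case True
    then show ?thesis using pCons.prems by auto
  next
    case False
    then obtain k M where k: "k > 0" "\<And>x. x \<ge> M \<Longrightarrow> poly p x \<ge> k"
      using pCons by auto
    have "poly (pCons a p) x \<ge> 1" if x: "x \<ge> max M (max 0 ((\<bar>a\<bar> + 1) / k))" for x
    proof -
      have "x \<ge> M" "x \<ge> 0" "x \<ge> (\<bar>a\<bar> + 1) / k"
        using x unfolding max.bounded_iff by blast+
      then have "\<bar>a\<bar> + 1 \<le> x * k" using k(1) by (simp add: pos_divide_le_eq)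
      also have "\<dots> \<le> x * poly p x" using k \<open>x \<ge> M\<close> \<open>x \<ge> 0\<close> by (intro mult_left_mono) auto
      finally have *: "\<bar>a\<bar> + 1 \<le> x * poly p x" .
      have "- a \<le> \<bar>a\<bar>" by (rule abs_ge_minus_self)
      then have "1 \<le> a + (\<bar>a\<bar> + 1)" by (simp add: algebra_simps)
      also have "\<dots> \<le> a + x * poly p x" using * by (rule add_left_mono)
      finally show ?thesis by simp
    qed
    then have "\<forall>x\<ge>max M (max 0 ((\<bar>a\<bar> + 1) / k)). poly (pCons a p) x \<ge> 1" by blast
    then have "\<exists>M. \<forall>x\<ge>M. poly (pCons a p) x \<ge> 1" by (rule exI)
    then have "(0::'f) < 1 \<and> (\<exists>M. \<forall>x\<ge>M. poly (pCons a p) x \<ge> 1)" by (simp only: zero_less_one simp_thms)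
    then show ?thesis by (rule exI)
  qed
qed

lemma sgn_poly_at_top:
  fixes p :: "'f::linordered_field poly"
  shows "\<exists>M. \<forall>x\<ge>M. sgn (poly p x) = sgn (Polynomial.lead_coeff p)"
proof -
  consider "p = 0" | "Polynomial.lead_coeff p > 0" | "Polynomial.lead_coeff (-p) > 0"
    by (metis lead_coeff_minus leading_coeff_0_iff neg_0_less_iff_less linorder_neqE)
  then show ?thesis
  proof cases
    case 2
    from poly_ge_at_top[OF this] obtain k M where "k > 0" "\<forall>x\<ge>M. poly p x \<ge> k" by blast
    then have "\<forall>x\<ge>M. poly p x > 0" by force
    then have "\<forall>x\<ge>M. sgn (poly p x) = sgn (Polynomial.lead_coeff p)" using 2 by simp
    then show ?thesis ..
  next
    case 3
    from poly_ge_at_top[OF this] obtain k M where "k > 0" "\<forall>x\<ge>M. poly (-p) x \<ge> k" by blast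
    then have "\<forall>x\<ge>M. poly p x < 0" by force
    then have "\<forall>x\<ge>M. sgn (poly p x) = sgn (Polynomial.lead_coeff p)" using 3 by (simp add: lead_coeff_minus)
    then show ?thesis ..
  qed auto
qed

lemma sgn_poly_at_bot:
  fixes p :: "'f::linordered_field poly"
  shows "\<exists>M. \<forall>x\<ge>M. sgn (poly p (-x)) = (-1) ^ Polynomial.degree p * sgn (Polynomial.lead_coeff p)"
proof -
  define q where "q = pcompose p [:0,-1:]"
  have "poly q x = poly p (-x)" for x by (simp add: q_def poly_pcompose)
  moreover have "Polynomial.lead_coeff q = Polynomial.lead_coeff p * (-1) ^ Polynomial.degree p"
    unfolding q_def by (subst lead_coeff_comp) simp_all
  moreover have "sgn ((-1::'f) ^ n) = (-1) ^ n" for n by (induction n) (auto simp: sgn_mult)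
  ultimately show ?thesis using sgn_poly_at_top[of q] by (simp add: sgn_mult mult.commute)
qed

text \<open>The arguments come from different ordered rings, so equality of \<open>sgn\<close>
  values would not even be well-typed.\<close>

definition same_sgn :: "'f::linordered_idom \<Rightarrow> 'g::linordered_idom \<Rightarrow> bool" where
  "same_sgn x y \<longleftrightarrow> (0 < x \<longleftrightarrow> 0 < y) \<and> (x < 0 \<longleftrightarrow> y < 0)"

lemma same_sgn_eq_0_iff: "same_sgn x y \<Longrightarrow> x = 0 \<longleftrightarrow> y = 0"
  unfolding same_sgn_def by (meson less_irrefl linorder_neqE)

lemma same_sgn_0 [simp]: "same_sgn 0 0"
  by (simp add: same_sgn_def)

lemma same_sgn_pos: "0 < x \<Longrightarrow> 0 < y \<Longrightarrow> same_sgn x y"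
  and same_sgn_neg: "x < 0 \<Longrightarrow> y < 0 \<Longrightarrow> same_sgn x y"
  by (auto simp: same_sgn_def)

lemma same_sgn_mult: "same_sgn x y \<Longrightarrow> same_sgn x' y' \<Longrightarrow> same_sgn (x * x') (y * y')"
  unfolding same_sgn_def zero_less_mult_iff mult_less_0_iff by blast

lemma same_sgn_power: "same_sgn x y \<Longrightarrow> same_sgn (x ^ n) (y ^ n)"
  by (induction n) (auto intro: same_sgn_mult, simp add: same_sgn_def)

text \<open>Serves to strip the power of the leading coefficient that pseudo-division leaves in
  front of the dividend.\<close>

lemma same_sgn_cancel:
  assumes "same_sgn (x * x') (y * y')" "same_sgn x y" "x \<noteq> 0"
  shows "same_sgn x' y'"
proof (cases "0 < x")
  case True
  then show ?thesis using assms(1,2) by (auto simp: same_sgn_def zero_less_mult_iff mult_less_0_iff)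
next
  case False
  then have "x < 0" using assms(3) by simp
  then show ?thesis using assms(1,2) by (auto simp: same_sgn_def zero_less_mult_iff mult_less_0_iff)
qed

lemma same_sgn_sgn_cong:
  assumes "same_sgn x y" "sgn x' = (-1) ^ n * sgn x" "sgn y' = (-1) ^ n * sgn y"
  shows "same_sgn x' y'"
proof -
  have "sgn x' = (if even n then sgn x else sgn (- x))" "sgn y' = (if even n then sgn y else sgn (- y))"
    using assms(2,3) by (simp_all add: sgn_minus)
  then show ?thesis using assms(1) unfolding same_sgn_def
    by (metis neg_0_less_iff_less neg_less_0_iff_less sgn_greater sgn_less)
qed

text \<open>Cutting at corresponding roots replaces the usual sorted lists of roots: when a polynomial joins the
  family, only the base pieces have to be refined.\<close>

inductive sign_match ::
    "'i set \<Rightarrow> ('i \<Rightarrow> 'f::rcf poly) \<Rightarrow> ('i \<Rightarrow> 'g::rcf poly) \<Rightarrow> 'f \<Rightarrow> 'f \<Rightarrow> 'g \<Rightarrow> 'g \<Rightarrow> bool"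
  for I p q where
  base: "a < b \<Longrightarrow> a' < b' \<Longrightarrow>
    (\<And>i x y. i \<in> I \<Longrightarrow> a < x \<Longrightarrow> x < b \<Longrightarrow> a' < y \<Longrightarrow> y < b' \<Longrightarrow> same_sgn (poly (p i) x) (poly (q i) y)) \<Longrightarrow>
    sign_match I p q a b a' b'"
| split: "sign_match I p q a c a' c' \<Longrightarrow> sign_match I p q c b c' b' \<Longrightarrow>
    i \<in> I \<Longrightarrow> p i \<noteq> 0 \<Longrightarrow> poly (p i) c = 0 \<Longrightarrow>
    (\<And>i. i \<in> I \<Longrightarrow> same_sgn (poly (p i) c) (poly (q i) c')) \<Longrightarrow>
    sign_match I p q a b a' b'"

lemma sign_match_realize:
  assumes "sign_match I p q a b a' b'" "a < x" "x < b"
  shows "\<exists>y. \<forall>i\<in>I. same_sgn (poly (p i) x) (poly (q i) y)"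
  using assms
proof (induction rule: sign_match.induct)
  case (base a b a' b')
  obtain y where "a' < y" "y < b'" using dense[OF base(2)] by blast
  then show ?case using base by blast
next
  case (split a c a' c' b b' i)
  then show ?case by (metis linorder_neqE)
qed

text \<open>At an existing cut the sign of the new polynomial is dictated by \<open>rem\<close>.
  Inside a base piece its derivative, a member of the family, has constant sign, so the new
  polynomial is strictly monotone or constant. It then has at most one root there or vanishes
  identically, and the signs at the ends, which agree in both fields, tell which.\<close>

lemma sign_match_insert:
  fixes p :: "'i \<Rightarrow> 'f::rcf poly" and q :: "'i \<Rightarrow> 'g::rcf poly"
  assumes "sign_match I p q a b a' b'"
    and d: "d \<in> I" "p d = pderiv (p j)" "q d = pderiv (q j)"
    and rem: "\<And>i x y. i \<in> I \<Longrightarrow> p i \<noteq> 0 \<Longrightarrow> poly (p i) x = 0 \<Longrightarrow> poly (q i) y = 0 \<Longrightarrow>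
        (\<And>k. k \<in> I \<Longrightarrow> same_sgn (poly (p k) x) (poly (q k) y)) \<Longrightarrow>
        same_sgn (poly (p j) x) (poly (q j) y)"
    and "same_sgn (poly (p j) a) (poly (q j) a')" "same_sgn (poly (p j) b) (poly (q j) b')"
  shows "sign_match (insert j I) p q a b a' b'"
  using assms(1,6,7)
proof (induction rule: sign_match.induct)
  case (split a c a' c' b b' i)
  have "poly (q i) c' = 0" using same_sgn_eq_0_iff[OF split.hyps(6)[OF split.hyps(3)]] split.hyps(5) by simp
  then have "same_sgn (poly (p j) c) (poly (q j) c')"
    by (intro rem[OF split.hyps(3-5)] split.hyps(6))
  note c = this
  show ?case
  proof (rule sign_match.split[where i=i and c=c and c'=c'])
    show "sign_match (insert j I) p q a c a' c'" by (rule split.IH(1)[OF split.prems(1) c])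
    show "sign_match (insert j I) p q c b c' b'" by (rule split.IH(2)[OF c split.prems(2)])
    show "same_sgn (poly (p k) c) (poly (q k) c')" if "k \<in> insert j I" for k
      using that c split.hyps(6) by blast
  qed (use split.hyps in auto)
next
  case (base a b a' b')
  obtain x0 where x0: "a < x0" "x0 < b" using dense[OF base(1)] by blast
  obtain y0 where y0: "a' < y0" "y0 < b'" using dense[OF base(2)] by blast
  note xy0 = x0 y0
  have single: "sign_match (insert j I) p q a b a' b'"
    if single: "\<And>x y. a < x \<Longrightarrow> x < b \<Longrightarrow> a' < y \<Longrightarrow> y < b' \<Longrightarrow> same_sgn (poly (p j) x) (poly (q j) y)"
  proof (rule sign_match.base[OF base(1,2)])
    show "same_sgn (poly (p i) x) (poly (q i) y)" if "i \<in> insert j I" "a < x" "x < b" "a' < y" "y < b'" for i x y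
      using \<open>i \<in> insert j I\<close> base(3)[OF _ that(2-)] single[OF that(2-)] by blast
  qed
  \<comment> \<open>One new root on each side: it becomes a cut, and the older members stay matched
    there and on both halves because they were matched for all pairs of points of the piece.\<close>
  have triple: "sign_match (insert j I) p q a b a' b'"
    if c: "a < c" "c < b" "poly (p j) c = 0" "a' < c'" "c' < b'" "poly (q j) c' = 0" "p j \<noteq> 0"
      and left: "\<And>x y. a < x \<Longrightarrow> x < c \<Longrightarrow> a' < y \<Longrightarrow> y < c' \<Longrightarrow> same_sgn (poly (p j) x) (poly (q j) y)"
      and right: "\<And>x y. c < x \<Longrightarrow> x < b \<Longrightarrow> c' < y \<Longrightarrow> y < b' \<Longrightarrow> same_sgn (poly (p j) x) (poly (q j) y)" for c c'
  proof (rule sign_match.split[where i = j and c = c and c' = c'])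
    show "sign_match (insert j I) p q a c a' c'"
    proof (rule sign_match.base[OF c(1,4)])
      show "same_sgn (poly (p i) x) (poly (q i) y)" if "i \<in> insert j I" "a < x" "x < c" "a' < y" "y < c'" for i x y
        using \<open>i \<in> insert j I\<close> base(3)[OF _ \<open>a < x\<close> less_trans[OF \<open>x < c\<close> c(2)] \<open>a' < y\<close> less_trans[OF \<open>y < c'\<close> c(5)]]
          left[OF that(2-)] by blast
    qed
    show "sign_match (insert j I) p q c b c' b'"
    proof (rule sign_match.base[OF c(2,5)])
      show "same_sgn (poly (p i) x) (poly (q i) y)" if "i \<in> insert j I" "c < x" "x < b" "c' < y" "y < b'" for i x y
        using \<open>i \<in> insert j I\<close> base(3)[OF _ less_trans[OF c(1) \<open>c < x\<close>] \<open>x < b\<close> less_trans[OF c(4) \<open>c' < y\<close>] \<open>y < b'\<close>]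
          right[OF that(2-)] by blast
    qed
    show "same_sgn (poly (p i) c) (poly (q i) c')" if "i \<in> insert j I" for i
      using that c(3,6) base(3)[OF _ c(1,2,4,5)] by (metis insertE same_sgn_0)
  qed (use c in auto)
  \<comment> \<open>The match holds for every pair of points, so the sign at \<open>x0\<close> fixes
    the sign on the whole second interval, and the sign at \<open>y0\<close> carries it back to the
    whole first one.\<close>
  have der: "same_sgn (poly (pderiv (p j)) x) (poly (pderiv (q j)) y)" if "a < x" "x < b" "a' < y" "y < b'" for x y
    using base(3)[OF d(1) that] d by simp
  consider "poly (pderiv (p j)) x0 > 0" | "poly (pderiv (p j)) x0 < 0" | "poly (pderiv (p j)) x0 = 0"
    by (meson linorder_neqE)
  then show ?case
  proof cases
    case 1
    then have dq: "poly (pderiv (q j)) y > 0" if "a' < y" "y < b'" for y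
      using der[OF xy0(1,2) that] by (auto simp: same_sgn_def)
    then have dp: "poly (pderiv (p j)) x > 0" if "a < x" "x < b" for x
      using der[OF that xy0(3,4)] xy0 by (auto simp: same_sgn_def)
    have mp: "poly (p j) x < poly (p j) y" if "a \<le> x" "x < y" "y \<le> b" for x y
      using that by (intro poly_strict_mono dp) auto
    have mq: "poly (q j) x < poly (q j) y" if "a' \<le> x" "x < y" "y \<le> b'" for x y
      using that by (intro poly_strict_mono dq) auto
    consider "poly (p j) a \<ge> 0" | "poly (p j) b \<le> 0" | "poly (p j) a < 0" "poly (p j) b > 0" by force
    then show ?thesis
    proof cases
      case 1
      then have "poly (q j) a' \<ge> 0" using base(4) by (auto simp: same_sgn_def not_less[symmetric])
      with 1 have "poly (p j) x > 0" "poly (q j) y > 0" if "a < x" "x < b" "a' < y" "y < b'" for x y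
        using mp[OF order_refl that(1) less_imp_le[OF that(2)]] mq[OF order_refl that(3) less_imp_le[OF that(4)]] by (metis order.strict_trans1 order.strict_trans2)+
      then show ?thesis by (intro single) (rule same_sgn_pos)
    next
      case 2
      then have "poly (q j) b' \<le> 0" using base(5) by (auto simp: same_sgn_def not_less[symmetric])
      with 2 have "poly (p j) x < 0" "poly (q j) y < 0" if "a < x" "x < b" "a' < y" "y < b'" for x y
        using mp[OF less_imp_le[OF that(1)] that(2) order_refl] mq[OF less_imp_le[OF that(3)] that(4) order_refl] by (metis order.strict_trans1 order.strict_trans2)+
      then show ?thesis by (intro single) (rule same_sgn_neg)
    next
      case 3
      then have 3: "poly (p j) a < 0" "poly (p j) b > 0" "poly (q j) a' < 0" "poly (q j) b' > 0"
        using base(4,5) by (auto simp: same_sgn_def)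
      obtain c where c: "a < c" "c < b" "poly (p j) c = 0" using rcf_ivt[OF base(1) 3(1,2)] by blast
      obtain c' where c': "a' < c'" "c' < b'" "poly (q j) c' = 0" using rcf_ivt[OF base(2) 3(3,4)] by blast
      show ?thesis
      proof (rule triple[OF c c'])
        show "p j \<noteq> 0" using 3 by auto
        show "same_sgn (poly (p j) x) (poly (q j) y)" if "a < x" "x < c" "a' < y" "y < c'" for x y
          using mp[OF less_imp_le[OF that(1)] that(2) less_imp_le[OF c(2)]] mq[OF less_imp_le[OF that(3)] that(4) less_imp_le[OF c'(2)]] c(3) c'(3) by (simp add: same_sgn_def)
        show "same_sgn (poly (p j) x) (poly (q j) y)" if "c < x" "x < b" "c' < y" "y < b'" for x y
          using mp[OF less_imp_le[OF c(1)] that(1) less_imp_le[OF that(2)]] mq[OF less_imp_le[OF c'(1)] that(3) less_imp_le[OF that(4)]] c(3) c'(3) by (simp add: same_sgn_def)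
      qed
    qed
  next
    case 2
    then have dq: "poly (pderiv (q j)) y < 0" if "a' < y" "y < b'" for y
      using der[OF xy0(1,2) that] by (auto simp: same_sgn_def)
    then have dp: "poly (pderiv (p j)) x < 0" if "a < x" "x < b" for x
      using der[OF that xy0(3,4)] xy0 by (auto simp: same_sgn_def)
    have mp: "poly (p j) y < poly (p j) x" if "a \<le> x" "x < y" "y \<le> b" for x y
      using that by (intro poly_strict_antimono dp) auto
    have mq: "poly (q j) y < poly (q j) x" if "a' \<le> x" "x < y" "y \<le> b'" for x y
      using that by (intro poly_strict_antimono dq) auto
    consider "poly (p j) a \<le> 0" | "poly (p j) b \<ge> 0" | "poly (p j) a > 0" "poly (p j) b < 0" by force
    then show ?thesis
    proof cases
      case 1
      then have "poly (q j) a' \<le> 0" using base(4) by (auto simp: same_sgn_def not_less[symmetric])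
      with 1 have "poly (p j) x < 0" "poly (q j) y < 0" if "a < x" "x < b" "a' < y" "y < b'" for x y
        using mp[OF order_refl that(1) less_imp_le[OF that(2)]] mq[OF order_refl that(3) less_imp_le[OF that(4)]] by (metis order.strict_trans1 order.strict_trans2)+
      then show ?thesis by (intro single) (rule same_sgn_neg)
    next
      case 2
      then have "poly (q j) b' \<ge> 0" using base(5) by (auto simp: same_sgn_def not_less[symmetric])
      with 2 have "poly (p j) x > 0" "poly (q j) y > 0" if "a < x" "x < b" "a' < y" "y < b'" for x y
        using mp[OF less_imp_le[OF that(1)] that(2) order_refl] mq[OF less_imp_le[OF that(3)] that(4) order_refl] by (metis order.strict_trans1 order.strict_trans2)+
      then show ?thesis by (intro single) (rule same_sgn_pos)
    next
      case 3
      then have 3: "poly (p j) a > 0" "poly (p j) b < 0" "poly (q j) a' > 0" "poly (q j) b' < 0"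
        using base(4,5) by (auto simp: same_sgn_def)
      obtain c where c: "a < c" "c < b" "poly (p j) c = 0"
        using rcf_ivt_sgn[OF base(1)] mult_pos_neg[OF 3(1,2)] by blast
      obtain c' where c': "a' < c'" "c' < b'" "poly (q j) c' = 0"
        using rcf_ivt_sgn[OF base(2)] mult_pos_neg[OF 3(3,4)] by blast
      show ?thesis
      proof (rule triple[OF c c'])
        show "p j \<noteq> 0" using 3 by auto
        show "same_sgn (poly (p j) x) (poly (q j) y)" if "a < x" "x < c" "a' < y" "y < c'" for x y
          using mp[OF less_imp_le[OF that(1)] that(2) less_imp_le[OF c(2)]] mq[OF less_imp_le[OF that(3)] that(4) less_imp_le[OF c'(2)]] c(3) c'(3) by (simp add: same_sgn_def)
        show "same_sgn (poly (p j) x) (poly (q j) y)" if "c < x" "x < b" "c' < y" "y < b'" for x y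
          using mp[OF less_imp_le[OF c(1)] that(1) less_imp_le[OF that(2)]] mq[OF less_imp_le[OF c'(1)] that(3) less_imp_le[OF that(4)]] c(3) c'(3) by (simp add: same_sgn_def)
      qed
    qed
  next
    case 3
    then have dq: "poly (pderiv (q j)) y = 0" if "a' < y" "y < b'" for y
      using same_sgn_eq_0_iff[OF der[OF xy0(1,2) that]] by simp
    then have dp: "poly (pderiv (p j)) x = 0" if "a < x" "x < b" for x
      using same_sgn_eq_0_iff[OF der[OF that xy0(3,4)]] xy0 by simp
    have "poly (p j) x = poly (p j) a" if "a < x" "x < b" for x
      using that by (intro poly_const_on dp) auto
    moreover have "poly (q j) x = poly (q j) a'" if "a' < x" "x < b'" for x
      using that by (intro poly_const_on dq) auto
    ultimately show ?thesis by (intro single) (simp add: base(4))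
  qed
qed

text \<open>Kept as a predicate on sets: the polynomials in some of the variables and the
  intermediate rings of an algebraic closure are all handled without a type of their own.\<close>

definition is_subring :: "'c::comm_ring_1 set \<Rightarrow> bool" where
  "is_subring C \<longleftrightarrow> 0 \<in> C \<and> 1 \<in> C \<and> (\<forall>x\<in>C. \<forall>y\<in>C. x + y \<in> C \<and> x * y \<in> C) \<and> (\<forall>x\<in>C. - x \<in> C)"

definition poly_over :: "'c::comm_ring_1 set \<Rightarrow> 'c poly set" where
  "poly_over C = {p. \<forall>i. coeff p i \<in> C}"

text \<open>The library's \<open>pderiv\<close> is restricted to coefficient rings without zero divisors.\<close>

definition formal_deriv :: "'c::comm_ring_1 poly \<Rightarrow> 'c poly" where
  "formal_deriv p = (\<Sum>i<degree p. monom (of_nat (Suc i) * coeff p (Suc i)) i)"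

lemma coeff_formal_deriv: "coeff (formal_deriv p) n = of_nat (Suc n) * coeff p (Suc n)"
  by (simp add: formal_deriv_def coeff_sum coeff_eq_0 del: of_nat_Suc)

context
  fixes C :: "'c::comm_ring_1 set"
  assumes C: "is_subring C"
begin

lemma subring_0: "0 \<in> C" and subring_1: "1 \<in> C"
  and subring_add: "x \<in> C \<Longrightarrow> y \<in> C \<Longrightarrow> x + y \<in> C"
  and subring_mult: "x \<in> C \<Longrightarrow> y \<in> C \<Longrightarrow> x * y \<in> C"
  and subring_uminus: "x \<in> C \<Longrightarrow> - x \<in> C"
  using C by (auto simp: is_subring_def)

lemma subring_diff: "x \<in> C \<Longrightarrow> y \<in> C \<Longrightarrow> x - y \<in> C"
  using subring_add[of x "-y"] subring_uminus by simp

lemma subring_of_nat: "of_nat n \<in> C"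
  by (induction n) (auto intro: subring_0 subring_1 subring_add)

lemma subring_sum: "(\<And>i. i \<in> A \<Longrightarrow> f i \<in> C) \<Longrightarrow> sum f A \<in> C"
  by (induction A rule: infinite_finite_induct) (auto intro: subring_0 subring_add)

lemma subring_power: "x \<in> C \<Longrightarrow> x ^ n \<in> C"
  by (induction n) (auto intro: subring_1 subring_mult)

lemma poly_over_add: "p \<in> poly_over C \<Longrightarrow> q \<in> poly_over C \<Longrightarrow> p + q \<in> poly_over C"
  and poly_over_diff: "p \<in> poly_over C \<Longrightarrow> q \<in> poly_over C \<Longrightarrow> p - q \<in> poly_over C"
  and poly_over_0: "0 \<in> poly_over C"
  and poly_over_monom: "c \<in> C \<Longrightarrow> monom c n \<in> poly_over C"
  and poly_over_smult: "c \<in> C \<Longrightarrow> p \<in> poly_over C \<Longrightarrow> smult c p \<in> poly_over C"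
  and poly_over_mult: "p \<in> poly_over C \<Longrightarrow> q \<in> poly_over C \<Longrightarrow> p * q \<in> poly_over C"
  by (auto simp: poly_over_def coeff_mult intro!: subring_add subring_diff subring_uminus subring_0
      subring_mult subring_sum)

lemma poly_over_formal_deriv: "p \<in> poly_over C \<Longrightarrow> formal_deriv p \<in> poly_over C"
  unfolding poly_over_def mem_Collect_eq coeff_formal_deriv by (intro allI subring_mult subring_of_nat) auto

lemma poly_over_pseudo_divmod_main:
  "lc \<in> C \<Longrightarrow> q \<in> poly_over C \<Longrightarrow> r \<in> poly_over C \<Longrightarrow> d \<in> poly_over C \<Longrightarrow>
   snd (pseudo_divmod_main lc q r d dr n) \<in> poly_over C"
proof (induction n arbitrary: q r dr)
  case (Suc n)
  have "coeff r dr \<in> C" using Suc.prems(3) by (simp add: poly_over_def)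
  then show ?case
    unfolding pseudo_divmod_main.simps Let_def
    by (intro Suc.IH poly_over_add poly_over_smult poly_over_monom poly_over_diff poly_over_mult Suc.prems)
qed simp

lemma poly_over_pseudo_divmod:
  assumes "p \<in> poly_over C" "q \<in> poly_over C"
  shows "snd (pseudo_divmod p q) \<in> poly_over C"
proof -
  have "coeff q (degree q) \<in> C" using assms(2) by (simp add: poly_over_def)
  then show ?thesis unfolding pseudo_divmod_def
    using assms by (auto intro!: poly_over_pseudo_divmod_main poly_over_0)
qed

end

section \<open>Elimination of one variable\<close>

text \<open>The operations of Cohen and Hoermander: truncation for the case that a leading
  coefficient is mapped to zero, derivatives for monotonicity between cuts, pseudo-remainders for
  signs at cuts. None of them divides, so all make sense before the coefficients are
  specialized.\<close>

inductive_set elim_closure :: "'c::comm_ring_1 poly set \<Rightarrow> 'c poly set" for L where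
  base: "p \<in> L \<Longrightarrow> p \<in> elim_closure L"
| trunc: "p \<in> elim_closure L \<Longrightarrow> 0 < degree p \<Longrightarrow> p - monom (lead_coeff p) (degree p) \<in> elim_closure L"
| deriv: "p \<in> elim_closure L \<Longrightarrow> 0 < degree p \<Longrightarrow> formal_deriv p \<in> elim_closure L"
| rem: "p \<in> elim_closure L \<Longrightarrow> q \<in> elim_closure L \<Longrightarrow> 0 < degree q \<Longrightarrow> degree q \<le> degree p \<Longrightarrow>
    snd (pseudo_divmod p q) \<in> elim_closure L"

lemma elim_closure_poly_over:
  assumes "is_subring C" "L \<subseteq> poly_over C"
  shows "elim_closure L \<subseteq> poly_over C"
proof
  fix p assume "p \<in> elim_closure L"
  then show "p \<in> poly_over C"
  proof induction
    case (trunc p)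
    then have "lead_coeff p \<in> C" by (simp add: poly_over_def)
    then show ?case by (intro poly_over_diff[OF assms(1)] poly_over_monom[OF assms(1)] trunc)
  qed (use assms in \<open>auto intro: poly_over_formal_deriv poly_over_pseudo_divmod\<close>)
qed

lemma degree_trunc_less:
  assumes "0 < degree p"
  shows "degree (p - monom (lead_coeff p) (degree p)) < degree (p :: 'c::comm_ring_1 poly)"
proof -
  let ?t = "p - monom (lead_coeff p) (degree p)"
  have "degree ?t \<le> degree p" by (intro degree_diff_le degree_monom_le order_refl)
  then have "?t = 0 \<or> degree ?t < degree p" by (rule eq_zero_or_degree_less) simp
  then show ?thesis using assms by auto
qed

lemma degree_formal_deriv_less:
  assumes "0 < degree p"
  shows "degree (formal_deriv p) < degree (p :: 'c::comm_ring_1 poly)"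
proof -
  have "degree (formal_deriv p) \<le> degree p - 1"
    by (rule degree_le) (auto simp: coeff_formal_deriv coeff_eq_0)
  then show ?thesis using assms by simp
qed

lemma degree_pseudo_rem_less:
  assumes "0 < degree q"
  shows "degree (snd (pseudo_divmod p q)) < degree (q :: 'c::comm_ring_1 poly)"
proof -
  have "q \<noteq> 0" using assms by auto
  from pseudo_divmod(2)[OF this prod.collapse[symmetric], of p] show ?thesis using assms by auto
qed

text \<open>Every operation yields a degree strictly below that of all its inputs. Hence the members
  of degree at least \<open>k\<close> arise from \<open>L\<close> and from the members of degree at
  least \<open>k + 1\<close>, and finiteness descends from the maximal degree to 0.\<close>

lemma finite_elim_closure:
  assumes "finite L"
  shows "finite (elim_closure L)"
proof -
  define N where "N = Max (insert 0 (degree ` L))"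
  have N: "degree p \<le> N" if "p \<in> elim_closure L" for p
    using that
  proof induction
    case (base p)
    then show ?case unfolding N_def by (intro Max_ge) (use assms in auto)
  next
    case (trunc p)
    then show ?case using degree_trunc_less[of p] by simp
  next
    case (deriv p)
    then show ?case using degree_formal_deriv_less[of p] by simp
  next
    case (rem p q)
    then show ?case using degree_pseudo_rem_less[of q p] by simp
  qed
  have "finite {p \<in> elim_closure L. k \<le> degree p}" if "k \<le> Suc N" for k
    using that
  proof (induction rule: inc_induct)
    case base
    have "{p \<in> elim_closure L. Suc N \<le> degree p} = {}" using N by force
    then show ?case by (simp only: finite.emptyI)
  next
    case (step k)
    let ?S = "{p \<in> elim_closure L. Suc k \<le> degree p}"
    have "{p \<in> elim_closure L. k \<le> degree p} \<subseteq>
        L \<union> (\<lambda>p. p - monom (lead_coeff p) (degree p)) ` ?S \<union> formal_deriv ` ?S \<union>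
        (\<lambda>(p, q). snd (pseudo_divmod p q)) ` (?S \<times> ?S)" (is "_ \<subseteq> ?R")
    proof (intro subsetI, elim CollectE conjE)
      fix p assume "p \<in> elim_closure L" "k \<le> degree p"
      then show "p \<in> ?R"
      proof cases
        case (trunc p')
        then have "p' \<in> ?S" using degree_trunc_less[of p'] \<open>k \<le> degree p\<close> by simp
        then show ?thesis using trunc(1) by blast
      next
        case (deriv p')
        then have "p' \<in> ?S" using degree_formal_deriv_less[of p'] \<open>k \<le> degree p\<close> by simp
        then show ?thesis using deriv(1) by blast
      next
        case (rem p' q)
        then have "p' \<in> ?S" "q \<in> ?S" using degree_pseudo_rem_less[of q p'] \<open>k \<le> degree p\<close> by auto
        then have "(p', q) \<in> ?S \<times> ?S" by blast
        then show ?thesis using rem(1) by force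
      qed simp
    qed
    then show ?case by (rule finite_subset) (use step.IH assms in auto)
  qed
  from this[of 0] show ?thesis by simp
qed

lemma finite_common_bound:
  fixes P :: "'i \<Rightarrow> 'f::linorder \<Rightarrow> bool"
  assumes "finite D" "\<And>i. i \<in> D \<Longrightarrow> \<exists>M. \<forall>x\<ge>M. P i x"
  shows "\<exists>M. \<forall>x\<ge>M. \<forall>i\<in>D. P i x"
  using assms
proof (induction D rule: finite_induct)
  case (insert i D)
  from insert.prems obtain M where M: "\<forall>x\<ge>M. P i x" by blast
  from insert obtain M' where M': "\<forall>x\<ge>M'. \<forall>i\<in>D. P i x" by blast
  have "\<forall>x\<ge>max M M'. \<forall>k\<in>insert i D. P k x" using M M' by simp
  then show ?case by blast
qed simp

lemma map_poly_formal_deriv: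
  fixes h :: "'a::comm_ring_1 \<Rightarrow> 'b::{comm_ring_1,semiring_no_zero_divisors}"
  assumes "comm_ring_hom h"
  shows "map_poly h (formal_deriv p) = pderiv (map_poly h p)"
proof -
  interpret comm_ring_hom h by fact
  show ?thesis by (rule poly_eqI) (simp add: coeff_formal_deriv coeff_pderiv hom_distribs)
qed

text \<open>The identity of pseudo-division survives the homomorphism, and at a root of the divisor
  only the remainder is left beside the scaled dividend.\<close>

lemma (in comm_ring_hom) poly_map_poly_pseudo_rem:
  assumes "0 < degree q" "poly (map_poly hom q) x = 0"
  shows "poly (map_poly hom (snd (pseudo_divmod p q))) x =
    hom (lead_coeff q) ^ (Suc (degree p) - degree q) * poly (map_poly hom p) x"
proof -
  interpret mp: map_poly_comm_ring_hom hom ..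
  obtain d r where dr: "pseudo_divmod p q = (d, r)" by fastforce
  have "q \<noteq> 0" using assms by auto
  from pseudo_divmod(1)[OF this dr]
  have "map_poly hom (smult (lead_coeff q ^ (Suc (degree p) - degree q)) p) = map_poly hom (q * d + r)"
    by simp
  then have "smult (hom (lead_coeff q) ^ (Suc (degree p) - degree q)) (map_poly hom p) =
      map_poly hom q * map_poly hom d + map_poly hom r"
    by (simp add: hom_distribs)
  from arg_cong[OF this, of "\<lambda>p. poly p x"] show ?thesis using assms(2) dr by simp
qed

text \<open>\<open>E\<close> collects all coefficients of the closure of \<open>L\<close>. Their
  signs fix the true degrees, the signs near both infinities and, by induction on the degree, the
  whole sign diagram. As \<open>E\<close> is chosen before the homomorphisms, one set serves every
  specialization.\<close>

theorem elimination:
  fixes L :: "'c::comm_ring_1 poly set"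
  assumes "finite L" "is_subring C" "L \<subseteq> poly_over C"
  shows "\<exists>E. finite E \<and> E \<subseteq> C \<and> (\<forall>(h1 :: 'c \<Rightarrow> 'f::rcf) (h2 :: 'c \<Rightarrow> 'g::rcf) x.
     comm_ring_hom h1 \<longrightarrow> comm_ring_hom h2 \<longrightarrow> (\<forall>e\<in>E. same_sgn (h1 e) (h2 e)) \<longrightarrow>
     (\<exists>y. \<forall>p\<in>L. same_sgn (poly (map_poly h1 p) x) (poly (map_poly h2 p) y)))"
proof -
  define K where "K = elim_closure L"
  define E where "E = (\<Union>p\<in>K. set (coeffs p))"
  have "finite K" unfolding K_def using assms(1) by (rule finite_elim_closure)
  then have "finite E" by (auto simp: E_def)
  have KC: "K \<subseteq> poly_over C" unfolding K_def using assms by (intro elim_closure_poly_over)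
  then have "coeff p i \<in> C" if "p \<in> K" for p i using that by (auto simp: poly_over_def)
  then have "E \<subseteq> C" by (auto simp: E_def coeffs_def split: if_splits)
  have "\<exists>y. \<forall>p\<in>L. same_sgn (poly (map_poly h1 p) x) (poly (map_poly h2 p) y)"
    if h1: "comm_ring_hom h1" and h2: "comm_ring_hom h2" and E: "\<forall>e\<in>E. same_sgn (h1 e) (h2 e)"
    for h1 :: "'c \<Rightarrow> 'f" and h2 :: "'c \<Rightarrow> 'g" and x
  proof -
    interpret h1: comm_ring_hom h1 by fact
    interpret h2: comm_ring_hom h2 by fact
    interpret mp1: map_poly_comm_ring_hom h1 ..
    interpret mp2: map_poly_comm_ring_hom h2 ..
    have lc: "same_sgn (h1 (lead_coeff p)) (h2 (lead_coeff p))" if "p \<in> K" for p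
    proof (cases "p = 0")
      case False
      then have "lead_coeff p \<in> set (coeffs p)" by (simp add: coeffs_def)
      then show ?thesis using E that by (auto simp: E_def)
    qed simp
    \<comment> \<open>The members whose formal degree survives specialization. Cutting off a leading
      coefficient that both homomorphisms kill changes neither image, so \<open>D\<close> still
      represents all of \<open>K\<close>.\<close>
    define D where "D = {p \<in> K. degree p = 0 \<or> h1 (lead_coeff p) \<noteq> 0}"
    have "finite D" using \<open>finite K\<close> by (simp add: D_def)
    have D2: "degree p = 0 \<or> h2 (lead_coeff p) \<noteq> 0" if "p \<in> D" for p
      using that same_sgn_eq_0_iff[OF lc] by (auto simp: D_def)
    have reduce: "\<exists>r\<in>D. degree r \<le> degree p \<and> map_poly h1 r = map_poly h1 p \<and> map_poly h2 r = map_poly h2 p"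
      if "p \<in> K" for p
      using that
    proof (induction "degree p" arbitrary: p rule: less_induct)
      case less
      show ?case
      proof (cases "p \<in> D")
        case False
        then have p: "0 < degree p" "h1 (lead_coeff p) = 0" using less.prems by (auto simp: D_def)
        then have "h2 (lead_coeff p) = 0" using same_sgn_eq_0_iff[OF lc[OF less.prems]] by simp
        let ?t = "p - monom (lead_coeff p) (degree p)"
        have "?t \<in> K" using less.prems p(1) unfolding K_def by (intro elim_closure.trunc)
        from less.hyps[OF degree_trunc_less[OF p(1)] this] obtain r where
          r: "r \<in> D" "degree r \<le> degree ?t" "map_poly h1 r = map_poly h1 ?t" "map_poly h2 r = map_poly h2 ?t"
          by blast
        have "map_poly h1 ?t = map_poly h1 p" "map_poly h2 ?t = map_poly h2 p"
          using p(2) \<open>h2 (lead_coeff p) = 0\<close> by (simp_all add: hom_distribs)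
        then show ?thesis using r degree_trunc_less[OF p(1)] by (intro bexI[of _ r]) auto
      qed auto
    qed
    have deg1: "degree (map_poly h1 p) = degree p" "lead_coeff (map_poly h1 p) = h1 (lead_coeff p)" if "p \<in> D" for p
    proof -
      show "degree (map_poly h1 p) = degree p"
      proof (cases "degree p = 0")
        case True
        then show ?thesis using degree_map_poly_le[of h1 p] by simp
      next
        case False
        then show ?thesis using that by (intro degree_map_poly) (auto simp: D_def)
      qed
      then show "lead_coeff (map_poly h1 p) = h1 (lead_coeff p)" by simp
    qed
    have deg2: "degree (map_poly h2 p) = degree p" "lead_coeff (map_poly h2 p) = h2 (lead_coeff p)" if "p \<in> D" for p
    proof -
      show "degree (map_poly h2 p) = degree p"
      proof (cases "degree p = 0")
        case True
        then show ?thesis using degree_map_poly_le[of h2 p] by simp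
      next
        case False
        then show ?thesis using D2[OF that] by (intro degree_map_poly) auto
      qed
      then show "lead_coeff (map_poly h2 p) = h2 (lead_coeff p)" by simp
    qed
    \<comment> \<open>Four bounds, two for each field, beyond which every member of \<open>D\<close>
      has the sign of its leading term.\<close>
    have "\<exists>M. \<forall>t\<ge>M. \<forall>p\<in>D. sgn (poly (map_poly h1 p) t) = sgn (h1 (lead_coeff p))"
    proof (rule finite_common_bound[OF \<open>finite D\<close>])
      show "\<exists>M. \<forall>t\<ge>M. sgn (poly (map_poly h1 p) t) = sgn (h1 (lead_coeff p))" if "p \<in> D" for p
        using sgn_poly_at_top[of "map_poly h1 p"] unfolding deg1(2)[OF that] unfolding deg1(1)[OF that] .
    qed
    then obtain A1 where A1: "\<And>t p. t \<ge> A1 \<Longrightarrow> p \<in> D \<Longrightarrow> sgn (poly (map_poly h1 p) t) = sgn (h1 (lead_coeff p))"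
      by blast
    have "\<exists>M. \<forall>t\<ge>M. \<forall>p\<in>D. sgn (poly (map_poly h1 p) (- t)) = (-1) ^ degree p * sgn (h1 (lead_coeff p))"
    proof (rule finite_common_bound[OF \<open>finite D\<close>])
      show "\<exists>M. \<forall>t\<ge>M. sgn (poly (map_poly h1 p) (- t)) = (-1) ^ degree p * sgn (h1 (lead_coeff p))" if "p \<in> D" for p
        using sgn_poly_at_bot[of "map_poly h1 p"] unfolding deg1(2)[OF that] unfolding deg1(1)[OF that] .
    qed
    then obtain B1 where B1: "\<And>t p. t \<ge> B1 \<Longrightarrow> p \<in> D \<Longrightarrow> sgn (poly (map_poly h1 p) (-t)) = (-1) ^ degree p * sgn (h1 (lead_coeff p))"
      by blast
    have "\<exists>M. \<forall>t\<ge>M. \<forall>p\<in>D. sgn (poly (map_poly h2 p) t) = sgn (h2 (lead_coeff p))"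
    proof (rule finite_common_bound[OF \<open>finite D\<close>])
      show "\<exists>M. \<forall>t\<ge>M. sgn (poly (map_poly h2 p) t) = sgn (h2 (lead_coeff p))" if "p \<in> D" for p
        using sgn_poly_at_top[of "map_poly h2 p"] unfolding deg2(2)[OF that] unfolding deg2(1)[OF that] .
    qed
    then obtain A2 where A2: "\<And>t p. t \<ge> A2 \<Longrightarrow> p \<in> D \<Longrightarrow> sgn (poly (map_poly h2 p) t) = sgn (h2 (lead_coeff p))"
      by blast
    have "\<exists>M. \<forall>t\<ge>M. \<forall>p\<in>D. sgn (poly (map_poly h2 p) (- t)) = (-1) ^ degree p * sgn (h2 (lead_coeff p))"
    proof (rule finite_common_bound[OF \<open>finite D\<close>])
      show "\<exists>M. \<forall>t\<ge>M. sgn (poly (map_poly h2 p) (- t)) = (-1) ^ degree p * sgn (h2 (lead_coeff p))" if "p \<in> D" for p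
        using sgn_poly_at_bot[of "map_poly h2 p"] unfolding deg2(2)[OF that] unfolding deg2(1)[OF that] .
    qed
    then obtain B2 where B2: "\<And>t p. t \<ge> B2 \<Longrightarrow> p \<in> D \<Longrightarrow> sgn (poly (map_poly h2 p) (-t)) = (-1) ^ degree p * sgn (h2 (lead_coeff p))"
      by blast
    \<comment> \<open>The summand with \<open>x\<close> puts \<open>x\<close> strictly between
      \<open>-a\<close> and \<open>a\<close>; the bound 1 in \<open>b\<close> only makes the second
      interval nonempty.\<close>
    define a where "a = max (max A1 B1) (\<bar>x\<bar> + 1)"
    define b where "b = max (max A2 B2) 1"
    have a: "a \<ge> A1" "a \<ge> B1" "\<bar>x\<bar> + 1 \<le> a" and b: "b \<ge> A2" "b \<ge> B2" "b \<ge> 1"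
      unfolding a_def b_def by auto
    have x: "- a < x" "x < a" "- a < a" using a(3) by (auto simp: abs_if split: if_splits)
    have "0 < b" using b(3) by linarith
    then have "- b < b" by simp
    have top: "same_sgn (poly (map_poly h1 p) a) (poly (map_poly h2 p) b)" if "p \<in> D" for p
      using that A1[OF a(1) that] A2[OF b(1) that] by (intro same_sgn_sgn_cong[OF lc, where n = 0]) (auto simp: D_def)
    have bot: "same_sgn (poly (map_poly h1 p) (-a)) (poly (map_poly h2 p) (-b))" if "p \<in> D" for p
      using that B1[OF a(2) that] B2[OF b(2) that] by (intro same_sgn_sgn_cong[OF lc]) (auto simp: D_def)
    \<comment> \<open>By increasing degree, so that the derivative of a newcomer and its remainders
      modulo the polynomials already present are in the family before it.\<close>
    have "sign_match {p \<in> D. degree p < Suc n} (map_poly h1) (map_poly h2) (-a) a (-b) b" for n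
    proof (induction n)
      case 0
      show ?case
      proof (rule sign_match.base[OF x(3) \<open>- b < b\<close>])
        fix p u v assume "p \<in> {p \<in> D. degree p < Suc 0}"
        then have "p \<in> K" "degree p = 0" by (auto simp: D_def)
        then obtain c where p: "p = [:c:]" using degree0_coeffs by blast
        show "same_sgn (poly (map_poly h1 p) u) (poly (map_poly h2 p) v)"
          using lc[OF \<open>p \<in> K\<close>] by (simp add: p hom_distribs)
      qed
    next
      case (Suc n)
      let ?I = "{p \<in> D. degree p < Suc n}"
      \<comment> \<open>Polynomials of equal degree enter one at a time. Dividing by an equal-degree
        member of \<open>Y\<close> is harmless, because the remainder has smaller degree and so
        represents in \<open>?I\<close>.\<close>
      have "sign_match (?I \<union> Y) (map_poly h1) (map_poly h2) (-a) a (-b) b"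
        if "finite Y" "Y \<subseteq> {p \<in> D. degree p = Suc n}" for Y
        using that
      proof (induction Y rule: finite_induct)
        case (insert j Y)
        have j: "j \<in> D" "degree j = Suc n" "j \<in> K" using insert.prems by (auto simp: D_def)
        have "formal_deriv j \<in> K" using j unfolding K_def by (intro elim_closure.deriv) auto
        from reduce[OF this] obtain d where d: "d \<in> D" "degree d \<le> degree (formal_deriv j)"
          "map_poly h1 d = pderiv (map_poly h1 j)" "map_poly h2 d = pderiv (map_poly h2 j)"
          unfolding map_poly_formal_deriv[OF h1] map_poly_formal_deriv[OF h2] by blast
        have "degree d < Suc n" using d(2) degree_formal_deriv_less[of j] j(2) by simp
        with d have dI: "d \<in> ?I \<union> Y" by simp
        have "sign_match (insert j (?I \<union> Y)) (map_poly h1) (map_poly h2) (-a) a (-b) b"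
        proof (rule sign_match_insert[OF _ dI d(3,4) _ bot[OF j(1)] top[OF j(1)]])
          show "sign_match (?I \<union> Y) (map_poly h1) (map_poly h2) (-a) a (-b) b"
            using insert.IH insert.prems by simp
          fix i u v
          assume i: "i \<in> ?I \<union> Y" "map_poly h1 i \<noteq> 0" "poly (map_poly h1 i) u = 0" "poly (map_poly h2 i) v = 0"
            and sg: "\<And>k. k \<in> ?I \<union> Y \<Longrightarrow> same_sgn (poly (map_poly h1 k) u) (poly (map_poly h2 k) v)"
          have iD: "i \<in> D" "degree i \<le> Suc n" using i(1) insert.prems by auto
          \<comment> \<open>Cuts are made only at roots of nonzero images, so the divisor cannot be
            constant.\<close>
          have "degree i \<noteq> 0"
          proof
            assume "degree i = 0"
            then obtain c where "i = [:c:]" using degree0_coeffs by blast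
            then show False using i(2,3) by (simp add: hom_distribs)
          qed
          then have di: "0 < degree i" by simp
          then have lci: "h1 (lead_coeff i) \<noteq> 0" "i \<in> K" using iD by (auto simp: D_def)
          let ?r = "snd (pseudo_divmod j i)"
          let ?k = "Suc (degree j) - degree i"
          have "?r \<in> K" using lci j iD di unfolding K_def by (intro elim_closure.rem) auto
          from reduce[OF this] obtain r where r: "r \<in> D" "degree r \<le> degree ?r"
            "map_poly h1 r = map_poly h1 ?r" "map_poly h2 r = map_poly h2 ?r" by blast
          have "degree r < Suc n" using r(2) degree_pseudo_rem_less[OF di, of j] iD(2) by simp
          with r have "r \<in> ?I \<union> Y" by simp
          from sg[OF this] have "same_sgn (h1 (lead_coeff i) ^ ?k * poly (map_poly h1 j) u)
              (h2 (lead_coeff i) ^ ?k * poly (map_poly h2 j) v)"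
            unfolding r(3,4) h1.poly_map_poly_pseudo_rem[OF di i(3)] h2.poly_map_poly_pseudo_rem[OF di i(4)] .
          then show "same_sgn (poly (map_poly h1 j) u) (poly (map_poly h2 j) v)"
            by (rule same_sgn_cancel) (use lci lc in \<open>auto intro: same_sgn_power\<close>)
        qed
        then show ?case by simp
      qed (use Suc.IH in simp)
      from this[of "{p \<in> D. degree p = Suc n}"] \<open>finite D\<close>
      have "sign_match (?I \<union> {p \<in> D. degree p = Suc n}) (map_poly h1) (map_poly h2) (-a) a (-b) b"
        by simp
      moreover have "?I \<union> {p \<in> D. degree p = Suc n} = {p \<in> D. degree p < Suc (Suc n)}" by auto
      ultimately show ?case by simp
    qed
    note match = this
    define N where "N = Max (degree ` D)"
    have "degree p < Suc N" if "p \<in> D" for p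
      unfolding N_def less_Suc_eq_le using that \<open>finite D\<close> by (intro Max_ge) auto
    then have "{p \<in> D. degree p < Suc N} = D" by blast
    with match[of N] have "sign_match D (map_poly h1) (map_poly h2) (-a) a (-b) b" by simp
    from sign_match_realize[OF this x(1,2)] obtain y where
      y: "\<And>p. p \<in> D \<Longrightarrow> same_sgn (poly (map_poly h1 p) x) (poly (map_poly h2 p) y)" by blast
    have "same_sgn (poly (map_poly h1 p) x) (poly (map_poly h2 p) y)" if "p \<in> L" for p
    proof -
      have "p \<in> K" using that unfolding K_def by (rule elim_closure.base)
      from reduce[OF this] obtain r where "r \<in> D" "map_poly h1 r = map_poly h1 p" "map_poly h2 r = map_poly h2 p"
        by blast
      with y[of r] show ?thesis by simp
    qed
    then show ?thesis by blast
  qed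
  then show ?thesis using \<open>finite E\<close> \<open>E \<subseteq> C\<close> by (intro exI[of _ E] conjI allI impI)
qed

section \<open>Transfer of sign patterns to real points\<close>

definition mconst :: "'a \<Rightarrow> ('d, 'a::zero) mpoly" where
  "mconst c = Poly_Mapping.single 0 c"

definition mvar :: "'d \<Rightarrow> ('d, real) mpoly" where
  "mvar i = Poly_Mapping.single (Poly_Mapping.single i 1) 1"

lemma mpoly_induct [case_names const var add mult]:
  fixes f :: "('d::finite, real) mpoly"
  assumes const: "\<And>c. P (mconst c)" and var: "\<And>i. P (mvar i)"
    and add: "\<And>f g. P f \<Longrightarrow> P g \<Longrightarrow> P (f + g)"
    and mult: "\<And>f g. P f \<Longrightarrow> P g \<Longrightarrow> P (f * g)"
  shows "P f"
proof -
  have one: "P 1" using const[of 1] by (simp add: mconst_def single_one)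
  have pow: "P f \<Longrightarrow> P (f ^ n)" for f n
    by (induction n) (auto intro: one mult)
  have "P (Poly_Mapping.single m c)" for m :: "'d \<Rightarrow>\<^sub>0 nat" and c :: real
  proof -
    have vp: "mvar i ^ k = Poly_Mapping.single (Poly_Mapping.single i k) 1" for i :: 'd and k
      by (induction k) (simp_all add: mvar_def mult_single single_add[symmetric])
    have "(\<Prod>i\<in>A. Poly_Mapping.single (Poly_Mapping.single i (Poly_Mapping.lookup m i)) (1::real)) =
        Poly_Mapping.single (\<Sum>i\<in>A. Poly_Mapping.single i (Poly_Mapping.lookup m i)) 1" for A :: "'d set"
      by (induction A rule: infinite_finite_induct) (simp_all add: mult_single)
    moreover have "(\<Sum>i\<in>UNIV. Poly_Mapping.single i (Poly_Mapping.lookup m i)) = m"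
      by (rule poly_mapping_eqI) (simp add: lookup_sum lookup_single when_def)
    ultimately have "Poly_Mapping.single m c = mconst c * (\<Prod>i\<in>UNIV. mvar i ^ Poly_Mapping.lookup m i)"
      by (simp add: vp mconst_def mult_single)
    moreover have "P (\<Prod>i\<in>A. mvar i ^ Poly_Mapping.lookup m i)" for A
      by (induction A rule: infinite_finite_induct) (auto intro: one mult pow var)
    ultimately show ?thesis by (auto intro: mult const)
  qed
  then have "P (\<Sum>m\<in>A. Poly_Mapping.single m (Poly_Mapping.lookup f m))" for A
  proof (induction A rule: infinite_finite_induct)
    case (insert m A)
    then show ?case by (auto intro: add)
  qed (use const[of 0] in \<open>auto simp: mconst_def\<close>)
  moreover have "(\<Sum>m\<in>Poly_Mapping.keys f. Poly_Mapping.single m (Poly_Mapping.lookup f m)) = f"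
    by (rule poly_mapping_eqI)
      (simp add: lookup_sum lookup_single when_def in_keys_iff)
  ultimately show ?thesis by metis
qed

lemma subst_superset:
  assumes "finite A" "Poly_Mapping.keys f \<subseteq> A" "c 0 = 0"
  shows "subst c s f = (\<Sum>m\<in>A. c (Poly_Mapping.lookup f m) * (\<Prod>i\<in>UNIV. s i ^ Poly_Mapping.lookup m i))"
  unfolding subst_def using assms
  by (intro sum.mono_neutral_left) (auto simp: in_keys_iff)

lemma subst_single:
  assumes "c 0 = 0"
  shows "subst c s (Poly_Mapping.single m a) = c a * (\<Prod>i\<in>UNIV. s i ^ Poly_Mapping.lookup m i)"
  by (subst subst_superset[where A = "{m}"]) (use assms in auto)

context
  fixes c :: "real \<Rightarrow> 'b::comm_ring_1" and s :: "'d::finite \<Rightarrow> 'b"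
  assumes c: "comm_ring_hom c"
begin

interpretation comm_ring_hom c by (rule c)

lemma subst_add: "subst c s (f + g) = subst c s f + subst c s g"
proof -
  let ?A = "Poly_Mapping.keys f \<union> Poly_Mapping.keys g"
  have "Poly_Mapping.keys (f + g) \<subseteq> ?A" by (rule Poly_Mapping.keys_add)
  then show ?thesis
    by (simp add: subst_superset[where A = ?A] lookup_add hom_distribs distrib_right sum.distrib)
qed

lemma subst_sum: "subst c s (sum f A) = (\<Sum>x\<in>A. subst c s (f x))"
  by (induction A rule: infinite_finite_induct) (auto simp: subst_add subst_def[of _ _ 0])

lemma subst_mult: "subst c s (f * g) = subst c s f * subst c s g"
proof -
  let ?t = "\<lambda>f m. Poly_Mapping.single m (Poly_Mapping.lookup f m) :: ('d, real) mpoly"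
  have decomp: "f = (\<Sum>m\<in>Poly_Mapping.keys f. ?t f m)" for f :: "('d, real) mpoly"
    by (rule poly_mapping_eqI) (simp add: lookup_sum lookup_single when_def in_keys_iff)
  have "f * g = (\<Sum>m\<in>Poly_Mapping.keys f. \<Sum>k\<in>Poly_Mapping.keys g. ?t f m * ?t g k)"
    by (subst decomp[of f], subst decomp[of g]) (rule sum_product)
  also have "subst c s \<dots> = (\<Sum>m\<in>Poly_Mapping.keys f. \<Sum>k\<in>Poly_Mapping.keys g. subst c s (?t f m) * subst c s (?t g k))"
    by (simp add: subst_sum mult_single subst_single hom_distribs lookup_add power_add prod.distrib mult_ac)
  also have "\<dots> = (\<Sum>m\<in>Poly_Mapping.keys f. subst c s (?t f m)) * (\<Sum>k\<in>Poly_Mapping.keys g. subst c s (?t g k))"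
    by (rule sum_product[symmetric])
  also have "\<dots> = subst c s f * subst c s g"
    by (simp flip: subst_sum decomp)
  finally show ?thesis .
qed

lemma subst_mconst: "subst c s (mconst a) = c a"
  by (simp add: mconst_def subst_single)

lemma subst_mvar: "subst c s (mvar i) = s i"
proof -
  have "(\<Prod>j\<in>UNIV. s j ^ Poly_Mapping.lookup (Poly_Mapping.single i (1::nat)) j) = (\<Prod>j\<in>{i}. s j)"
    by (rule prod.mono_neutral_cong_right) (auto simp: lookup_single when_def)
  then show ?thesis by (simp add: mvar_def subst_single)
qed

lemma comm_ring_hom_subst: "comm_ring_hom (subst c s)"
proof
  show "subst c s 0 = 0" by (simp add: subst_def)
  show "subst c s 1 = 1" using subst_mconst[of 1] by (simp add: mconst_def single_one)
qed (simp_all add: subst_add subst_mult)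

end

lemma comm_ring_hom_id: "comm_ring_hom (\<lambda>a::'a::comm_ring_1. a)"
  by standard auto

lemma comm_ring_hom_peval: "comm_ring_hom (\<lambda>f. peval f x)"
  unfolding peval_def by (rule comm_ring_hom_subst[OF comm_ring_hom_id])

global_interpretation peval: comm_ring_hom "\<lambda>f. peval f x" for x
  by (rule comm_ring_hom_peval)

lemma peval_mconst [simp]: "peval (mconst c) x = c"
  unfolding peval_def by (rule subst_mconst[OF comm_ring_hom_id])

lemma peval_mvar [simp]: "peval (mvar i) x = x $ i"
  unfolding peval_def by (rule subst_mvar[OF comm_ring_hom_id])

lemma comm_ring_hom_mconst: "comm_ring_hom (mconst :: real \<Rightarrow> ('d::finite, real) mpoly)"
  by standard (simp_all add: mconst_def single_add mult_single single_one)

global_interpretation mconst: comm_ring_hom "mconst :: real \<Rightarrow> ('d::finite, real) mpoly"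
  by (rule comm_ring_hom_mconst)

inductive_set mpoly_in :: "'d set \<Rightarrow> ('d::finite, real) mpoly set" for W where
  const: "mconst c \<in> mpoly_in W"
| var: "i \<in> W \<Longrightarrow> mvar i \<in> mpoly_in W"
| add: "f \<in> mpoly_in W \<Longrightarrow> g \<in> mpoly_in W \<Longrightarrow> f + g \<in> mpoly_in W"
| mult: "f \<in> mpoly_in W \<Longrightarrow> g \<in> mpoly_in W \<Longrightarrow> f * g \<in> mpoly_in W"

lemma mpoly_in_UNIV: "f \<in> mpoly_in UNIV"
  by (induction f rule: mpoly_induct) (auto intro: mpoly_in.intros)

lemma is_subring_mpoly_in: "is_subring (mpoly_in W)"
proof -
  have "0 \<in> mpoly_in W" "1 \<in> mpoly_in W"
    using mpoly_in.const[of 0 W] mpoly_in.const[of 1 W] by simp_all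
  moreover have "- f \<in> mpoly_in W" if "f \<in> mpoly_in W" for f
    using mpoly_in.mult[OF mpoly_in.const[of "-1" W] that] by (simp add: mconst.hom_uminus)
  ultimately show ?thesis by (auto simp: is_subring_def intro: mpoly_in.intros)
qed

lemma peval_cong_mpoly_in:
  fixes x y :: "real ^ 'd::finite"
  assumes "f \<in> mpoly_in W" "\<And>i. i \<in> W \<Longrightarrow> x $ i = y $ i"
  shows "peval f x = peval f y"
  using assms by (induction) (auto simp: hom_distribs)

text \<open>Lets one variable be eliminated inside a fixed ring: the coefficients involve fewer
  variables but remain elements of the same type.\<close>

lemma mpoly_in_insert_eq_poly:
  assumes "f \<in> mpoly_in (insert i W)"
  shows "\<exists>p\<in>poly_over (mpoly_in W). f = poly p (mvar i)"
  using assms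
proof induction
  case (const c)
  then show ?case
    by (intro bexI[of _ "[:mconst c:]"])
      (auto simp: poly_over_def coeff_pCons split: nat.splits intro: mpoly_in.const subring_0[OF is_subring_mpoly_in])
next
  case (var j)
  show ?case
  proof (cases "j = i")
    case True
    then show ?thesis
      by (intro bexI[of _ "[:0, 1:]"])
        (auto simp: poly_over_def coeff_pCons split: nat.splits intro: subring_1[OF is_subring_mpoly_in] subring_0[OF is_subring_mpoly_in])
  next
    case False
    then have "j \<in> W" using var by simp
    then show ?thesis
      by (intro bexI[of _ "[:mvar j:]"])
        (auto simp: poly_over_def coeff_pCons split: nat.splits intro: mpoly_in.var subring_0[OF is_subring_mpoly_in])
  qed
next
  case (add f g)
  then show ?case using poly_over_add[OF is_subring_mpoly_in] by (metis poly_add)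
next
  case (mult f g)
  then show ?case using poly_over_mult[OF is_subring_mpoly_in] by (metis poly_mult)
qed

text \<open>Tarski transfer; the coordinates are specialized one at a time.\<close>

theorem sign_transfer:
  fixes \<phi> :: "('d::finite, real) mpoly \<Rightarrow> 's::rcf"
  assumes hom: "comm_ring_hom \<phi>" and "finite F"
  shows "\<exists>x. \<forall>f\<in>F. same_sgn (\<phi> f) (peval f x)"
proof -
  interpret \<phi>: comm_ring_hom \<phi> by fact
  \<comment> \<open>Nothing is assumed about how the reals sit in the other field. Positive reals
    are squares, so any ring homomorphism into an ordered field respects their signs.\<close>
  have const: "same_sgn (\<phi> (mconst c)) c" for c :: real
  proof -
    have pos: "\<phi> (mconst c) > 0" if "c > 0" for c :: real
    proof -
      have "\<phi> (mconst c) * \<phi> (mconst (1 / c)) = 1"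
        using that by (simp flip: \<phi>.hom_mult mconst.hom_mult)
      then have "\<phi> (mconst c) \<noteq> 0" by auto
      moreover have "\<phi> (mconst c) = \<phi> (mconst (sqrt c)) ^ 2"
        using that by (simp add: power2_eq_square flip: \<phi>.hom_mult mconst.hom_mult)
      ultimately show ?thesis by (metis zero_less_power2 power2_eq_square mult_eq_0_iff)
    qed
    consider "c > 0" | "c = 0" | "- c > 0" by force
    then show ?thesis
    proof cases
      case 1 then show ?thesis using pos[OF 1] by (intro same_sgn_pos)
    next
      case 3
      from pos[OF this] show ?thesis using 3 by (intro same_sgn_neg) (simp_all add: mconst.hom_uminus \<phi>.hom_uminus)
    qed simp
  qed
  have "finite W \<Longrightarrow> finite F \<Longrightarrow> F \<subseteq> mpoly_in W \<Longrightarrow> \<exists>x. \<forall>f\<in>F. same_sgn (\<phi> f) (peval f x)" for W F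
  proof (induction W arbitrary: F rule: finite_induct)
    case empty
    have "same_sgn (\<phi> f) (peval f x)" if "f \<in> mpoly_in {}" for f x
    proof -
      from that have "\<exists>c. f = mconst c"
        by induction (auto simp flip: mconst.hom_add mconst.hom_mult)
      then show ?thesis using const by auto
    qed
    then show ?case using empty by blast
  next
    case (insert i W)
    have "\<forall>f\<in>F. \<exists>p. p \<in> poly_over (mpoly_in W) \<and> f = poly p (mvar i)"
      using mpoly_in_insert_eq_poly insert.prems by blast
    then obtain P where P: "\<And>f. f \<in> F \<Longrightarrow> P f \<in> poly_over (mpoly_in W)" "\<And>f. f \<in> F \<Longrightarrow> f = poly (P f) (mvar i)"
      by metis
    have "finite (P ` F)" "P ` F \<subseteq> poly_over (mpoly_in W)" using insert.prems P by auto
    from elimination[OF this(1) is_subring_mpoly_in this(2), where 'f = 's and 'g = real]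
    obtain E where E: "finite E" "E \<subseteq> mpoly_in W"
      and elim: "\<And>(h1 :: ('d, real) mpoly \<Rightarrow> 's) (h2 :: ('d, real) mpoly \<Rightarrow> real) x.
        comm_ring_hom h1 \<Longrightarrow> comm_ring_hom h2 \<Longrightarrow> (\<forall>e\<in>E. same_sgn (h1 e) (h2 e)) \<Longrightarrow>
        \<exists>y. \<forall>p\<in>P ` F. same_sgn (poly (map_poly h1 p) x) (poly (map_poly h2 p) y)"
      by metis
    from insert.IH[OF E] obtain x where x: "\<forall>f\<in>E. same_sgn (\<phi> f) (peval f x)" by blast
    from elim[OF hom comm_ring_hom_peval x, of "\<phi> (mvar i)"] obtain y where
      y: "\<And>f. f \<in> F \<Longrightarrow> same_sgn (poly (map_poly \<phi> (P f)) (\<phi> (mvar i))) (poly (map_poly (\<lambda>f. peval f x) (P f)) y)"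
      by blast
    \<comment> \<open>Only coordinate \<open>i\<close> moves. The coefficients of \<open>P f\<close>
      do not involve it and keep their values.\<close>
    define x' where "x' = (\<chi> j. if j = i then y else x $ j)"
    have "same_sgn (\<phi> f) (peval f x')" if "f \<in> F" for f
    proof -
      have "peval (coeff (P f) k) x = peval (coeff (P f) k) x'" for k
        using P(1)[OF that] insert.hyps(2) by (intro peval_cong_mpoly_in[of _ W]) (auto simp: x'_def poly_over_def)
      then have "map_poly (\<lambda>f. peval f x) (P f) = map_poly (\<lambda>f. peval f x') (P f)"
        by (intro poly_eqI) simp
      moreover have "peval (mvar i) x' = y" by (simp add: x'_def)
      ultimately have "poly (map_poly (\<lambda>f. peval f x) (P f)) y = peval (poly (P f) (mvar i)) x'"
        by (metis peval.poly_map_poly)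
      then show ?thesis using y[OF that] by (simp add: P(2)[OF that, symmetric])
    qed
    then show ?case by blast
  qed
  from this[OF finite assms(2)] show ?thesis using mpoly_in_UNIV by blast
qed

section \<open>The real closure of an ordered field\<close>

text \<open>One set encodes an ordered subfield. Closure under inverses makes the differences
  \<open>P - P\<close> a field, and squares are required only for such differences, since in the
  algebraic closure -1 is itself a square. Enlarging \<open>P\<close> may thus enlarge the field as
  well as the order.\<close>

definition partial_cone :: "'a::linordered_field alg_closure set \<Rightarrow> bool" where
  "partial_cone P \<longleftrightarrow>
     (\<forall>x\<in>P. \<forall>y\<in>P. x + y \<in> P \<and> x * y \<in> P \<and> (x - y) * (x - y) \<in> P) \<and>
     (\<forall>x\<in>P. inverse x \<in> P) \<and> (\<forall>a\<ge>0. to_ac a \<in> P) \<and> - 1 \<notin> P"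

definition cone_field :: "'a::linordered_field alg_closure set \<Rightarrow> 'a alg_closure set" where
  "cone_field P = {x - y |x y. x \<in> P \<and> y \<in> P}"

lemma maximal_partial_cone_exists:
  "\<exists>P. partial_cone (P :: 'a::linordered_field alg_closure set) \<and> (\<forall>Q. partial_cone Q \<longrightarrow> P \<subseteq> Q \<longrightarrow> Q = P)"
proof -
  have "partial_cone (to_ac ` {0..} :: 'a alg_closure set)"
    unfolding partial_cone_def
  proof (intro conjI ballI allI impI)
    show "- 1 \<notin> (to_ac ` {0..} :: 'a alg_closure set)"
    proof
      assume "- 1 \<in> (to_ac ` {0..} :: 'a alg_closure set)"
      then obtain a :: 'a where "a \<ge> 0" "to_ac a = - 1" by auto
      then have "to_ac a = to_ac (-1)" by simp
      then have "a = -1" unfolding to_ac_eq_iff .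
      with \<open>a \<ge> 0\<close> show False by simp
    qed
  qed (auto simp flip: to_ac_add to_ac_mult to_ac_diff to_ac_inverse intro!: imageI)
  then have ne: "{P :: 'a alg_closure set. partial_cone P} \<noteq> {}" by blast
  have "\<exists>M\<in>{P :: 'a alg_closure set. partial_cone P}. \<forall>Y\<in>{P. partial_cone P}. M \<subseteq> Y \<longrightarrow> Y = M"
  proof (rule subset_Zorn_nonempty[OF ne])
    fix C :: "'a alg_closure set set"
    assume "C \<noteq> {}" and chain: "subset.chain {P. partial_cone P} C"
    then have sub: "\<And>P. P \<in> C \<Longrightarrow> partial_cone P"
      and lin: "\<And>P Q. P \<in> C \<Longrightarrow> Q \<in> C \<Longrightarrow> P \<subseteq> Q \<or> Q \<subseteq> P"
      by (auto simp: subset.chain_def)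
    have two: "\<exists>P\<in>C. x \<in> P \<and> y \<in> P" if "x \<in> \<Union>C" "y \<in> \<Union>C" for x y
      using that lin by blast
    have "partial_cone (\<Union>C)" unfolding partial_cone_def
    proof (intro conjI ballI allI impI)
      fix x y assume "x \<in> \<Union>C" "y \<in> \<Union>C"
      then obtain P where "P \<in> C" "x \<in> P" "y \<in> P" using two by blast
      then show "x + y \<in> \<Union>C" "x * y \<in> \<Union>C" "(x - y) * (x - y) \<in> \<Union>C"
        using sub[OF \<open>P \<in> C\<close>] by (auto simp: partial_cone_def)
    next
      fix x assume "x \<in> \<Union>C"
      then show "inverse x \<in> \<Union>C" using sub by (auto simp: partial_cone_def)
    next
      fix a :: 'a assume "0 \<le> a"
      then show "to_ac a \<in> \<Union>C" using sub \<open>C \<noteq> {}\<close> by (fastforce simp: partial_cone_def)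
    next
      show "- 1 \<notin> \<Union>C" using sub by (auto simp: partial_cone_def)
    qed
    then show "\<Union>C \<in> {P. partial_cone P}" by simp
  qed
  then show ?thesis by blast
qed

definition max_cone :: "'a::linordered_field alg_closure set" where
  "max_cone = (SOME P. partial_cone P \<and> (\<forall>Q. partial_cone Q \<longrightarrow> P \<subseteq> Q \<longrightarrow> Q = P))"

lemma max_cone_spec:
  "partial_cone (max_cone :: 'a::linordered_field alg_closure set) \<and>
   (\<forall>Q. partial_cone Q \<longrightarrow> (max_cone :: 'a alg_closure set) \<subseteq> Q \<longrightarrow> Q = max_cone)"
  using someI_ex[OF maximal_partial_cone_exists[where 'a = 'a]] unfolding max_cone_def .

lemmas max_cone = max_cone_spec[THEN conjunct1]

lemma max_cone_maximal: "partial_cone Q \<Longrightarrow> max_cone \<subseteq> Q \<Longrightarrow> Q = max_cone"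
  using max_cone_spec by blast

section \<open>Arithmetic of a cone and of the field it spans\<close>

context
  fixes P :: "'a::linordered_field alg_closure set"
  assumes P: "partial_cone P"
begin

lemma partial_cone_add: "x \<in> P \<Longrightarrow> y \<in> P \<Longrightarrow> x + y \<in> P"
  and partial_cone_mult: "x \<in> P \<Longrightarrow> y \<in> P \<Longrightarrow> x * y \<in> P"
  and partial_cone_inverse: "x \<in> P \<Longrightarrow> inverse x \<in> P"
  and partial_cone_to_ac: "a \<ge> 0 \<Longrightarrow> to_ac a \<in> P"
  and partial_cone_minus_1: "- 1 \<notin> P"
  using P by (auto simp: partial_cone_def)

lemma partial_cone_0: "0 \<in> P" and partial_cone_1: "1 \<in> P"
  using partial_cone_to_ac[of 0] partial_cone_to_ac[of 1] by auto

lemma partial_cone_square: "x \<in> cone_field P \<Longrightarrow> x * x \<in> P"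
  using P by (auto simp: partial_cone_def cone_field_def)

lemma cone_subset_field: "P \<subseteq> cone_field P"
proof
  fix x assume "x \<in> P"
  then have "x - 0 \<in> cone_field P" using partial_cone_0 unfolding cone_field_def by blast
  then show "x \<in> cone_field P" by simp
qed

lemma is_subring_cone_field: "is_subring (cone_field P)"
proof -
  have "x + y \<in> cone_field P" "x * y \<in> cone_field P" if xy: "x \<in> cone_field P" "y \<in> cone_field P" for x y
  proof -
    from xy obtain a b c d where *: "a \<in> P" "b \<in> P" "c \<in> P" "d \<in> P" "x = a - b" "y = c - d"
      unfolding cone_field_def by blast
    have "x + y = (a + c) - (b + d)" "x * y = (a * c + b * d) - (a * d + b * c)"
      unfolding *(5,6) by (simp_all add: algebra_simps)
    then show "x + y \<in> cone_field P" "x * y \<in> cone_field P"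
      unfolding cone_field_def using * by (blast intro: partial_cone_add partial_cone_mult)+
  qed
  moreover have "- x \<in> cone_field P" if "x \<in> cone_field P" for x
    using that minus_diff_eq unfolding cone_field_def by blast
  ultimately show ?thesis
    using partial_cone_0 partial_cone_1 cone_subset_field by (auto simp: is_subring_def)
qed

lemma to_ac_in_cone_field: "to_ac a \<in> cone_field P"
proof (cases "a \<ge> 0")
  case True
  then show ?thesis using partial_cone_to_ac cone_subset_field by blast
next
  case False
  then have "to_ac (- a) \<in> cone_field P" using partial_cone_to_ac[of "-a"] cone_subset_field by auto
  from subring_uminus[OF is_subring_cone_field this] show ?thesis by simp
qed

lemma cone_field_inverse: "x \<in> cone_field P \<Longrightarrow> inverse x \<in> cone_field P"
proof (cases "x = 0")
  case False
  assume x: "x \<in> cone_field P"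
  then have "inverse (x * x) \<in> cone_field P" using partial_cone_inverse[OF partial_cone_square] cone_subset_field by blast
  from subring_mult[OF is_subring_cone_field x this] False show ?thesis by (simp add: field_simps)
qed simp

end

text \<open>After factors of the indeterminate are removed, an algebraic equation of a nonzero
  \<open>x\<close> reads \<open>a + x * q(x) = 0\<close> with \<open>a\<close> nonzero, so the
  inverse is \<open>- q(x) / a\<close>, a polynomial expression in \<open>x\<close>.\<close>

lemma subring_inverse_algebraic:
  fixes x :: "'a::linordered_field alg_closure"
  assumes L: "is_subring L" "range to_ac \<subseteq> L" and x: "x \<in> L"
  shows "inverse x \<in> L"
proof (cases "x = 0")
  case False
  obtain p :: "'a poly" where "p \<noteq> 0" "poly (map_poly to_ac p) x = 0" by (rule alg_closure_algebraic)
  then show ?thesis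
  proof (induction p)
    case (pCons a p)
    have eq: "to_ac a + x * poly (map_poly to_ac p) x = 0"
      using pCons.prems(2) unfolding Polynomial.map_poly_pCons[where f = to_ac, OF to_ac_0] by simp
    show ?case
    proof (cases "a = 0")
      case True
      then show ?thesis using pCons eq False by auto
    next
      case a: False
      let ?q = "poly (map_poly to_ac p) x"
      have q: "?q \<in> L" unfolding poly_altdef
        using L(2) by (intro subring_sum[OF L(1)] subring_mult[OF L(1)] subring_power[OF L(1)] x) (auto simp: coeff_map_poly)
      have "x * ?q = - to_ac a" using eq by (simp add: add_eq_0_iff)
      then have "x * (- (?q * to_ac (inverse a))) = to_ac a * to_ac (inverse a)"
        by (simp only: mult_minus_right mult.assoc[symmetric] minus_mult_left minus_minus)
      also have "\<dots> = 1" using a by simp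
      finally have "x * (- (?q * to_ac (inverse a))) = 1" .
      then have "inverse x = - (?q * to_ac (inverse a))" by (rule inverse_unique)
      moreover have "to_ac (inverse a) \<in> L" using L(2) by blast
      ultimately show ?thesis using q by (simp only: subring_uminus[OF L(1)] subring_mult[OF L(1)])
    qed
  qed simp
qed (use subring_0[OF L(1)] in simp)

text \<open>If \<open>x\<close> is outside, \<open>-x\<close> can be adjoined: the elements
  \<open>a - x * b\<close> form a cone in the same field, for -1 among them would give
  \<open>x = (1 + a) / b\<close>, an element of the cone. By maximality nothing was added, so
  \<open>-x\<close> was present.\<close>

lemma max_cone_total:
  assumes x: "x \<in> cone_field max_cone"
  shows "x \<in> max_cone \<or> - x \<in> (max_cone :: 'a::linordered_field alg_closure set)"
proof (cases "x \<in> max_cone")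
  case nx: False
  note C = max_cone[where 'a = 'a]
  note sub = is_subring_cone_field[OF C]
  note P = partial_cone_add[OF C] partial_cone_mult[OF C] partial_cone_inverse[OF C] partial_cone_0[OF C] partial_cone_1[OF C]
  define Q where "Q = {a - x * b | a b. a \<in> max_cone \<and> b \<in> max_cone}"
  have xx: "x * x \<in> max_cone" using partial_cone_square[OF C x] .
  have PQ: "max_cone \<subseteq> Q"
  proof
    fix a :: "'a alg_closure" assume "a \<in> max_cone"
    then have "a - x * 0 \<in> Q" using P(4) unfolding Q_def by blast
    then show "a \<in> Q" by simp
  qed
  have QL: "Q \<subseteq> cone_field max_cone"
    using cone_subset_field[OF C] x by (auto simp: Q_def intro!: subring_diff[OF sub] subring_mult[OF sub])
  have Qmult: "u * v \<in> Q" if "u \<in> Q" "v \<in> Q" for u v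
  proof -
    from that obtain a b c d where *: "a \<in> max_cone" "b \<in> max_cone" "c \<in> max_cone" "d \<in> max_cone"
      "u = a - x * b" "v = c - x * d" unfolding Q_def by blast
    have "u * v = (a * c + x * x * (b * d)) - x * (a * d + b * c)" unfolding *(5,6) by (simp add: algebra_simps)
    then show ?thesis unfolding Q_def using * xx by (blast intro: P)
  qed
  have "partial_cone Q" unfolding partial_cone_def
  proof (intro conjI ballI allI impI)
    fix u v assume uv: "u \<in> Q" "v \<in> Q"
    then obtain a b c d where *: "a \<in> max_cone" "b \<in> max_cone" "c \<in> max_cone" "d \<in> max_cone"
      "u = a - x * b" "v = c - x * d" unfolding Q_def by blast
    have "u + v = (a + c) - x * (b + d)" unfolding *(5,6) by (simp add: algebra_simps)
    then show "u + v \<in> Q" unfolding Q_def using * by (blast intro: P)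
    show "u * v \<in> Q" by (rule Qmult[OF uv])
    have "u - v \<in> cone_field max_cone" using uv QL by (auto intro: subring_diff[OF sub])
    then show "(u - v) * (u - v) \<in> Q" using partial_cone_square[OF C] PQ by blast
  next
    fix u assume u: "u \<in> Q"
    then have "inverse u \<in> cone_field max_cone" using QL cone_field_inverse[OF C] by blast
    then have "inverse u * inverse u \<in> Q" using partial_cone_square[OF C] PQ by blast
    from Qmult[OF u this] show "inverse u \<in> Q" by (cases "u = 0") (simp_all add: field_simps)
  next
    show "to_ac a \<in> Q" if "a \<ge> 0" for a using partial_cone_to_ac[OF C that] PQ by blast
  next
    show "- 1 \<notin> Q"
    proof
      assume "- 1 \<in> Q"
      then obtain a b where ab: "a \<in> max_cone" "b \<in> max_cone" "- 1 = a - x * b" unfolding Q_def by blast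
      then have eq: "x * b = 1 + a" by (metis add_diff_cancel_left' diff_add_cancel minus_diff_eq add.commute add_uminus_conv_diff diff_minus_eq_add)
      show False
      proof (cases "b = 0")
        case True
        with ab(3) have "- 1 = a" by simp
        with ab(1) partial_cone_minus_1[OF C] show False by metis
      next
        case False
        then have "x = (1 + a) * inverse b" using eq by (simp add: field_simps)
        then show False using nx ab P by simp
      qed
    qed
  qed
  from max_cone_maximal[OF this PQ] have "Q = max_cone" .
  moreover have "0 - x * 1 \<in> Q" unfolding Q_def using P by blast
  ultimately show ?thesis by simp
qed simp

lemma max_cone_antisym:
  assumes "x \<in> max_cone" "- x \<in> (max_cone :: 'a::linordered_field alg_closure set)"
  shows "x = 0"
proof (rule ccontr)
  note C = max_cone[where 'a = 'a]
  assume "x \<noteq> 0"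
  then have "- x * inverse x = - 1" by simp
  moreover have "- x * inverse x \<in> max_cone"
    using assms by (intro partial_cone_mult[OF C] partial_cone_inverse[OF C])
  ultimately show False using partial_cone_minus_1[OF C] by simp
qed

lemma max_cone_mult_strict:
  fixes x y z :: "'a::linordered_field alg_closure"
  assumes "y - x \<in> max_cone" "x - y \<notin> max_cone" "z \<in> max_cone" "- z \<notin> max_cone"
  shows "z * y - z * x \<in> max_cone" "z * x - z * y \<notin> max_cone"
proof -
  note C = max_cone[where 'a = 'a]
  have *: "z * (y - x) \<in> max_cone" using partial_cone_mult[OF C assms(3,1)] .
  then show "z * y - z * x \<in> max_cone" by (simp add: right_diff_distrib)
  show "z * x - z * y \<notin> max_cone"
  proof
    assume "z * x - z * y \<in> max_cone"
    then have "- (z * (y - x)) \<in> max_cone" by (simp add: right_diff_distrib)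
    from max_cone_antisym[OF * this] have "z = 0 \<or> x = y" by auto
    then show False using assms partial_cone_0[OF C] by auto
  qed
qed

typedef (overloaded) 'a :: linordered_field real_closure = "cone_field (max_cone :: 'a alg_closure set)"
  morphisms rc_rep rc_abs
  using subring_0[OF is_subring_cone_field[OF max_cone]] by blast

setup_lifting type_definition_real_closure

instantiation real_closure :: (linordered_field) linordered_field
begin

lift_definition zero_real_closure :: "'a real_closure" is 0
  by (rule subring_0[OF is_subring_cone_field[OF max_cone]])
lift_definition one_real_closure :: "'a real_closure" is 1
  by (rule subring_1[OF is_subring_cone_field[OF max_cone]])
lift_definition plus_real_closure :: "'a real_closure \<Rightarrow> 'a real_closure \<Rightarrow> 'a real_closure" is "(+)"
  by (rule subring_add[OF is_subring_cone_field[OF max_cone]])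
lift_definition times_real_closure :: "'a real_closure \<Rightarrow> 'a real_closure \<Rightarrow> 'a real_closure" is "(*)"
  by (rule subring_mult[OF is_subring_cone_field[OF max_cone]])
lift_definition minus_real_closure :: "'a real_closure \<Rightarrow> 'a real_closure \<Rightarrow> 'a real_closure" is "(-)"
  by (rule subring_diff[OF is_subring_cone_field[OF max_cone]])
lift_definition uminus_real_closure :: "'a real_closure \<Rightarrow> 'a real_closure" is uminus
  by (rule subring_uminus[OF is_subring_cone_field[OF max_cone]])
lift_definition inverse_real_closure :: "'a real_closure \<Rightarrow> 'a real_closure" is inverse
  by (rule cone_field_inverse[OF max_cone])
definition divide_real_closure :: "'a real_closure \<Rightarrow> 'a real_closure \<Rightarrow> 'a real_closure" where
  "divide_real_closure x y = x * inverse y"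
lift_definition less_eq_real_closure :: "'a real_closure \<Rightarrow> 'a real_closure \<Rightarrow> bool" is
  "\<lambda>x y. y - x \<in> max_cone" .
definition less_real_closure :: "'a real_closure \<Rightarrow> 'a real_closure \<Rightarrow> bool" where
  "less_real_closure x y \<longleftrightarrow> x \<le> y \<and> \<not> y \<le> x"
definition abs_real_closure :: "'a real_closure \<Rightarrow> 'a real_closure" where
  "abs_real_closure x = (if x < 0 then - x else x)"
definition sgn_real_closure :: "'a real_closure \<Rightarrow> 'a real_closure" where
  "sgn_real_closure x = (if x = 0 then 0 else if 0 < x then 1 else - 1)"

instance
proof
  note C = max_cone[where 'a = 'a]
  fix x y z :: "'a real_closure"
  show "x * y * z = x * (y * z)" "x * y = y * x" "1 * x = x" "(x + y) * z = x * z + y * z"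
    "x + y + z = x + (y + z)" "x + y = y + x" "0 + x = x" "- x + x = 0" "x - y = x + - y"
    by (transfer; simp add: algebra_simps)+
  show "(0 :: 'a real_closure) \<noteq> 1" by transfer simp
  show "x \<noteq> 0 \<Longrightarrow> inverse x * x = 1" by transfer simp
  show "inverse (0 :: 'a real_closure) = 0" by transfer simp
  show "x div y = x * inverse y" by (rule divide_real_closure_def)
  show "(x < y) = (x \<le> y \<and> \<not> y \<le> x)" by (rule less_real_closure_def)
  show "x \<le> x" by transfer (simp add: partial_cone_0[OF C])
  show "x \<le> y \<Longrightarrow> y \<le> z \<Longrightarrow> x \<le> z"
    by transfer (use partial_cone_add[OF C] in fastforce)
  show antisym: "x = y" if "x \<le> y" "y \<le> x" for x y :: "'a real_closure"
    using that by transfer (metis max_cone_antisym minus_diff_eq right_minus_eq)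
  show "x \<le> y \<or> y \<le> x"
    by transfer (metis max_cone_total minus_diff_eq subring_diff[OF is_subring_cone_field[OF max_cone]])
  show "x \<le> y \<Longrightarrow> z + x \<le> z + y" by transfer simp
  show "z * x < z * y" if "x < y" "0 < z"
    using that unfolding less_real_closure_def by transfer (simp add: max_cone_mult_strict)
  show "\<bar>x\<bar> = (if x < 0 then - x else x)" by (rule abs_real_closure_def)
  show "sgn x = (if x = 0 then 0 else if 0 < x then 1 else - 1)" by (rule sgn_real_closure_def)
qed (transfer, simp add: algebra_simps)+

end

section \<open>Adjoining a root to the maximal ordered field\<close>

lemma comm_ring_hom_rc_rep: "comm_ring_hom rc_rep"
  by standard (simp_all add: zero_real_closure.rep_eq one_real_closure.rep_eq plus_real_closure.rep_eq times_real_closure.rep_eq)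

lemma rc_rep_in_max_cone_iff: "rc_rep x \<in> max_cone \<longleftrightarrow> 0 \<le> x"
  by transfer simp

lift_definition to_rc :: "'a::linordered_field \<Rightarrow> 'a real_closure" is to_ac
  by (rule to_ac_in_cone_field[OF max_cone])

lemma comm_ring_hom_to_rc: "comm_ring_hom to_rc"
  by standard (transfer; simp)+

lemma to_rc_nonneg: "0 \<le> a \<Longrightarrow> 0 \<le> to_rc a"
  by transfer (simp add: partial_cone_to_ac[OF max_cone])

global_interpretation rc_rep: comm_ring_hom rc_rep
  by (rule comm_ring_hom_rc_rep)

lemma rc_rep_eq_0_iff [simp]: "rc_rep x = 0 \<longleftrightarrow> x = 0"
  by (metis rc_rep_inject rc_rep.hom_zero)

interpretation rc_rep_poly: map_poly_comm_ring_hom rc_rep ..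

lemma degree_map_poly_rc_rep: "degree (map_poly rc_rep q) = degree q"
  by (cases "q = 0") (auto intro: degree_map_poly)

definition rc_eval :: "'a::linordered_field alg_closure \<Rightarrow> 'a real_closure poly \<Rightarrow> 'a alg_closure" where
  "rc_eval \<alpha> s = poly (map_poly rc_rep s) \<alpha>"

lemma comm_ring_hom_rc_eval: "comm_ring_hom (rc_eval \<alpha>)"
  by standard (simp_all add: rc_eval_def hom_distribs)

global_interpretation rc_eval: comm_ring_hom "rc_eval \<alpha>" for \<alpha>
  by (rule comm_ring_hom_rc_eval)

lemma rc_eval_const [simp]: "rc_eval \<alpha> [:c:] = rc_rep c"
  by (simp add: rc_eval_def hom_distribs)

lemma rc_eval_smult: "rc_eval \<alpha> (smult c s) = rc_rep c * rc_eval \<alpha> s"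
  by (simp add: rc_eval_def hom_distribs)

lemma rc_eval_rc_rep: "rc_eval (rc_rep c) s = rc_rep (poly s c)"
  by (simp add: rc_eval_def)

lemma rc_eval_mod:
  assumes "rc_eval \<alpha> q = 0"
  shows "rc_eval \<alpha> s = rc_eval \<alpha> (s mod q)"
proof -
  have "rc_eval \<alpha> (q * (s div q) + s mod q) = rc_eval \<alpha> (s mod q)"
    using assms by (simp only: rc_eval.hom_add rc_eval.hom_mult mult_zero_left add_0)
  then show ?thesis by (simp only: mult_div_mod_eq)
qed

text \<open>With K the ordered field just built, the least set of elements of
  \<open>K[\<alpha>]\<close> that must be nonnegative in any extension of its order. The order
  extends exactly when -1 is not among them.\<close>

inductive_set cone_adjoin :: "'a::linordered_field alg_closure \<Rightarrow> 'a alg_closure set" for \<alpha> where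
  square: "0 \<le> p \<Longrightarrow> rc_rep p * (rc_eval \<alpha> s * rc_eval \<alpha> s) \<in> cone_adjoin \<alpha>"
| add: "x \<in> cone_adjoin \<alpha> \<Longrightarrow> y \<in> cone_adjoin \<alpha> \<Longrightarrow> x + y \<in> cone_adjoin \<alpha>"

lemma cone_adjoin_mult:
  assumes "x \<in> cone_adjoin \<alpha>" "y \<in> cone_adjoin \<alpha>"
  shows "x * y \<in> cone_adjoin \<alpha>"
  using assms(1)
proof induction
  case (square p s)
  from assms(2) show ?case
  proof induction
    case (square p' s')
    have "rc_rep (p * p') * (rc_eval \<alpha> (s * s') * rc_eval \<alpha> (s * s')) \<in> cone_adjoin \<alpha>"
      using square \<open>0 \<le> p\<close> by (intro cone_adjoin.square) simp
    then show ?case by (simp add: hom_distribs mult_ac)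
  qed (simp add: distrib_left cone_adjoin.add)
qed (simp add: distrib_right cone_adjoin.add)

lemma is_subring_range_rc_eval: "is_subring (range (rc_eval \<alpha>))"
  unfolding is_subring_def
proof (intro conjI ballI)
  show "0 \<in> range (rc_eval \<alpha>)" "1 \<in> range (rc_eval \<alpha>)"
    by (metis rangeI rc_eval.hom_zero, metis rangeI rc_eval.hom_one)
qed (auto simp flip: rc_eval.hom_add rc_eval.hom_mult rc_eval.hom_uminus)

lemma to_ac_in_range_rc_eval: "to_ac a \<in> range (rc_eval \<alpha>)"
  by (metis rangeI rc_eval_const to_rc.rep_eq)

lemma cone_adjoin_subset_range: "cone_adjoin \<alpha> \<subseteq> range (rc_eval \<alpha>)"
proof
  fix x assume "x \<in> cone_adjoin \<alpha>"
  then show "x \<in> range (rc_eval \<alpha>)"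
  proof induction
    case (square p s)
    then show ?case by (metis rangeI rc_eval.hom_mult rc_eval_const)
  qed (rule subring_add[OF is_subring_range_rc_eval])
qed

lemma cone_adjoin_square: "x \<in> range (rc_eval \<alpha>) \<Longrightarrow> x * x \<in> cone_adjoin \<alpha>"
  using cone_adjoin.square[of 1 \<alpha>] by auto

lemma max_cone_subset_adjoin: "max_cone \<subseteq> cone_adjoin \<alpha>"
proof
  fix x :: "'a alg_closure" assume x: "x \<in> max_cone"
  then have "rc_rep (rc_abs x) = x" using cone_subset_field[OF max_cone] by (intro rc_abs_inverse) blast
  moreover from this x have "0 \<le> rc_abs x" by (simp flip: rc_rep_in_max_cone_iff)
  ultimately show "x \<in> cone_adjoin \<alpha>" using cone_adjoin.square[of "rc_abs x" \<alpha> 1] by simp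
qed

text \<open>If \<open>-1\<close> were a sum of terms \<open>p s\<^sup>2\<close> at a root of \<open>q\<close>, with \<open>p \<ge> 0\<close> and \<open>deg s < deg q\<close>, then
  \<open>1 + \<Sum> p s\<^sup>2 = q h\<close> with \<open>deg h < deg q\<close>, although \<open>q h\<close> is not positive everywhere. So the order
  extends to the root, which lies in the maximal ordered field already.\<close>

lemma real_closure_root_if_minimal:
  fixes q :: "'a::linordered_field real_closure poly"
  assumes root: "rc_eval \<alpha> q = 0" and deg: "degree q > 0"
    and minimal: "\<And>r. r \<noteq> 0 \<Longrightarrow> degree r < degree q \<Longrightarrow> rc_eval \<alpha> r \<noteq> 0"
    and nonpos: "\<And>h. degree h < degree q \<Longrightarrow> \<exists>c. poly (q * h) c \<le> 0"
  shows "\<exists>c. poly q c = 0"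
proof -
  have "q \<noteq> 0" using deg by auto
  have elt: "\<exists>u. x = rc_eval \<alpha> u \<and> degree u \<le> 2 * degree q - 2 \<and> (\<forall>c. 0 \<le> poly u c)" if "x \<in> cone_adjoin \<alpha>" for x
    using that
  proof induction
    case (square p s)
    define t where "t = s mod q"
    have "rc_eval \<alpha> s = rc_eval \<alpha> t" unfolding t_def by (rule rc_eval_mod[OF root])
    moreover have "degree t < degree q" unfolding t_def using degree_mod_less'[OF \<open>q \<noteq> 0\<close>] deg by (metis degree_0)
    then have "degree (t * t) \<le> 2 * degree q - 2" using degree_mult_le[of t t] by linarith
    then have "degree (smult p (t * t)) \<le> 2 * degree q - 2" using degree_smult_le order_trans by blast
    ultimately show ?case using square
      by (intro exI[of _ "smult p (t * t)"]) (simp add: rc_eval_smult hom_distribs)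
  next
    case (add x y)
    then obtain u v where "x = rc_eval \<alpha> u" "degree u \<le> 2 * degree q - 2" "\<forall>c. 0 \<le> poly u c"
      "y = rc_eval \<alpha> v" "degree v \<le> 2 * degree q - 2" "\<forall>c. 0 \<le> poly v c" by blast
    then show ?case
      by (intro exI[of _ "u + v"]) (simp add: hom_distribs degree_add_le)
  qed
  have "partial_cone (cone_adjoin \<alpha>)" unfolding partial_cone_def
  proof (intro conjI ballI allI impI)
    fix x y assume xy: "x \<in> cone_adjoin \<alpha>" "y \<in> cone_adjoin \<alpha>"
    then show "x + y \<in> cone_adjoin \<alpha>" "x * y \<in> cone_adjoin \<alpha>" by (auto intro: cone_adjoin.add cone_adjoin_mult)
    have "x - y \<in> range (rc_eval \<alpha>)" using xy cone_adjoin_subset_range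
      by (blast intro: subring_diff[OF is_subring_range_rc_eval])
    then show "(x - y) * (x - y) \<in> cone_adjoin \<alpha>" by (rule cone_adjoin_square)
  next
    fix x assume x: "x \<in> cone_adjoin \<alpha>"
    have "inverse x \<in> range (rc_eval \<alpha>)"
      using x cone_adjoin_subset_range to_ac_in_range_rc_eval
      by (intro subring_inverse_algebraic is_subring_range_rc_eval) blast+
    from cone_adjoin_mult[OF x cone_adjoin_square[OF this]] show "inverse x \<in> cone_adjoin \<alpha>"
      by (cases "x = 0") (simp_all add: field_simps)
  next
    show "to_ac a \<in> cone_adjoin \<alpha>" if "0 \<le> a" for a
      using partial_cone_to_ac[OF max_cone that] max_cone_subset_adjoin by blast
  next
    show "- 1 \<notin> cone_adjoin \<alpha>"
    proof
      assume "- 1 \<in> cone_adjoin \<alpha>"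
      from elt[OF this] obtain u where u: "- 1 = rc_eval \<alpha> u" "degree u \<le> 2 * degree q - 2" "\<forall>c. 0 \<le> poly u c" by blast
      define w where "w = 1 + u"
      have pos: "poly w c > 0" for c using u(3) by (simp add: w_def add_pos_nonneg)
      then have "w \<noteq> 0" by auto
      have "rc_eval \<alpha> w = 0" by (simp add: w_def hom_distribs flip: u(1))
      then have "rc_eval \<alpha> (w mod q) = 0" using rc_eval_mod[OF root, of w] by simp
      then have "w mod q = 0" using minimal[of "w mod q"] degree_mod_less'[OF \<open>q \<noteq> 0\<close>] by blast
      then obtain h where wq: "w = q * h" by (metis dvdE mod_0_imp_dvd)
      then have "h \<noteq> 0" using \<open>w \<noteq> 0\<close> by auto
      then have "degree w = degree q + degree h"
        unfolding wq using \<open>q \<noteq> 0\<close> by (intro degree_mult_eq)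
      moreover have "degree w \<le> 2 * degree q - 2" unfolding w_def using u(2) by (intro degree_add_le) auto
      ultimately have "degree h < degree q" using deg by linarith
      from nonpos[OF this] obtain c where "poly w c \<le> 0" unfolding wq by blast
      then show False using pos[of c] by simp
    qed
  qed
  from max_cone_maximal[OF this max_cone_subset_adjoin] have eq: "cone_adjoin \<alpha> = max_cone" .
  \<comment> \<open>The difference of the squares of \<open>\<alpha> + 1\<close> and
    \<open>\<alpha> - 1\<close>, divided by 4, is \<open>\<alpha>\<close>. This exhibits the root as
    a difference of two cone elements.\<close>
  define x where "x = rc_rep (1/4) * (rc_eval \<alpha> [:1, 1:] * rc_eval \<alpha> [:1, 1:])"
  define y where "y = rc_rep (1/4) * (rc_eval \<alpha> [:-1, 1:] * rc_eval \<alpha> [:-1, 1:])"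
  have "x \<in> cone_adjoin \<alpha>" "y \<in> cone_adjoin \<alpha>" unfolding x_def y_def by (intro cone_adjoin.square; simp)+
  then have "x - y \<in> cone_field max_cone" unfolding eq cone_field_def by blast
  moreover have "x - y = rc_rep (1/4) * rc_rep 4 * \<alpha>"
    by (simp add: x_def y_def rc_eval_def hom_distribs algebra_simps)
  moreover have "rc_rep (1/4) * rc_rep 4 = (1 :: 'a alg_closure)"
    by (simp flip: rc_rep.hom_mult)
  ultimately have "\<alpha> \<in> cone_field max_cone" by simp
  then obtain c where c: "\<alpha> = rc_rep c" by (metis rc_abs_inverse)
  have "poly q c = 0" using root unfolding c rc_eval_rc_rep by simp
  then show ?thesis ..
qed

text \<open>Strong induction on the degree. If \<open>q\<close> splits, one factor changes sign. If
  not, \<open>q\<close> has least degree among the nonzero polynomials killing one of its roots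
  \<open>\<alpha>\<close>; and a cofactor \<open>h\<close> of smaller degree with
  \<open>q * h\<close> positive everywhere would change sign with \<open>q\<close>, hence have a
  root by induction. So a root lies in the field, an unsplittable \<open>q\<close> is linear, and
  the sign change places the root between \<open>a\<close> and \<open>b\<close>.\<close>

lemma real_closure_ivt:
  fixes q :: "'a::linordered_field real_closure poly"
  assumes "a < b" "poly q a * poly q b < 0"
  shows "\<exists>c>a. c < b \<and> poly q c = 0"
  using assms(2)
proof (induction "degree q" arbitrary: q rule: less_induct)
  case less
  have deg: "degree q > 0"
  proof (rule ccontr)
    assume "\<not> degree q > 0"
    then obtain c where "q = [:c:]" using degree0_coeffs by blast
    then show False using less.prems by (simp add: mult_less_0_iff)
  qed
  then have "q \<noteq> 0" by auto
  show ?case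
  proof (cases "\<exists>f g. q = f * g \<and> degree f < degree q \<and> degree g < degree q")
    case True
    then obtain f g where fg: "q = f * g" "degree f < degree q" "degree g < degree q" by blast
    have "(poly f a * poly f b) * (poly g a * poly g b) < 0" using less.prems by (simp add: fg(1) mult_ac)
    then have "poly f a * poly f b < 0 \<or> poly g a * poly g b < 0"
      using mult_less_0_iff[of "poly f a * poly f b" "poly g a * poly g b"] by blast
    then show ?thesis using less.hyps[OF fg(2)] less.hyps[OF fg(3)] fg(1) by auto
  next
    case irred: False
    have "degree (map_poly rc_rep q) > 0" using deg by (simp add: degree_map_poly_rc_rep)
    then obtain \<alpha> where root: "rc_eval \<alpha> q = 0" unfolding rc_eval_def using alg_closed_imp_poly_has_root by blast
    have "\<exists>c. poly q c = 0"
    proof (rule real_closure_root_if_minimal[OF root deg])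
      show "rc_eval \<alpha> r \<noteq> 0" if r: "r \<noteq> 0" "degree r < degree q" for r
      proof
        assume "rc_eval \<alpha> r = 0"
        with r obtain m where m: "m \<noteq> 0 \<and> rc_eval \<alpha> m = 0" "\<And>k. k \<noteq> 0 \<and> rc_eval \<alpha> k = 0 \<Longrightarrow> degree m \<le> degree k"
          using ex_has_least_nat[of "\<lambda>m. m \<noteq> 0 \<and> rc_eval \<alpha> m = 0" r degree] by blast
        have "degree m < degree q" using m(2)[of r] r \<open>rc_eval \<alpha> r = 0\<close> by simp
        have "degree m > 0"
        proof (rule ccontr)
          assume "\<not> degree m > 0"
          then obtain c where "m = [:c:]" using degree0_coeffs by blast
          then show False using m(1) by simp
        qed
        have "rc_eval \<alpha> (q mod m) = 0" using root rc_eval_mod[of \<alpha> m q] m(1) by simp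
        moreover have "q mod m = 0 \<or> degree (q mod m) < degree m" using degree_mod_less'[of m q] m(1) by blast
        ultimately have "q mod m = 0" using m(2)[of "q mod m"] by fastforce
        then obtain k where fac: "q = m * k" by (metis dvdE mod_0_imp_dvd)
        then have "k \<noteq> 0" using \<open>q \<noteq> 0\<close> by auto
        then have "degree q = degree m + degree k" unfolding fac using m(1) by (intro degree_mult_eq) auto
        then have "degree k < degree q" using \<open>degree m > 0\<close> by simp
        then show False using irred fac \<open>degree m < degree q\<close> by blast
      qed
      show "\<exists>c. poly (q * h) c \<le> 0" if h: "degree h < degree q" for h
      proof (rule ccontr)
        assume "\<not> (\<exists>c. poly (q * h) c \<le> 0)"
        then have pos: "poly (q * h) c > 0" for c by (meson not_le)
        have "(poly q a * poly q b) * (poly h a * poly h b) > 0"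
          using mult_pos_pos[OF pos[of a] pos[of b]] by (simp add: mult_ac)
        then have "poly h a * poly h b < 0" using less.prems by (auto simp: zero_less_mult_iff mult_less_0_iff)
        from less.hyps[OF h this] obtain c where "poly h c = 0" by blast
        then show False using pos[of c] by simp
      qed
    qed
    then obtain c where c: "poly q c = 0" by blast
    then obtain g where g: "q = [:-c, 1:] * g" by (metis dvdE poly_eq_0_iff_dvd)
    have "g \<noteq> 0" using g \<open>q \<noteq> 0\<close> by auto
    then have dq: "degree q = 1 + degree g" unfolding g by (subst degree_mult_eq) auto
    have "\<not> degree q > 1"
    proof
      assume "degree q > 1"
      then have "degree [:-c, 1:] < degree q" "degree g < degree q" using dq by auto
      then show False using irred g by blast
    qed
    then have "degree g = 0" using dq by simp
    then obtain k where k: "g = [:k:]" using degree0_coeffs by blast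
    have "(k * k) * ((a - c) * (b - c)) < 0" using less.prems by (simp add: g k algebra_simps)
    moreover have "k * k \<ge> 0" by simp
    ultimately have "(a - c) * (b - c) < 0" by (meson mult_nonneg_nonneg not_le)
    then show ?thesis using \<open>a < b\<close> c by (auto simp: mult_less_0_iff)
  qed
qed

instance real_closure :: (linordered_field) rcf
  by standard (unfold foldr_eq_poly, rule real_closure_ivt, simp_all add: mult_neg_pos)

section \<open>The Positivstellensatz\<close>

context
  fixes T :: "'a::comm_ring_1 set"
  assumes T: "preordering T"
begin

lemma preordering_add: "a \<in> T \<Longrightarrow> b \<in> T \<Longrightarrow> a + b \<in> T"
  and preordering_mult: "a \<in> T \<Longrightarrow> b \<in> T \<Longrightarrow> a * b \<in> T"
  and preordering_square: "a\<^sup>2 \<in> T"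
  using T by (auto simp: preordering_def)

lemma preordering_square': "a * a \<in> T"
  using preordering_square[of a] by (simp add: power2_eq_square)

lemma preordering_0: "0 \<in> T" and preordering_1: "1 \<in> T"
  using preordering_square[of 0] preordering_square[of 1] by simp_all

lemma preordering_even_power: "a ^ (2 * m) \<in> T"
  using preordering_square[of "a ^ m"] by (simp add: power_mult mult.commute)

lemma preordering_power: "a \<in> T \<Longrightarrow> a ^ m \<in> T"
  by (induction m) (auto intro: preordering_1 preordering_mult)

lemma preordering_sum: "(\<And>i. i \<in> A \<Longrightarrow> f i \<in> T) \<Longrightarrow> sum f A \<in> T"
  by (induction A rule: infinite_finite_induct) (auto intro: preordering_0 preordering_add)

lemma preordering_adjoin: "preordering {s + a * t | s t. s \<in> T \<and> t \<in> T}" (is "preordering ?Q")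
  unfolding preordering_def
proof (intro conjI ballI allI)
  fix u v assume "u \<in> ?Q" "v \<in> ?Q"
  then obtain s t s' t' where *: "s \<in> T" "t \<in> T" "s' \<in> T" "t' \<in> T" and uv: "u = s + a * t" "v = s' + a * t'" by blast
  have "u + v = (s + s') + a * (t + t')" "u * v = (s * s' + a * a * (t * t')) + a * (s * t' + t * s')"
    unfolding uv by (simp_all add: algebra_simps)
  then show "u + v \<in> ?Q" "u * v \<in> ?Q"
    using preordering_add[OF *(1,3)] preordering_add[OF *(2,4)]
      preordering_add[OF preordering_mult[OF *(1,3)] preordering_mult[OF preordering_square' preordering_mult[OF *(2,4)]]]
      preordering_add[OF preordering_mult[OF *(1,4)] preordering_mult[OF *(2,3)]] by blast+
next
  fix u
  have "u\<^sup>2 = u\<^sup>2 + a * 0" by simp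
  then show "u\<^sup>2 \<in> ?Q" using preordering_square preordering_0 by blast
qed

end

lemma preordering_preordering_gen: "preordering (preordering_gen G)"
  unfolding preordering_gen_def preordering_def by blast

lemma preordering_gen_superset: "G \<subseteq> preordering_gen G"
  unfolding preordering_gen_def by blast

lemma preordering_gen_minimal: "preordering T \<Longrightarrow> G \<subseteq> T \<Longrightarrow> preordering_gen G \<subseteq> T"
  unfolding preordering_gen_def by blast

lemma preordering_gen_mono: "G \<subseteq> H \<Longrightarrow> preordering_gen G \<subseteq> preordering_gen H"
  by (rule preordering_gen_minimal[OF preordering_preordering_gen order_trans[OF _ preordering_gen_superset]])

lemma preordering_gen_insert:
  "preordering_gen (insert a G) = {s + a * t | s t. s \<in> preordering_gen G \<and> t \<in> preordering_gen G}" (is "_ = ?Q")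
proof
  note T = preordering_preordering_gen[of G]
  have "a = 0 + a * 1" by simp
  then have "a \<in> ?Q" using preordering_0[OF T] preordering_1[OF T] by blast
  moreover have "G \<subseteq> ?Q"
  proof
    fix g assume "g \<in> G"
    then have "g \<in> preordering_gen G" using preordering_gen_superset by blast
    moreover have "g = g + a * 0" by simp
    ultimately show "g \<in> ?Q" using preordering_0[OF T] by blast
  qed
  ultimately have "insert a G \<subseteq> ?Q" by (simp only: insert_subset)
  then show "preordering_gen (insert a G) \<subseteq> ?Q"
    by (rule preordering_gen_minimal[OF preordering_adjoin[OF T]])
  note T' = preordering_preordering_gen[of "insert a G"]
  have "preordering_gen G \<subseteq> preordering_gen (insert a G)"
    by (rule preordering_gen_mono[OF subset_insertI])
  moreover have "a \<in> preordering_gen (insert a G)" by (rule subsetD[OF preordering_gen_superset insertI1])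
  ultimately show "?Q \<subseteq> preordering_gen (insert a G)"
    by (auto intro!: preordering_add[OF T'] preordering_mult[OF T'])
qed

definition prime_cone :: "'a::comm_ring_1 set \<Rightarrow> bool" where
  "prime_cone P \<longleftrightarrow> preordering P \<and> (\<forall>a. a \<in> P \<or> - a \<in> P) \<and> - 1 \<notin> P \<and>
     (\<forall>a b. a * b \<in> P \<and> - (a * b) \<in> P \<longrightarrow> (a \<in> P \<and> - a \<in> P) \<or> (b \<in> P \<and> - b \<in> P))"

text \<open>For a maximal preordering avoiding all \<open>- \<phi>^(2m)\<close>, an outside element
  \<open>x\<close> comes with an identity \<open>- \<phi>^(2m) = s + x * t\<close>. Two such
  identities, for \<open>x\<close> and \<open>y\<close>, multiply to a forbidden one as soon as
  \<open>- (x * y)\<close> is inside. Even powers of \<open>\<phi>\<close> are squares, so the mixed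
  terms stay inside.\<close>

lemma prime_cone_exists:
  fixes T :: "'a::comm_ring_1 set"
  assumes "preordering T" "\<And>m. - (\<phi> ^ (2 * m)) \<notin> T"
  shows "\<exists>P. prime_cone P \<and> T \<subseteq> P \<and> (\<forall>m. - (\<phi> ^ (2 * m)) \<notin> P)"
proof -
  define A where "A = {P. preordering P \<and> T \<subseteq> P \<and> (\<forall>m. - (\<phi> ^ (2 * m)) \<notin> P)}"
  have "\<exists>M\<in>A. \<forall>Y\<in>A. M \<subseteq> Y \<longrightarrow> Y = M"
  proof (rule subset_Zorn_nonempty)
    show "A \<noteq> {}" using assms unfolding A_def by blast
    fix C assume "C \<noteq> {}" and chain: "subset.chain A C"
    then have sub: "\<And>P. P \<in> C \<Longrightarrow> P \<in> A" and lin: "\<And>P Q. P \<in> C \<Longrightarrow> Q \<in> C \<Longrightarrow> P \<subseteq> Q \<or> Q \<subseteq> P"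
      by (auto simp: subset.chain_def)
    have "preordering (\<Union>C)" unfolding preordering_def
    proof (intro conjI ballI allI)
      fix a b assume "a \<in> \<Union>C" "b \<in> \<Union>C"
      then obtain P where "P \<in> C" "a \<in> P" "b \<in> P" using lin by blast
      then show "a + b \<in> \<Union>C" "a * b \<in> \<Union>C" using sub[OF \<open>P \<in> C\<close>] by (auto simp: A_def preordering_def intro!: bexI[of _ P])
    next
      fix a show "a\<^sup>2 \<in> \<Union>C" using \<open>C \<noteq> {}\<close> sub by (fastforce simp: A_def preordering_def)
    qed
    moreover have "T \<subseteq> \<Union>C" using sub \<open>C \<noteq> {}\<close> by (auto simp: A_def)
    moreover have "- (\<phi> ^ (2 * m)) \<notin> \<Union>C" for m using sub by (auto simp: A_def)
    ultimately show "\<Union>C \<in> A" by (simp add: A_def)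
  qed
  then obtain P where PA: "P \<in> A" and max: "\<And>Y. Y \<in> A \<Longrightarrow> P \<subseteq> Y \<Longrightarrow> Y = P" by blast
  from PA have P: "preordering P" "T \<subseteq> P" "\<And>m. - (\<phi> ^ (2 * m)) \<notin> P" by (simp_all add: A_def)
  note PI = preordering_add[OF P(1)] preordering_mult[OF P(1)] preordering_even_power[OF P(1)]
    preordering_0[OF P(1)] preordering_1[OF P(1)] preordering_square'[OF P(1)]
  have out: "\<exists>m s t. s \<in> P \<and> t \<in> P \<and> - (\<phi> ^ (2 * m)) = s + x * t" if "x \<notin> P" for x
  proof (rule ccontr)
    assume *: "\<not> ?thesis"
    let ?Q = "{s + x * t | s t. s \<in> P \<and> t \<in> P}"
    have PQ: "P \<subseteq> ?Q"
    proof
      fix s assume "s \<in> P"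
      moreover have "s = s + x * 0" by simp
      ultimately show "s \<in> ?Q" using PI(4) by blast
    qed
    have "- (\<phi> ^ (2 * m)) \<notin> ?Q" for m using * by blast
    then have "?Q \<in> A" using order_trans[OF P(2) PQ] preordering_adjoin[OF P(1)] by (simp add: A_def)
    from max[OF this PQ] have "?Q = P" .
    moreover have "x = 0 + x * 1" by simp
    then have "x \<in> ?Q" using PI by blast
    ultimately show False using that by simp
  qed
  \<comment> \<open>Taking \<open>y = - x\<close> gives totality, because \<open>x * x\<close> is
    inside; the four sign choices for \<open>a\<close> and \<open>b\<close> give primality.\<close>
  have key: False if x: "x \<notin> P" and y: "y \<notin> P" and xy: "- (x * y) \<in> P" for x y
  proof -
    obtain m s t where 1: "s \<in> P" "t \<in> P" "- (\<phi> ^ (2 * m)) = s + x * t" using out[OF x] by blast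
    obtain n s' t' where 2: "s' \<in> P" "t' \<in> P" "- (\<phi> ^ (2 * n)) = s' + y * t'" using out[OF y] by blast
    have "\<phi> ^ (2 * m) = - s - x * t" "\<phi> ^ (2 * n) = - s' - y * t'"
      using 1(3) 2(3) by (metis minus_add_distrib minus_minus diff_conv_add_uminus)+
    then have "- (\<phi> ^ (2 * (m + n))) = - (x * y) * (t * t') + \<phi> ^ (2 * m) * s' + \<phi> ^ (2 * n) * s + s * s'"
      by (simp add: distrib_left power_add) (simp add: algebra_simps)
    also have "\<dots> \<in> P" using 1 2 xy by (intro PI)
    finally show False using P(3) by blast
  qed
  have total: "a \<in> P \<or> - a \<in> P" for a using key[of a "- a"] PI(6)[of a] by auto
  have "prime_cone P" unfolding prime_cone_def
  proof (intro conjI allI impI)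
    show "preordering P" "a \<in> P \<or> - a \<in> P" for a by (rule P(1), rule total)
    show "- 1 \<notin> P" using P(3)[of 0] by simp
    fix a b assume ab: "a * b \<in> P \<and> - (a * b) \<in> P"
    then show "(a \<in> P \<and> - a \<in> P) \<or> (b \<in> P \<and> - b \<in> P)"
      using key[of a b] key[of "-a" b] key[of a "-b"] key[of "-a" "-b"] by auto
  qed
  then show ?thesis using P by blast
qed

text \<open>A type cannot depend on a term, so the ordered quotient ring is formed for one fixed chosen
  counterexample to the Positivstellensatz (if there is any).\<close>

definition psatz_fails :: "('d::finite, real) mpoly set \<times> ('d, real) mpoly \<Rightarrow> bool" where
  "psatz_fails = (\<lambda>(G, \<phi>). finite G \<and> (\<forall>x\<in>nonneg_set G. peval \<phi> x = 0) \<and>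
     (\<forall>m. - (\<phi> ^ (2 * m)) \<notin> preordering_gen G))"

definition psatz_cex :: "('d::finite, real) mpoly set \<times> ('d, real) mpoly" where
  "psatz_cex = (if \<exists>c. psatz_fails (c :: ('d, real) mpoly set \<times> ('d, real) mpoly)
     then SOME c. psatz_fails c else ({}, 1))"

lemma preordering_nonneg_at: "preordering {f. 0 \<le> peval f x}"
  by (auto simp: preordering_def hom_distribs)

text \<open>Covers the default pair too: everything generated by the empty set is nonnegative at the
  origin, and -1 is not. The cone, and hence the quotient type, therefore exists
  unconditionally.\<close>

lemma psatz_cex_proper: "- (snd psatz_cex ^ (2 * m)) \<notin> preordering_gen (fst (psatz_cex :: ('d::finite, real) mpoly set \<times> _))"
proof (cases "\<exists>c. psatz_fails (c :: ('d, real) mpoly set \<times> ('d, real) mpoly)")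
  case True
  then have "psatz_cex = (SOME c. psatz_fails (c :: ('d, real) mpoly set \<times> ('d, real) mpoly))"
    by (simp add: psatz_cex_def)
  then have "psatz_fails (psatz_cex :: ('d, real) mpoly set \<times> ('d, real) mpoly)"
    using someI_ex[OF True] by simp
  then show ?thesis by (auto simp: psatz_fails_def case_prod_beta)
next
  case False
  then have c: "psatz_cex = (({}, 1) :: ('d, real) mpoly set \<times> ('d, real) mpoly)" unfolding psatz_cex_def by (rule if_not_P)
  have "preordering_gen {} \<subseteq> {f :: ('d, real) mpoly. 0 \<le> peval f 0}"
    by (intro preordering_gen_minimal preordering_nonneg_at) simp
  then show ?thesis unfolding c by (auto simp: hom_distribs)
qed

definition psatz_cone :: "('d::finite, real) mpoly set" where
  "psatz_cone = (SOME P. prime_cone P \<and> preordering_gen (fst psatz_cex) \<subseteq> P \<and> (\<forall>m. - (snd psatz_cex ^ (2 * m)) \<notin> P))"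

lemma psatz_cone_spec:
  "prime_cone (psatz_cone :: ('d::finite, real) mpoly set) \<and> preordering_gen (fst psatz_cex) \<subseteq> (psatz_cone :: ('d, real) mpoly set) \<and>
   (\<forall>m. - (snd psatz_cex ^ (2 * m)) \<notin> (psatz_cone :: ('d, real) mpoly set))"
  using someI_ex[OF prime_cone_exists[OF preordering_preordering_gen psatz_cex_proper[where 'd = 'd]]]
  unfolding psatz_cone_def .

section \<open>The ordered quotient ring of the chosen prime cone\<close>

lemma psatz_cone: "preordering psatz_cone" "a \<in> psatz_cone \<or> - a \<in> psatz_cone" "- 1 \<notin> psatz_cone"
  "a * b \<in> psatz_cone \<Longrightarrow> - (a * b) \<in> psatz_cone \<Longrightarrow>
     (a \<in> psatz_cone \<and> - a \<in> psatz_cone) \<or> (b \<in> psatz_cone \<and> - b \<in> psatz_cone)"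
  using psatz_cone_spec unfolding prime_cone_def by blast+

lemmas psatz_coneI = preordering_add[OF psatz_cone(1)] preordering_mult[OF psatz_cone(1)]
  preordering_0[OF psatz_cone(1)] preordering_1[OF psatz_cone(1)]

text \<open>Congruence modulo the support of the cone, so the quotient is the ring on which the cone
  becomes a linear order.\<close>

definition psatz_rel :: "('d::finite, real) mpoly \<Rightarrow> ('d, real) mpoly \<Rightarrow> bool" where
  "psatz_rel f g \<longleftrightarrow> f - g \<in> psatz_cone \<and> g - f \<in> psatz_cone"

lemma psatz_rel_add: "psatz_rel f f' \<Longrightarrow> psatz_rel g g' \<Longrightarrow> psatz_rel (f + g) (f' + g')"
  unfolding psatz_rel_def
  using psatz_coneI(1)[of "f - f'" "g - g'"] psatz_coneI(1)[of "f' - f" "g' - g"] by (simp add: algebra_simps)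

lemma psatz_rel_uminus: "psatz_rel f f' \<Longrightarrow> psatz_rel (- f) (- f')"
  unfolding psatz_rel_def by (simp add: algebra_simps)

lemma psatz_rel_trans: "psatz_rel f g \<Longrightarrow> psatz_rel g h \<Longrightarrow> psatz_rel f h"
  unfolding psatz_rel_def
  using psatz_coneI(1)[of "f - g" "g - h"] psatz_coneI(1)[of "h - g" "g - f"] by (simp add: algebra_simps)

text \<open>The cone is closed under multiplication only by its own elements; totality supplies one
  of \<open>h\<close> and \<open>- h\<close>, and the relation is symmetric under the change of
  sign.\<close>

lemma psatz_rel_mult_left:
  assumes "psatz_rel f f'"
  shows "psatz_rel (h * f) (h * f')"
proof -
  have "c * (f - f') \<in> psatz_cone" "c * (f' - f) \<in> psatz_cone" if "c \<in> psatz_cone" for c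
    using assms that unfolding psatz_rel_def by (auto intro: psatz_coneI)
  from this[of h] this[of "-h"] psatz_cone(2)[of h] show ?thesis
    unfolding psatz_rel_def by (auto simp: algebra_simps)
qed

lemma psatz_rel_mult: "psatz_rel f f' \<Longrightarrow> psatz_rel g g' \<Longrightarrow> psatz_rel (f * g) (f' * g')"
  using psatz_rel_mult_left[of g g' f] psatz_rel_mult_left[of f f' g'] psatz_rel_trans by (metis mult.commute)

lemma equivp_psatz_rel: "equivp psatz_rel"
  by (intro equivpI reflpI sympI transpI) (auto intro: psatz_rel_trans, auto simp: psatz_rel_def psatz_coneI)

lemma psatz_rel_diff: "psatz_rel f f' \<Longrightarrow> psatz_rel g g' \<Longrightarrow> psatz_rel (f - g) (f' - g')"
  using psatz_rel_add[OF _ psatz_rel_uminus, of f f' g g'] by simp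

lemma psatz_rel_cone_cong: "psatz_rel f f' \<Longrightarrow> f \<in> psatz_cone \<Longrightarrow> f' \<in> psatz_cone"
  unfolding psatz_rel_def using psatz_coneI(1)[of f "f' - f"] by simp

lemma psatz_rel_sym: "psatz_rel f g \<Longrightarrow> psatz_rel g f"
  by (simp add: psatz_rel_def)

quotient_type 'd psatz_ring = "('d::finite, real) mpoly" / psatz_rel
  morphisms psatz_rep psatz_abs
  by (rule equivp_psatz_rel)

lemma psatz_abs_surj: "\<exists>f. x = psatz_abs f"
  by (induct x rule: psatz_ring.abs_induct) blast

instantiation psatz_ring :: (finite) comm_ring_1
begin

lift_definition zero_psatz_ring :: "'a psatz_ring" is 0 .
lift_definition one_psatz_ring :: "'a psatz_ring" is 1 .
lift_definition plus_psatz_ring :: "'a psatz_ring \<Rightarrow> 'a psatz_ring \<Rightarrow> 'a psatz_ring" is "(+)"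
  by (rule psatz_rel_add)
lift_definition minus_psatz_ring :: "'a psatz_ring \<Rightarrow> 'a psatz_ring \<Rightarrow> 'a psatz_ring" is "(-)"
  by (rule psatz_rel_diff)
lift_definition uminus_psatz_ring :: "'a psatz_ring \<Rightarrow> 'a psatz_ring" is uminus
  by (rule psatz_rel_uminus)
lift_definition times_psatz_ring :: "'a psatz_ring \<Rightarrow> 'a psatz_ring \<Rightarrow> 'a psatz_ring" is "(*)"
  by (rule psatz_rel_mult)

instance
proof
  fix x y z :: "'a psatz_ring"
  obtain f g h where xyz: "x = psatz_abs f" "y = psatz_abs g" "z = psatz_abs h"
    using psatz_abs_surj[of x] psatz_abs_surj[of y] psatz_abs_surj[of z] by blast
  note simps = xyz zero_psatz_ring.abs_eq one_psatz_ring.abs_eq plus_psatz_ring.abs_eq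
    minus_psatz_ring.abs_eq uminus_psatz_ring.abs_eq times_psatz_ring.abs_eq
  show "x * y * z = x * (y * z)" "x * y = y * x" "1 * x = x" "(x + y) * z = x * z + y * z"
    "x + y + z = x + (y + z)" "x + y = y + x" "0 + x = x" "- x + x = 0" "x - y = x + - y"
    unfolding simps by (simp_all add: algebra_simps)
  show "(0 :: 'a psatz_ring) \<noteq> 1"
    by (simp add: psatz_cone(3) zero_psatz_ring.abs_eq one_psatz_ring.abs_eq psatz_ring.abs_eq_iff psatz_rel_def)
qed

end

instantiation psatz_ring :: (finite) linordered_idom
begin

lift_definition less_eq_psatz_ring :: "'a psatz_ring \<Rightarrow> 'a psatz_ring \<Rightarrow> bool" is
  "\<lambda>f g. g - f \<in> psatz_cone"
  by (meson psatz_rel_cone_cong psatz_rel_diff psatz_rel_sym)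
definition less_psatz_ring :: "'a psatz_ring \<Rightarrow> 'a psatz_ring \<Rightarrow> bool" where
  "less_psatz_ring x y \<longleftrightarrow> x \<le> y \<and> \<not> y \<le> x"
definition abs_psatz_ring :: "'a psatz_ring \<Rightarrow> 'a psatz_ring" where
  "abs_psatz_ring x = (if x < 0 then - x else x)"
definition sgn_psatz_ring :: "'a psatz_ring \<Rightarrow> 'a psatz_ring" where
  "sgn_psatz_ring x = (if x = 0 then 0 else if 0 < x then 1 else - 1)"

instance
proof
  fix x y z :: "'a psatz_ring"
  obtain f g h where xyz: "x = psatz_abs f" "y = psatz_abs g" "z = psatz_abs h"
    using psatz_abs_surj[of x] psatz_abs_surj[of y] psatz_abs_surj[of z] by blast
  note simps = xyz zero_psatz_ring.abs_eq less_eq_psatz_ring.abs_eq plus_psatz_ring.abs_eq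
    times_psatz_ring.abs_eq psatz_ring.abs_eq_iff psatz_rel_def less_psatz_ring_def
  show "(x < y) = (x \<le> y \<and> \<not> y \<le> x)" by (rule less_psatz_ring_def)
  show "x \<le> x" by (simp add: simps psatz_coneI)
  show "x \<le> y \<Longrightarrow> y \<le> z \<Longrightarrow> x \<le> z"
    using psatz_coneI(1)[of "g - f" "h - g"] by (simp add: simps)
  show "x \<le> y \<Longrightarrow> y \<le> x \<Longrightarrow> x = y" by (simp add: simps)
  show "x \<le> y \<or> y \<le> x" using psatz_cone(2)[of "g - f"] by (simp add: simps)
  show "x \<le> y \<Longrightarrow> z + x \<le> z + y" by (simp add: simps)
  show "z * x < z * y" if "x < y" "0 < z"
  proof -
    have *: "g - f \<in> psatz_cone" "f - g \<notin> psatz_cone" "h \<in> psatz_cone" "- h \<notin> psatz_cone"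
      using that by (simp_all add: simps)
    then have "h * (g - f) \<in> psatz_cone" by (intro psatz_coneI)
    moreover from this have "- (h * (g - f)) \<notin> psatz_cone" using psatz_cone(4)[of h "g - f"] * by auto
    ultimately show ?thesis by (simp add: simps right_diff_distrib)
  qed
  show "\<bar>x\<bar> = (if x < 0 then - x else x)" by (rule abs_psatz_ring_def)
  show "sgn x = (if x = 0 then 0 else if 0 < x then 1 else - 1)" by (rule sgn_psatz_ring_def)
qed

end

lemma comm_ring_hom_psatz_ring: "comm_ring_hom psatz_abs"
  by standard (simp_all add: zero_psatz_ring.abs_eq one_psatz_ring.abs_eq plus_psatz_ring.abs_eq times_psatz_ring.abs_eq)

lemma psatz_abs_nonneg: "f \<in> psatz_cone \<Longrightarrow> 0 \<le> psatz_abs f"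
  by (simp add: zero_psatz_ring.abs_eq less_eq_psatz_ring.abs_eq)

lemma psatz_abs_eq_0_iff: "psatz_abs f = 0 \<longleftrightarrow> f \<in> psatz_cone \<and> - f \<in> psatz_cone"
  by (simp add: zero_psatz_ring.abs_eq psatz_ring.abs_eq_iff psatz_rel_def)

lemma comm_ring_hom_comp:
  assumes "comm_ring_hom f" "comm_ring_hom g"
  shows "comm_ring_hom (\<lambda>x. f (g x))"
proof -
  interpret f: comm_ring_hom f by fact
  interpret g: comm_ring_hom g by fact
  show ?thesis by standard (simp_all add: f.hom_add g.hom_add f.hom_mult g.hom_mult)
qed

lemma comm_ring_hom_Fract: "comm_ring_hom (\<lambda>a::'a::idom. Fract a 1)"
  by standard (simp_all add: fract_collapse)

lemma to_rc_eq_0_iff [simp]: "to_rc a = 0 \<longleftrightarrow> a = 0"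
  by transfer simp

text \<open>The contradiction is reached for the chosen pair \<open>(H, \<psi>)\<close>. The given
  pair only shows that counterexamples exist, so that the chosen one is genuine.\<close>

theorem positivstellensatz:
  fixes G :: "('d::finite, real) mpoly set"
  assumes "finite G" "\<And>x. x \<in> nonneg_set G \<Longrightarrow> peval \<phi> x = 0"
  shows "\<exists>m. - (\<phi> ^ (2 * m)) \<in> preordering_gen G"
proof (rule ccontr)
  assume "\<not> ?thesis"
  then have "psatz_fails (G, \<phi>)" using assms by (auto simp: psatz_fails_def)
  then have ex: "\<exists>c :: ('d, real) mpoly set \<times> ('d, real) mpoly. psatz_fails c" by blast
  obtain H \<psi> where cex: "psatz_cex = (H :: ('d, real) mpoly set, \<psi>)" by (rule prod.exhaust)
  have eq: "psatz_cex = (SOME c :: ('d, real) mpoly set \<times> ('d, real) mpoly. psatz_fails c)"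
    unfolding psatz_cex_def using ex by (rule if_P)
  have "psatz_fails (psatz_cex :: ('d, real) mpoly set \<times> ('d, real) mpoly)"
    unfolding eq by (rule someI_ex[OF ex])
  then have "psatz_fails (H, \<psi>)" unfolding cex .
  then have H: "finite H" "\<forall>x\<in>nonneg_set H. peval \<psi> x = 0"
    unfolding psatz_fails_def prod.case by (rule conjunct1, rule conjunct1[OF conjunct2])
  note spec = psatz_cone_spec[where 'd = 'd, unfolded cex fst_conv snd_conv]
  have P: "H \<subseteq> psatz_cone" "- (\<psi> ^ (2 * m)) \<notin> psatz_cone" for m
    using order_trans[OF preordering_gen_superset spec[THEN conjunct2, THEN conjunct1]]
      spec[THEN conjunct2, THEN conjunct2] by simp_all
  \<comment> \<open>Quotient ring, ordered fraction field, real closure: along this chain elements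
    of the cone become nonnegative, and exactly the support becomes zero.\<close>
  define \<Phi> :: "('d, real) mpoly \<Rightarrow> 'd psatz_ring fract real_closure" where
    "\<Phi> f = to_rc (Fract (psatz_abs f) 1)" for f
  have "comm_ring_hom \<Phi>" unfolding \<Phi>_def[abs_def]
    by (rule comm_ring_hom_comp[OF comm_ring_hom_to_rc comm_ring_hom_comp[OF comm_ring_hom_Fract comm_ring_hom_psatz_ring]])
  from sign_transfer[OF this, of "insert \<psi> H"] H(1) obtain x where
    x: "same_sgn (\<Phi> \<psi>) (peval \<psi> x)" "\<And>h. h \<in> H \<Longrightarrow> same_sgn (\<Phi> h) (peval h x)" by auto
  have "0 \<le> peval h x" if "h \<in> H" for h
  proof -
    have "0 \<le> psatz_abs h" using that P(1) by (intro psatz_abs_nonneg) blast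
    then have "0 \<le> Fract (psatz_abs h) 1" by (simp add: zero_le_Fract_iff)
    then have "0 \<le> \<Phi> h" unfolding \<Phi>_def by (rule to_rc_nonneg)
    then show ?thesis using x(2)[OF that] by (meson same_sgn_def not_less)
  qed
  then have "x \<in> nonneg_set H" by (simp add: nonneg_set_def)
  then have "peval \<psi> x = 0" using H(2) by blast
  then have "\<Phi> \<psi> = 0" using same_sgn_eq_0_iff[OF x(1)] by blast
  then have "Fract (psatz_abs \<psi>) 1 = 0" unfolding \<Phi>_def to_rc_eq_0_iff .
  then have "psatz_abs \<psi> = 0" by (simp add: Zero_fract_def eq_fract)
  \<comment> \<open>With both \<open>\<psi>\<close> and \<open>- \<psi>\<close> in the cone,
    \<open>- \<psi>^2\<close> is there as well, the excluded case \<open>m = 1\<close>.\<close>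
  then have "\<psi> * - \<psi> \<in> psatz_cone" unfolding psatz_abs_eq_0_iff by (intro psatz_coneI) auto
  then show False using P(2)[of 1] by (simp add: power2_eq_square)
qed

corollary positivstellensatz_empty:
  fixes G :: "('d::finite, real) mpoly set"
  assumes "finite G" "nonneg_set G = {}"
  shows "- 1 \<in> preordering_gen G"
  using positivstellensatz[OF assms(1), of 1] assms(2) by simp

lemma positivstellensatz_pos:
  fixes G :: "('d::finite, real) mpoly set"
  assumes "finite G" "\<And>x. x \<in> nonneg_set G \<Longrightarrow> peval f x > 0"
  shows "\<exists>s\<in>preordering_gen G. \<exists>t\<in>preordering_gen G. f * t = 1 + s"
proof -
  have "nonneg_set (insert (- f) G) = {}" using assms(2) by (force simp: nonneg_set_def hom_distribs)
  then have "- 1 \<in> preordering_gen (insert (- f) G)" using assms(1) by (intro positivstellensatz_empty) simp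
  then obtain s t where st: "s \<in> preordering_gen G" "t \<in> preordering_gen G" "- 1 = s + (- f) * t"
    unfolding preordering_gen_insert by blast
  have "f * t = 1 + s" using st(3) by (simp add: algebra_simps add_eq_0_iff)
  then show ?thesis using st by blast
qed

section \<open>Archimedean preorderings\<close>

lemma mconst_in_preordering:
  assumes "preordering T" "0 \<le> c"
  shows "(mconst c :: ('d::finite, real) mpoly) \<in> T"
proof -
  have "(mconst c :: ('d, real) mpoly) = mconst (sqrt c) * mconst (sqrt c)"
    using assms(2) by (simp flip: mconst.hom_mult)
  then show ?thesis using preordering_square'[OF assms(1)] by simp
qed

lemma preordering_mconst_le:
  assumes "preordering T" "(mconst k - f :: ('d::finite, real) mpoly) \<in> T" "k \<le> l"
  shows "mconst l - f \<in> T"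
proof -
  have eq: "mconst l - f = (mconst k - f) + mconst (l - k)" by (simp add: mconst.hom_minus)
  show ?thesis unfolding eq
    using assms(3) by (intro preordering_add[OF assms(1,2)] mconst_in_preordering[OF assms(1)]) simp
qed

text \<open>An upper bound for every \<open>f\<close> includes one for \<open>- f\<close>, hence
  lower bounds.\<close>

definition archimedean :: "('d::finite, real) mpoly set \<Rightarrow> bool" where
  "archimedean T \<longleftrightarrow> preordering T \<and> (\<forall>f. \<exists>k. mconst k - f \<in> T)"

definition sqnorm :: "('d::finite, real) mpoly" where
  "sqnorm = (\<Sum>i\<in>UNIV. (mvar i)\<^sup>2)"

text \<open>The elements bounded on both sides form a subring, by
  \<open>2 (k l - f g) = (k - f) (l + g) + (k + f) (l - g)\<close> for products. It contains each
  variable, since \<open>N - x_i^2\<close> plus the square of \<open>x_i - 1\<close> or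
  \<open>x_i + 1\<close> bounds it by \<open>(N + 1) / 2\<close>.\<close>

lemma archimedean_if_sqnorm_bounded:
  fixes T :: "('d::finite, real) mpoly set"
  assumes T: "preordering T" and N: "mconst N - sqnorm \<in> T"
  shows "archimedean T"
proof -
  note PI = preordering_add[OF T] preordering_mult[OF T] preordering_square[OF T] mconst_in_preordering[OF T]
  have half: "f \<in> T" if "mconst 2 * f \<in> T" for f
  proof -
    have "mconst (1/2) * (mconst 2 * f) = f" by (simp flip: mult.assoc mconst.hom_mult)
    moreover have "mconst (1/2) * (mconst 2 * f) \<in> T" by (rule PI(2)[OF PI(4) that]) simp
    ultimately show ?thesis by (simp only:)
  qed
  have two: "mconst 2 * f = f + f" for f :: "('d, real) mpoly"
  proof -
    have "mconst 2 = (mconst 1 + mconst 1 :: ('d, real) mpoly)"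
      by (simp only: mconst.hom_add[symmetric] one_add_one)
    then show ?thesis by (simp only: mconst.hom_one distrib_right mult_1_left)
  qed
  have "\<exists>k. mconst k - f \<in> T \<and> mconst k + f \<in> T" for f
  proof (induction f rule: mpoly_induct)
    case (const c)
    show ?case by (rule exI[of _ "\<bar>c\<bar>"]) (auto simp flip: mconst.hom_minus mconst.hom_add intro!: PI(4))
  next
    case (var i)
    have "mconst N - (mvar i)\<^sup>2 = (mconst N - sqnorm) + (\<Sum>j\<in>UNIV - {i}. (mvar j)\<^sup>2)"
      unfolding sqnorm_def by (subst sum.remove[of _ i]) auto
    also have "\<dots> \<in> T" by (intro PI(1) N preordering_sum[OF T] PI(3))
    finally have *: "mconst N - (mvar i)\<^sup>2 \<in> T" .
    have c: "mconst N + 1 = mconst 2 * (mconst ((N + 1) / 2) :: ('d, real) mpoly)"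
      by (simp flip: mconst.hom_mult mconst.hom_one mconst.hom_add)
    have "mconst 2 * (mconst ((N + 1) / 2) - mvar i) = (mconst N - (mvar i)\<^sup>2) + (mvar i - 1)\<^sup>2"
         "mconst 2 * (mconst ((N + 1) / 2) + mvar i) = (mconst N - (mvar i)\<^sup>2) + (mvar i + 1)\<^sup>2"
      unfolding right_diff_distrib distrib_left c[symmetric] two[of "mvar i"] by (simp_all add: algebra_simps power2_eq_square)
    then have "mconst 2 * (mconst ((N + 1) / 2) - mvar i) \<in> T" "mconst 2 * (mconst ((N + 1) / 2) + mvar i) \<in> T"
      using PI(1)[OF * PI(3)] by simp_all
    then show ?case using half by blast
  next
    case (add f g)
    then obtain k l where kl: "mconst k - f \<in> T" "mconst k + f \<in> T" "mconst l - g \<in> T" "mconst l + g \<in> T" by blast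
    have "mconst (k + l) - (f + g) = (mconst k - f) + (mconst l - g)"
         "mconst (k + l) + (f + g) = (mconst k + f) + (mconst l + g)" by (simp_all add: mconst.hom_add algebra_simps)
    then show ?case using PI(1)[OF kl(1,3)] PI(1)[OF kl(2,4)] by metis
  next
    case (mult f g)
    then obtain k l where kl: "mconst k - f \<in> T" "mconst k + f \<in> T" "mconst l - g \<in> T" "mconst l + g \<in> T" by blast
    have "mconst 2 * (mconst (k * l) - f * g) = (mconst k - f) * (mconst l + g) + (mconst k + f) * (mconst l - g)"
         "mconst 2 * (mconst (k * l) + f * g) = (mconst k - f) * (mconst l - g) + (mconst k + f) * (mconst l + g)"
      unfolding two by (simp_all add: mconst.hom_mult algebra_simps)
    then have "mconst 2 * (mconst (k * l) - f * g) \<in> T" "mconst 2 * (mconst (k * l) + f * g) \<in> T"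
      using PI(1)[OF PI(2)[OF kl(1,4)] PI(2)[OF kl(2,3)]] PI(1)[OF PI(2)[OF kl(1,3)] PI(2)[OF kl(2,4)]] by simp_all
    then show ?case using half by blast
  qed
  then show ?thesis unfolding archimedean_def using T by blast
qed

text \<open>Woermann's argument: with \<open>p = N - \<bar>x\<bar>\<^sup>2 > 0\<close> on the compact set, a certificate \<open>p t = 1 + s\<close> gives
  \<open>(1 + s) p = p\<^sup>2 t\<close>; since \<open>s\<close> is bounded with respect to the archimedean preordering of \<open>p\<close>,
  multiplying by \<open>1 + s\<close> bounds \<open>s\<close>, hence \<open>\<bar>x\<bar>\<^sup>2\<close>, with respect to the given preordering.\<close>

theorem compact_imp_archimedean:
  fixes G :: "('d::finite, real) mpoly set"
  assumes "finite G" "compact (nonneg_set G)"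
  shows "archimedean (preordering_gen G)"
proof -
  let ?T = "preordering_gen G"
  note T = preordering_preordering_gen[of G]
  note PI = preordering_add[OF T] preordering_mult[OF T] preordering_square[OF T] preordering_1[OF T]
    mconst_in_preordering[OF T]
  have pe: "peval sqnorm x = norm x ^ 2" for x :: "real ^ 'd"
    unfolding power2_norm_eq_inner inner_vec_def by (simp add: sqnorm_def hom_distribs power2_eq_square)
  obtain b where b: "\<And>x. x \<in> nonneg_set G \<Longrightarrow> norm x \<le> b" "b > 0"
    using compact_imp_bounded[OF assms(2)] by (auto simp: bounded_pos)
  \<comment> \<open>The extra 1 makes \<open>p\<close> strictly positive on the set.\<close>
  define N where "N = b ^ 2 + 1"
  have "N > 0" by (simp add: N_def add_nonneg_pos)
  define p :: "('d, real) mpoly" where "p = mconst N - sqnorm"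
  have "peval p x > 0" if "x \<in> nonneg_set G" for x
    using power_mono[OF b(1)[OF that], of 2] by (simp add: p_def hom_distribs pe N_def)
  from positivstellensatz_pos[OF assms(1) this] obtain s t where st: "s \<in> ?T" "t \<in> ?T" "p * t = 1 + s" by blast
  have "(1 + s) * p = p\<^sup>2 * t" by (simp flip: st(3) add: power2_eq_square mult_ac)
  then have ps: "(1 + s) * p \<in> ?T" using PI st by simp
  have "archimedean (preordering_gen {p})"
    using preordering_gen_superset[of "{p}"] by (intro archimedean_if_sqnorm_bounded[of _ N] preordering_preordering_gen) (simp add: p_def)
  then obtain k where "mconst k - s \<in> preordering_gen {p}" by (auto simp: archimedean_def)
  then obtain u v where uv: "u \<in> preordering_gen {}" "v \<in> preordering_gen {}" "mconst k - s = u + p * v"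
    unfolding preordering_gen_insert by blast
  have uvT: "u \<in> ?T" "v \<in> ?T" using uv preordering_gen_mono[of "{}" G] by auto
  have "(1 + s) * (mconst k - s) = (1 + s) * u + ((1 + s) * p) * v" unfolding uv(3) by (simp add: algebra_simps)
  also have "\<dots> \<in> ?T"
    by (rule PI(1)[OF PI(2)[OF PI(1)[OF PI(4) st(1)] uvT(1)] PI(2)[OF ps uvT(2)]])
  finally have *: "(1 + s) * (mconst k - s) \<in> ?T" .
  \<comment> \<open>Obtained by completing the square: the quadratic in \<open>s\<close> is
    cancelled by adding \<open>(k/2 - s)^2\<close>, and the constant that remains is
    \<open>k + k^2/4\<close>.\<close>
  define c where "c = k + k * k / 4"
  have kc: "(mconst c :: ('d, real) mpoly) = mconst k + mconst (k/2) * mconst (k/2)" "(mconst k :: ('d, real) mpoly) = mconst (k/2) + mconst (k/2)"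
    by (simp_all add: c_def flip: mconst.hom_mult mconst.hom_add)
  have "mconst c - s = (1 + s) * (mconst k - s) + (mconst (k/2) - s)\<^sup>2"
    unfolding kc by (simp add: algebra_simps power2_eq_square)
  also have "\<dots> \<in> ?T" by (intro PI *)
  finally have cs: "mconst c - s \<in> ?T" .
  \<comment> \<open>\<open>(1 + s) p + s sqnorm\<close> equals \<open>N + N s - sqnorm\<close>, and
    the bound on \<open>s\<close> removes the term \<open>N s\<close>.\<close>
  have "mconst (N * c + N) - sqnorm = mconst N * (mconst c - s) + ((1 + s) * p + s * sqnorm)"
    by (simp add: p_def mconst.hom_add mconst.hom_mult algebra_simps)
  also have "\<dots> \<in> ?T"
    using \<open>N > 0\<close> by (intro PI(1)[OF PI(2)[OF PI(5) cs] PI(1)[OF ps PI(2)[OF st(1)]]])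
      (simp_all add: sqnorm_def preordering_sum[OF T] PI(3))
  finally show ?thesis by (rule archimedean_if_sqnorm_bounded[OF T])
qed

text \<open>From \<open>f t = 1 + s\<close> and \<open>t\<close> bounded by \<open>N\<close> follows
  \<open>N (f + r) - 1 = (N - t) (f + r) + s + r t\<close>. So if \<open>f + r\<close> is in the
  preordering and \<open>r\<close> is nonnegative, \<open>r\<close> may drop by
  \<open>1 / N\<close>; finitely many drops bring it to 0.\<close>

theorem schmuedgen:
  fixes G :: "('d::finite, real) mpoly set"
  assumes "finite G" "compact (nonneg_set G)" and pos: "\<And>x. x \<in> nonneg_set G \<Longrightarrow> peval f x > 0"
  shows "f \<in> preordering_gen G"
proof -
  let ?T = "preordering_gen G"
  note T = preordering_preordering_gen[of G]
  note PI = preordering_add[OF T] preordering_mult[OF T] mconst_in_preordering[OF T]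
  have arch: "\<exists>k. mconst k - f \<in> ?T" for f
    using compact_imp_archimedean[OF assms(1,2)] by (simp add: archimedean_def)
  obtain s t where st: "s \<in> ?T" "t \<in> ?T" "f * t = 1 + s" using positivstellensatz_pos[OF assms(1) pos] by blast
  obtain k where k: "mconst k - t \<in> ?T" using arch by blast
  define N where "N = max k 1"
  have N: "N > 0" "mconst N - t \<in> ?T" using preordering_mconst_le[OF T k, of N] by (auto simp: N_def)
  obtain r0 where r0: "mconst r0 - (- f) \<in> ?T" using arch by blast
  have step: "f + mconst (r - 1 / N) \<in> ?T" if r: "f + mconst r \<in> ?T" "r \<ge> 0" for r
  proof -
    have NN: "mconst N * mconst (1 / N) = (1 :: ('d, real) mpoly)" using N(1) by (simp flip: mconst.hom_mult)
    have "f + mconst (r - 1 / N) = mconst (1 / N) * ((mconst N * f + mconst N * mconst r) - 1)"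
    proof -
      have "mconst (1 / N) * ((mconst N * f + mconst N * mconst r) - 1) =
          (mconst N * mconst (1 / N)) * f + (mconst N * mconst (1 / N)) * mconst r - mconst (1 / N)"
        by (simp add: algebra_simps)
      then show ?thesis unfolding NN by (simp add: mconst.hom_minus)
    qed
    also have "(mconst N * f + mconst N * mconst r) - 1 = (mconst N - t) * (f + mconst r) + s + mconst r * t"
      using st(3) by (simp add: algebra_simps)
    finally have eq: "f + mconst (r - 1 / N) = mconst (1 / N) * ((mconst N - t) * (f + mconst r) + s + mconst r * t)" .
    have "mconst (1 / N) \<in> ?T" "mconst r \<in> ?T" using N(1) r(2) by (auto intro!: PI(3))
    then show ?thesis unfolding eq by (rule PI(2)[OF _ PI(1)[OF PI(1)[OF PI(2)[OF N(2) r(1)] st(1)] PI(2)[OF _ st(2)]]])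
  qed
  have up: "f + mconst r' \<in> ?T" if "f + mconst r \<in> ?T" "r \<le> r'" for r r'
  proof -
    have eq: "mconst r - (- f) = f + mconst r" for r by (simp add: add.commute)
    show ?thesis using preordering_mconst_le[OF T _ that(2), of "- f"] that(1) unfolding eq by blast
  qed
  \<comment> \<open>Clipping at 0 keeps the shift nonnegative, as each step requires.\<close>
  have "f + mconst (max 0 (r0 - real n / N)) \<in> ?T" for n
  proof (induction n)
    case 0
    have "f + mconst r0 \<in> ?T" using r0 by (simp add: add.commute)
    then show ?case by (rule up) simp
  next
    case (Suc n)
    have "max 0 (r0 - real n / N) - 1 / N \<le> max 0 (r0 - real (Suc n) / N)"
      using N(1) by (auto simp: max_def field_simps)
    with step[OF Suc] show ?case using up by simp
  qed
  moreover obtain n :: nat where "r0 * N \<le> real n" using real_arch_simple by blast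
  then have "max 0 (r0 - real n / N) = 0" using N(1) by (simp add: field_simps)
  ultimately have "f + mconst 0 \<in> ?T" by metis
  then show ?thesis by simp
qed

section \<open>Reduction to a congruence modulo the square\<close>

text \<open>Bernoulli bounds \<open>1 + w t\<close> strictly by \<open>(1 + t/L)^k\<close>, and the
  product with \<open>(1 - t/L)^k\<close> is \<open>(1 - (t/L)^2)^k\<close>, at most 1. This is the
  positivity of the multiplier of \<open>f^2\<close> at points where \<open>f\<close> takes the
  value \<open>t > 0\<close>.\<close>

lemma bernoulli_strict_upper:
  fixes t L w :: real
  assumes "0 < t" "t < L" "0 < w" "w * L < real k"
  shows "(1 - t / L) ^ k * (1 + w * t) < 1"
proof -
  have L: "L > 0" using assms by simp
  define v where "v = 1 - t / L"
  have v: "0 < v" using assms L by (simp add: v_def)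
  have "w * t < real k * (t / L)" using assms L by (simp add: field_simps)
  also have "1 + \<dots> \<le> (1 + t / L) ^ k"
    using assms L by (intro Bernoulli_inequality) (auto intro: order_trans[of _ 0])
  finally have "1 + w * t < (1 + t / L) ^ k" by simp
  then have "v ^ k * (1 + w * t) < v ^ k * (1 + t / L) ^ k" using v by simp
  also have "\<dots> = (v * (1 + t / L)) ^ k" by (simp add: power_mult_distrib)
  also have "\<dots> \<le> 1"
  proof (rule power_le_one)
    show "0 \<le> v * (1 + t / L)" using v assms L by (intro mult_nonneg_nonneg) auto
    have "v * (1 + t / L) = 1 - (t / L)\<^sup>2" by (simp add: v_def algebra_simps power2_eq_square)
    then show "v * (1 + t / L) \<le> 1" by simp
  qed
  finally show ?thesis by (simp add: v_def)
qed

text \<open>If \<open>f + w f\<^sup>2 \<in> T\<close>, then \<open>f = \<sigma> f\<^sup>2 + \<tau> (f + w f\<^sup>2)\<close> whenever \<open>\<sigma> f + \<tau> (1 + w f) = 1\<close>. The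
  truncated geometric series \<open>q = (1 - (1 - f / L)\<^sup>k) / f\<close> yields \<open>\<sigma> = q (1 + w f) - w\<close> and
  \<open>\<tau> = 1 - q f = (1 - f / L)\<^sup>k\<close>, both positive on the compact set for large \<open>k\<close>.\<close>

lemma in_preordering_if_perturbed:
  fixes G :: "('d::finite, real) mpoly set"
  assumes G: "finite G" "compact (nonneg_set G)"
    and nonneg: "\<And>x. x \<in> nonneg_set G \<Longrightarrow> 0 \<le> peval f x"
    and t: "t0 \<in> preordering_gen G" "t1 \<in> preordering_gen G" "f + t1 * f\<^sup>2 = t0"
  shows "f \<in> preordering_gen G"
proof -
  let ?T = "preordering_gen G"
  note T = preordering_preordering_gen[of G]
  note PI = preordering_add[OF T] preordering_mult[OF T] preordering_square[OF T] mconst_in_preordering[OF T]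
  have arch: "\<exists>k>0. mconst k - f \<in> ?T" for f
  proof -
    obtain k where k: "mconst k - f \<in> ?T"
      using compact_imp_archimedean[OF G] by (auto simp: archimedean_def)
    have "mconst (max k 1) - f \<in> ?T" by (rule preordering_mconst_le[OF T k]) simp
    then show ?thesis by (intro exI[of _ "max k 1"]) simp
  qed
  obtain w where w: "w > 0" "mconst w - t1 \<in> ?T" using arch by blast
  obtain l where l: "l > 0" "mconst l - f \<in> ?T" using arch by blast
  \<comment> \<open>The extra 1 turns the bound into \<open>f < L\<close> on the set, keeping
    \<open>1 - f / L\<close> strictly positive there.\<close>
  define L where "L = l + 1"
  have L: "L > 0" using l by (simp add: L_def)
  obtain k where k: "w * L < real k" using reals_Archimedean2 by blast
  define g where "g = f + mconst w * f\<^sup>2"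
  have "g = t0 + (mconst w - t1) * f\<^sup>2" unfolding g_def t(3)[symmetric] by (simp add: algebra_simps)
  then have g: "g \<in> ?T" using PI(1)[OF t(1) PI(2)[OF w(2) PI(3)]] by simp
  have LT: "mconst L - f \<in> ?T" by (rule preordering_mconst_le[OF T l(2)]) (simp add: L_def)
  define u where "u = mconst (1 / L) * (mconst L - f)"
  define q where "q = mconst (1 / L) * (\<Sum>j<k. u ^ j)"
  have iL: "mconst (1 / L) * mconst L = (1 :: ('d, real) mpoly)" using L by (simp flip: mconst.hom_mult)
  have "u = 1 - mconst (1 / L) * f" by (simp add: u_def right_diff_distrib iL)
  then have qf: "q * f = 1 - u ^ k" unfolding one_diff_power_eq[of u k] by (simp add: q_def mult_ac)
  have "u ^ k \<in> ?T" unfolding u_def using L by (intro preordering_power[OF T] PI(2)[OF PI(4) LT]) simp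
  then have \<tau>: "1 - q * f \<in> ?T" by (simp add: qf)
  define \<sigma> where "\<sigma> = q * (1 + mconst w * f) - mconst w"
  have "peval \<sigma> x > 0" if x: "x \<in> nonneg_set G" for x
  proof -
    let ?t = "peval f x"
    have "0 \<le> ?t" by (rule nonneg[OF x])
    have "?T \<subseteq> {f. 0 \<le> peval f x}"
      using x by (intro preordering_gen_minimal preordering_nonneg_at) (auto simp: nonneg_set_def)
    then have "0 \<le> peval (mconst l - f) x" using l(2) by blast
    then have "?t < L" by (simp add: hom_distribs L_def)
    have s: "peval \<sigma> x = peval q x * (1 + w * ?t) - w" by (simp add: \<sigma>_def hom_distribs)
    have ux: "peval u x = 1 - ?t / L" using L by (simp add: u_def hom_distribs field_simps)
    \<comment> \<open>At a zero of \<open>f\<close> the geometric sum has \<open>k\<close> terms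
      equal to 1, so \<open>q = k / L\<close>, which exceeds \<open>w\<close> by the choice of
      \<open>k\<close>.\<close>
    show ?thesis
    proof (cases "?t = 0")
      case True
      then have "peval q x = real k / L" by (simp add: q_def hom_distribs ux)
      moreover have "w < real k / L" using k L by (simp add: field_simps)
      ultimately show ?thesis using True by (simp add: s)
    next
      case False
      then have "?t > 0" using \<open>0 \<le> ?t\<close> by simp
      have "peval (q * f) x = peval (1 - u ^ k) x" by (simp only: qf)
      then have eq: "peval q x * ?t = 1 - (1 - ?t / L) ^ k" by (simp add: hom_distribs ux)
      have "?t * peval \<sigma> x = (peval q x * ?t) * (1 + w * ?t) - w * ?t"
        unfolding s by (simp add: algebra_simps)
      also have "\<dots> = (1 - (1 - ?t / L) ^ k) * (1 + w * ?t) - w * ?t" unfolding eq ..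
      also have "\<dots> = 1 - (1 - ?t / L) ^ k * (1 + w * ?t)" by (simp add: algebra_simps)
      also have "\<dots> > 0" using bernoulli_strict_upper[OF \<open>?t > 0\<close> \<open>?t < L\<close> w(1) k] by simp
      finally show ?thesis using \<open>?t > 0\<close> by (simp add: zero_less_mult_iff)
    qed
  qed
  then have \<sigma>: "\<sigma> \<in> ?T" by (rule schmuedgen[OF G])
  have "f = \<sigma> * f\<^sup>2 + (1 - q * f) * g"
    by (simp add: \<sigma>_def g_def algebra_simps power2_eq_square)
  also have "\<dots> \<in> ?T" by (rule PI(1)[OF PI(2)[OF \<sigma> PI(3)] PI(2)[OF \<tau> g]])
  finally show ?thesis .
qed

section \<open>Power series at a point\<close>

definition mfps_monom :: "('d \<Rightarrow>\<^sub>0 nat) \<Rightarrow> ('d, 'a::zero_neq_one) mfps" where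
  "mfps_monom a = Abs_mfps (\<lambda>m. if m = a then 1 else 0)"

lemma mfps_coeff_monom: "mfps_coeff (mfps_monom a) m = (if m = a then 1 else 0)"
  by (simp add: mfps_monom_def Abs_mfps_inverse)

lemma mfps_coeff_mult:
  "mfps_coeff (f * g) m = (\<Sum>(a, b)\<in>{(a, b). a + b = m}. mfps_coeff f a * mfps_coeff g b)"
  by (simp add: times_mfps.rep_eq)

lemma mfps_monom_mult: "mfps_monom a * mfps_monom b = (mfps_monom (a + b) :: ('d::finite, real) mfps)"
proof (rule mfps_eqI)
  fix m :: "'d \<Rightarrow>\<^sub>0 nat"
  have "mfps_coeff (mfps_monom a * mfps_monom b :: ('d, real) mfps) m =
      (\<Sum>u\<in>{(a, b). a + b = m}. if u = (a, b) then 1 else 0)"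
    unfolding mfps_coeff_mult by (intro sum.cong) (auto simp: mfps_coeff_monom split: if_splits)
  also have "\<dots> = (if a + b = m then 1 else 0)"
    by (subst sum.delta) (auto simp: finite_exponents_split)
  finally show "mfps_coeff (mfps_monom a * mfps_monom b :: ('d, real) mfps) m = mfps_coeff (mfps_monom (a + b)) m"
    by (simp add: mfps_coeff_monom)
qed

lemma mfps_const_mult_coeff: "mfps_coeff (mfps_const c * f) m = c * mfps_coeff (f :: ('d::finite, real) mfps) m"
proof -
  have "mfps_coeff (mfps_const c * f) m = (\<Sum>u\<in>{(a, b). a + b = m}. if u = (0, m) then c * mfps_coeff f m else 0)"
    unfolding mfps_coeff_mult by (intro sum.cong) (auto simp: mfps_const.rep_eq split: if_splits)
  also have "\<dots> = c * mfps_coeff f m" by (subst sum.delta) (auto simp: finite_exponents_split)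
  finally show ?thesis .
qed

lemma comm_ring_hom_mfps_const: "comm_ring_hom (mfps_const :: real \<Rightarrow> ('d::finite, real) mfps)"
proof
  show "mfps_const 0 = (0 :: ('d, real) mfps)" "mfps_const 1 = (1 :: ('d, real) mfps)"
    by (rule mfps_eqI; simp add: mfps_const.rep_eq zero_mfps.rep_eq one_mfps.rep_eq)+
  fix x y :: real
  show "mfps_const (x + y) = (mfps_const x + mfps_const y :: ('d, real) mfps)"
    by (rule mfps_eqI) (simp add: mfps_const.rep_eq plus_mfps.rep_eq)
  show "mfps_const (x * y) = (mfps_const x * mfps_const y :: ('d, real) mfps)"
    by (rule mfps_eqI) (simp add: mfps_const_mult_coeff, simp add: mfps_const.rep_eq)
qed

lemma comm_ring_hom_taylor: "comm_ring_hom (taylor p)"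
  unfolding taylor_def[abs_def] by (rule comm_ring_hom_subst[OF comm_ring_hom_mfps_const])

global_interpretation taylor: comm_ring_hom "taylor p" for p
  by (rule comm_ring_hom_taylor)

lemma taylor_mconst [simp]: "taylor p (mconst c) = mfps_const c"
  unfolding taylor_def by (rule subst_mconst[OF comm_ring_hom_mfps_const])

lemma taylor_mvar: "taylor p (mvar i) = mfps_const (p $ i) + mfps_var i"
  unfolding taylor_def by (rule subst_mvar[OF comm_ring_hom_mfps_const])

definition shifted_var :: "real ^ 'd \<Rightarrow> 'd \<Rightarrow> ('d::finite, real) mpoly" where
  "shifted_var p i = mvar i - mconst (p $ i)"

definition shifted_monom :: "real ^ 'd \<Rightarrow> ('d \<Rightarrow>\<^sub>0 nat) \<Rightarrow> ('d::finite, real) mpoly" where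
  "shifted_monom p a = (\<Prod>i\<in>UNIV. shifted_var p i ^ Poly_Mapping.lookup a i)"

lemma taylor_shifted_var: "taylor p (shifted_var p i) = mfps_var i"
  by (simp add: shifted_var_def hom_distribs taylor_mvar)

lemma taylor_shifted_monom:
  fixes p :: "real ^ 'd::finite"
  shows "taylor p (shifted_monom p a) = mfps_monom a"
proof -
  have var: "mfps_var i = (mfps_monom (Poly_Mapping.single i 1) :: ('d, real) mfps)" for i :: 'd
    by (rule mfps_eqI) (simp add: mfps_var.rep_eq mfps_coeff_monom)
  have one: "(1 :: ('d, real) mfps) = mfps_monom 0"
    by (rule mfps_eqI) (simp add: one_mfps.rep_eq mfps_coeff_monom)
  have pow: "(mfps_var i :: ('d, real) mfps) ^ k = mfps_monom (Poly_Mapping.single i k)" for i :: 'd and k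
    by (induction k) (simp_all add: one var mfps_monom_mult single_add[symmetric])
  have "(\<Prod>i\<in>A. (mfps_var i :: ('d, real) mfps) ^ Poly_Mapping.lookup a i) =
      mfps_monom (\<Sum>i\<in>A. Poly_Mapping.single i (Poly_Mapping.lookup a i))" for A
    by (induction A rule: infinite_finite_induct) (simp_all add: one pow mfps_monom_mult)
  moreover have "(\<Sum>i\<in>UNIV. Poly_Mapping.single i (Poly_Mapping.lookup a i)) = a"
    by (rule poly_mapping_eqI) (simp add: lookup_sum lookup_single when_def)
  ultimately show ?thesis
    by (simp add: shifted_monom_def taylor.hom_prod taylor.hom_power taylor_shifted_var)
qed

text \<open>Substituting \<open>x + p\<close> and then \<open>x - p\<close> for the variables
  returns \<open>f\<close>; the coefficients in between are the Taylor coefficients at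
  \<open>p\<close>, of which only finitely many are nonzero.\<close>

lemma shifted_expansion:
  fixes f :: "('d::finite, real) mpoly"
  shows "\<exists>A. finite A \<and> f = (\<Sum>a\<in>A. mconst (mfps_coeff (taylor p f) a) * shifted_monom p a) \<and>
    (\<forall>a. a \<notin> A \<longrightarrow> mfps_coeff (taylor p f) a = 0)"
proof -
  define s where "s = subst mconst (\<lambda>i. mvar i + mconst (p $ i)) f"
  interpret s: comm_ring_hom "subst mconst (\<lambda>i. mvar i + mconst (p $ i) :: ('d, real) mpoly)"
    by (rule comm_ring_hom_subst[OF comm_ring_hom_mconst])
  interpret y: comm_ring_hom "subst mconst (shifted_var p)"
    by (rule comm_ring_hom_subst[OF comm_ring_hom_mconst])
  have "subst mconst (shifted_var p) s = f" unfolding s_def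
    by (induction f rule: mpoly_induct)
      (simp_all add: s.hom_add y.hom_add s.hom_mult y.hom_mult subst_mconst[OF comm_ring_hom_mconst]
        subst_mvar[OF comm_ring_hom_mconst], simp add: shifted_var_def)
  then have f: "f = (\<Sum>a\<in>Poly_Mapping.keys s. mconst (Poly_Mapping.lookup s a) * shifted_monom p a)"
    by (simp add: subst_def shifted_monom_def)
  have "taylor p f = (\<Sum>a\<in>Poly_Mapping.keys s. mfps_const (Poly_Mapping.lookup s a) * mfps_monom a)"
    by (subst f) (simp add: taylor.hom_sum taylor.hom_mult taylor_shifted_monom)
  moreover have "mfps_coeff (sum g A) b = (\<Sum>a\<in>A. mfps_coeff (g a) b)" for g :: "_ \<Rightarrow> ('d, real) mfps" and A :: "('d \<Rightarrow>\<^sub>0 nat) set" and b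
    by (induction A rule: infinite_finite_induct) (simp_all add: zero_mfps.rep_eq plus_mfps.rep_eq)
  ultimately have "mfps_coeff (taylor p f) b = (\<Sum>a\<in>Poly_Mapping.keys s. if a = b then Poly_Mapping.lookup s b else 0)" for b
    by (simp add: mfps_const_mult_coeff mfps_coeff_monom if_distrib cong: if_cong)
  then have c: "mfps_coeff (taylor p f) b = Poly_Mapping.lookup s b" for b
    by (simp add: in_keys_iff)
  show ?thesis
    by (intro exI[of _ "Poly_Mapping.keys s"] conjI) (auto simp: c f[symmetric] in_keys_iff)
qed

text \<open>Generated by the \<open>M\<close>-th powers of the coordinates at \<open>p\<close>
  instead of all products of \<open>M\<close> of them. Such ideals shrink along with the powers of
  the maximal ideal, and whether a monomial belongs is read off from its single exponents.\<close>

definition local_ideal :: "nat \<Rightarrow> real ^ 'd \<Rightarrow> ('d::finite, real) mpoly set" where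
  "local_ideal M p = {\<Sum>i\<in>UNIV. shifted_var p i ^ M * h i | h. True}"

lemma local_idealI: "(\<Sum>i\<in>UNIV. shifted_var p i ^ M * h i) \<in> local_ideal M p"
  unfolding local_ideal_def by (intro CollectI exI[of _ h] conjI refl TrueI)

lemma local_idealE:
  assumes "a \<in> local_ideal M p"
  obtains h where "a = (\<Sum>i\<in>UNIV. shifted_var p i ^ M * h i)"
  using assms unfolding local_ideal_def by (elim CollectE exE conjE)

lemma local_ideal_gen: "shifted_var p i ^ M * g \<in> local_ideal M p"
proof -
  have "(\<Sum>j\<in>UNIV. shifted_var p j ^ M * (if j = i then g else 0)) = shifted_var p i ^ M * g"
    by (simp add: if_distrib cong: if_cong)
  with local_idealI[of p M "\<lambda>j. if j = i then g else 0"] show ?thesis by (simp only:)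
qed

lemma local_ideal_add:
  assumes "a \<in> local_ideal M p" "b \<in> local_ideal M p"
  shows "a + b \<in> local_ideal M p"
proof -
  obtain g where g: "a = (\<Sum>i\<in>UNIV. shifted_var p i ^ M * g i)" using assms(1) by (rule local_idealE)
  obtain h where h: "b = (\<Sum>i\<in>UNIV. shifted_var p i ^ M * h i)" using assms(2) by (rule local_idealE)
  have "a + b = (\<Sum>i\<in>UNIV. shifted_var p i ^ M * (g i + h i))" by (simp add: g h distrib_left sum.distrib)
  then show ?thesis by (simp only: local_idealI)
qed

lemma local_ideal_mult:
  assumes "a \<in> local_ideal M p"
  shows "r * a \<in> local_ideal M p"
proof -
  obtain g where g: "a = (\<Sum>i\<in>UNIV. shifted_var p i ^ M * g i)" using assms by (rule local_idealE)
  have "r * a = (\<Sum>i\<in>UNIV. shifted_var p i ^ M * (r * g i))" by (simp add: g sum_distrib_left mult.left_commute)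
  then show ?thesis by (simp only: local_idealI)
qed

lemma local_ideal_0: "0 \<in> local_ideal M p"
  using local_ideal_mult[OF local_ideal_gen, of 0] by simp

lemma local_ideal_uminus: "a \<in> local_ideal M p \<Longrightarrow> - a \<in> local_ideal M p"
  using local_ideal_mult[of a M p "- 1"] by simp

lemma local_ideal_diff: "a \<in> local_ideal M p \<Longrightarrow> b \<in> local_ideal M p \<Longrightarrow> a - b \<in> local_ideal M p"
  using local_ideal_add[OF _ local_ideal_uminus] by (metis diff_conv_add_uminus)

lemma local_ideal_sum: "(\<And>i. i \<in> A \<Longrightarrow> f i \<in> local_ideal M p) \<Longrightarrow> sum f A \<in> local_ideal M p"
  by (induction A rule: infinite_finite_induct) (auto intro: local_ideal_0 local_ideal_add)

text \<open>The ideal generated by the \<open>M\<close>-th powers of the indeterminates, described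
  by coefficients.\<close>

definition mfps_local_ideal :: "nat \<Rightarrow> ('d::finite, real) mfps set" where
  "mfps_local_ideal M = {h. \<forall>a. (\<forall>i. Poly_Mapping.lookup a i < M) \<longrightarrow> mfps_coeff h a = 0}"

lemma mfps_local_ideal_add: "g \<in> mfps_local_ideal M \<Longrightarrow> h \<in> mfps_local_ideal M \<Longrightarrow> g + h \<in> mfps_local_ideal M"
  by (simp add: mfps_local_ideal_def plus_mfps.rep_eq)

lemma mfps_local_ideal_mult: "h \<in> mfps_local_ideal M \<Longrightarrow> h * g \<in> mfps_local_ideal M"
proof -
  assume h: "h \<in> mfps_local_ideal M"
  have "mfps_coeff (h * g) m = 0" if m: "\<And>i. Poly_Mapping.lookup m i < M" for m
    unfolding mfps_coeff_mult
  proof (rule sum.neutral, clarify)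
    fix a b assume "m = a + b"
    have "Poly_Mapping.lookup a i < M" for i
      using m[of i] by (simp add: \<open>m = a + b\<close> lookup_add)
    then show "mfps_coeff h a * mfps_coeff g b = 0" using h by (simp add: mfps_local_ideal_def)
  qed
  then show ?thesis by (simp add: mfps_local_ideal_def)
qed

lemma local_ideal_if_taylor:
  assumes "taylor p f \<in> mfps_local_ideal M"
  shows "f \<in> local_ideal M p"
proof -
  obtain A where A: "finite A" "f = (\<Sum>a\<in>A. mconst (mfps_coeff (taylor p f) a) * shifted_monom p a)"
    using shifted_expansion[of f p] by blast
  have "mconst (mfps_coeff (taylor p f) a) * shifted_monom p a \<in> local_ideal M p" for a
  proof (cases "\<forall>i. Poly_Mapping.lookup a i < M")
    case True
    then have "mfps_coeff (taylor p f) a = 0" using assms by (simp add: mfps_local_ideal_def)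
    then show ?thesis by (simp add: local_ideal_0)
  next
    case False
    then obtain i where "M \<le> Poly_Mapping.lookup a i" by (meson not_less)
    then obtain k where k: "Poly_Mapping.lookup a i = M + k" using le_Suc_ex by blast
    have "shifted_monom p a = shifted_var p i ^ M * (shifted_var p i ^ k *
        (\<Prod>j\<in>UNIV - {i}. shifted_var p j ^ Poly_Mapping.lookup a j))"
      unfolding shifted_monom_def by (subst prod.remove[of _ i]) (simp_all add: k power_add mult.assoc)
    then show ?thesis using local_ideal_mult[OF local_ideal_gen] by simp
  qed
  then show ?thesis by (subst A(2)) (rule local_ideal_sum)
qed

lemma mfps_truncate: "\<exists>u. h - taylor p u \<in> mfps_local_ideal M"
proof -
  let ?B = "{a :: 'a \<Rightarrow>\<^sub>0 nat. \<forall>i. Poly_Mapping.lookup a i < M}"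
  have "finite ?B"
  proof (rule finite_imageD)
    have "Poly_Mapping.lookup ` ?B \<subseteq> Pi\<^sub>E UNIV (\<lambda>i. {..<M})" by auto
    moreover have "finite (Pi\<^sub>E (UNIV :: 'a set) (\<lambda>i. {..<M}))" by (rule finite_PiE) auto
    ultimately show "finite (Poly_Mapping.lookup ` ?B)" by (rule finite_subset)
    show "inj_on Poly_Mapping.lookup ?B" by (simp add: inj_on_def poly_mapping.lookup_inject)
  qed
  define u where "u = (\<Sum>a\<in>?B. mconst (mfps_coeff h a) * shifted_monom p a)"
  have "taylor p u = (\<Sum>a\<in>?B. mfps_const (mfps_coeff h a) * mfps_monom a)"
    by (simp add: u_def taylor.hom_sum taylor.hom_mult taylor_shifted_monom)
  moreover have "mfps_coeff (sum g A) b = (\<Sum>a\<in>A. mfps_coeff (g a) b)" for g :: "_ \<Rightarrow> ('a, real) mfps" and A :: "('a \<Rightarrow>\<^sub>0 nat) set" and b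
    by (induction A rule: infinite_finite_induct) (simp_all add: zero_mfps.rep_eq plus_mfps.rep_eq)
  ultimately have "mfps_coeff (taylor p u) b = (\<Sum>a\<in>?B. if a = b then mfps_coeff h b else 0)" for b
    by (simp add: mfps_const_mult_coeff mfps_coeff_monom if_distrib cong: if_cong) (rule sum.cong, auto)
  then have "mfps_coeff (taylor p u) b = mfps_coeff h b" if "b \<in> ?B" for b
    using \<open>finite ?B\<close> that by (simp add: sum.delta)
  then have "h - taylor p u \<in> mfps_local_ideal M"
    by (auto simp: mfps_local_ideal_def minus_mfps.rep_eq)
  then show ?thesis ..
qed

text \<open>The series congruent to the expansion of some element of the preordering form a
  preordering themselves, so minimality of the generated one applies and no explicit certificate has
  to be handled.\<close>

lemma local_membership_approx:
  fixes G :: "('d::finite, real) mpoly set"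
  assumes "taylor p f \<in> preordering_gen (taylor p ` G)"
  shows "\<exists>t\<in>preordering_gen G. f - t \<in> local_ideal M p"
proof -
  let ?T = "preordering_gen G"
  note T = preordering_preordering_gen[of G]
  define S where "S = {h. \<exists>t\<in>?T. h - taylor p t \<in> mfps_local_ideal M}"
  have "preordering S" unfolding preordering_def
  proof (intro conjI ballI allI)
    fix a b assume "a \<in> S" "b \<in> S"
    then obtain s t where st: "s \<in> ?T" "t \<in> ?T" "a - taylor p s \<in> mfps_local_ideal M" "b - taylor p t \<in> mfps_local_ideal M"
      by (auto simp: S_def)
    have add: "a + b - taylor p (s + t) = (a - taylor p s) + (b - taylor p t)" by (simp add: taylor.hom_add)
    have "a + b - taylor p (s + t) \<in> mfps_local_ideal M"
      unfolding add by (rule mfps_local_ideal_add[OF st(3,4)])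
    then show "a + b \<in> S" unfolding S_def using preordering_add[OF T st(1,2)] by blast
    have mult: "a * b - taylor p (s * t) = (a - taylor p s) * b + (b - taylor p t) * taylor p s"
      by (simp add: taylor.hom_mult algebra_simps)
    have "a * b - taylor p (s * t) \<in> mfps_local_ideal M"
      unfolding mult by (rule mfps_local_ideal_add[OF mfps_local_ideal_mult[OF st(3)] mfps_local_ideal_mult[OF st(4)]])
    then show "a * b \<in> S" unfolding S_def using preordering_mult[OF T st(1,2)] by blast
  next
    fix a
    \<comment> \<open>The square of an arbitrary series is approximated by the square of a
      polynomial truncation, which lies in every preordering.\<close>
    obtain u where u: "a - taylor p u \<in> mfps_local_ideal M" using mfps_truncate by blast
    have eq: "a\<^sup>2 - taylor p (u\<^sup>2) = (a - taylor p u) * (a + taylor p u)"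
      by (simp add: taylor.hom_mult algebra_simps power2_eq_square)
    have "a\<^sup>2 - taylor p (u\<^sup>2) \<in> mfps_local_ideal M" unfolding eq by (rule mfps_local_ideal_mult[OF u])
    then show "a\<^sup>2 \<in> S" unfolding S_def using preordering_square[OF T] by blast
  qed
  moreover have "taylor p ` G \<subseteq> S"
  proof
    fix h assume "h \<in> taylor p ` G"
    then obtain g where g: "g \<in> G" "h = taylor p g" by blast
    have "h - taylor p g \<in> mfps_local_ideal M" by (simp add: g mfps_local_ideal_def zero_mfps.rep_eq)
    then show "h \<in> S" unfolding S_def using g subsetD[OF preordering_gen_superset g(1)] by blast
  qed
  ultimately have "taylor p f \<in> S" using assms preordering_gen_minimal by blast
  then obtain t where "t \<in> ?T" "taylor p (f - t) \<in> mfps_local_ideal M" by (auto simp: S_def taylor.hom_minus)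
  then show ?thesis using local_ideal_if_taylor by blast
qed

section \<open>The local-global principle\<close>

definition support :: "'a::comm_ring_1 set \<Rightarrow> 'a set" where
  "support T = {a \<in> T. - a \<in> T}"

context
  fixes T :: "('d::finite, real) mpoly set"
  assumes T: "preordering T"
begin

lemma support_add: "a \<in> support T \<Longrightarrow> b \<in> support T \<Longrightarrow> a + b \<in> support T"
  using preordering_add[OF T, of a b] preordering_add[OF T, of "- a" "- b"] by (simp add: support_def)

text \<open>An arbitrary multiplier is a difference of squares:
  \<open>4 r b = (r + 1)^2 b + (r - 1)^2 (- b)\<close>, and 1/4 is a square.\<close>

lemma support_mult:
  assumes "a \<in> support T"
  shows "r * a \<in> support T"
proof -
  have *: "r * b \<in> T" if "b \<in> T" "- b \<in> T" for b r
  proof -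
    have four: "mconst (1/4) * mconst 4 = (1 :: ('d, real) mpoly)" by (simp flip: mconst.hom_mult)
    have "mconst 4 = (4 :: ('d, real) mpoly)" by (rule mconst.hom_numeral)
    then have "mconst 4 * r * b = (r + 1)\<^sup>2 * b + (r - 1)\<^sup>2 * - b"
      by (simp add: algebra_simps power2_eq_square)
    then have "mconst (1/4) * (mconst 4 * r * b) \<in> T"
      using preordering_mult[OF T mconst_in_preordering[OF T] preordering_add[OF T
        preordering_mult[OF T preordering_square[OF T] that(1)] preordering_mult[OF T preordering_square[OF T] that(2)]]]
      by simp
    then show ?thesis by (simp add: four flip: mult.assoc)
  qed
  show ?thesis using *[of a r] *[of "- a" r] assms by (simp add: support_def)
qed

lemma support_0: "0 \<in> support T"
  by (simp add: support_def preordering_0[OF T])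

lemma support_sum: "(\<And>i. i \<in> A \<Longrightarrow> f i \<in> support T) \<Longrightarrow> sum f A \<in> support T"
  by (induction A rule: infinite_finite_induct) (auto intro: support_0 support_add)

end

lemma peval_shifted_var [simp]: "peval (shifted_var p i) x = x $ i - p $ i"
  by (simp add: shifted_var_def hom_distribs)

text \<open>The quotient by the local ideal is a local ring with nilpotent maximal ideal.\<close>

lemma vanishing_power_in_local_ideal:
  assumes "peval u p = 0"
  shows "\<exists>N. u ^ N \<in> local_ideal M p"
proof -
  \<comment> \<open>The radical of the local ideal. It contains the coordinates at \<open>p\<close>,
    so induction on \<open>f\<close> puts every \<open>f - f(p)\<close> into it.\<close>
  define R where "R = {a. \<exists>N. a ^ N \<in> local_ideal M p}"
  have R_mult: "r * a \<in> R" if "a \<in> R" for r a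
    using that local_ideal_mult unfolding R_def by (fastforce simp: power_mult_distrib)
  have le: "a ^ n \<in> local_ideal M p" if "a ^ k \<in> local_ideal M p" "k \<le> n" for a k n
    using local_ideal_mult[OF that(1), of "a ^ (n - k)"] that(2) by (simp flip: power_add)
  have R_add: "a + b \<in> R" if "a \<in> R" "b \<in> R" for a b
  proof -
    from that obtain k l where kl: "a ^ k \<in> local_ideal M p" "b ^ l \<in> local_ideal M p" by (auto simp: R_def)
    have "(a + b) ^ (k + l) = (\<Sum>j\<le>k + l. of_nat ((k + l) choose j) * a ^ j * b ^ (k + l - j))"
      by (rule binomial_ring)
    also have "\<dots> \<in> local_ideal M p"
    proof (rule local_ideal_sum)
      fix j assume "j \<in> {..k + l}"
      show "of_nat ((k + l) choose j) * a ^ j * b ^ (k + l - j) \<in> local_ideal M p"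
      proof (cases "k \<le> j")
        case True
        from local_ideal_mult[OF le[OF kl(1) this], of "of_nat ((k + l) choose j) * b ^ (k + l - j)"]
        show ?thesis by (simp add: mult_ac)
      next
        case False
        then have "l \<le> k + l - j" by simp
        from local_ideal_mult[OF le[OF kl(2) this], of "of_nat ((k + l) choose j) * a ^ j"]
        show ?thesis by (simp add: mult_ac)
      qed
    qed
    finally show ?thesis by (auto simp: R_def)
  qed
  have zero: "0 \<in> R" unfolding R_def using local_ideal_0 by (intro CollectI exI[of _ 1]) simp
  have R_var: "shifted_var p i \<in> R" for i
    unfolding R_def using local_ideal_gen[of p i M 1] by auto
  have "f - mconst (peval f p) \<in> R" for f
  proof (induction f rule: mpoly_induct)
    case (const c)
    then show ?case using zero by simp
  next
    case (var i)
    show ?case using R_var[of i] by (simp add: shifted_var_def)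
  next
    case (add f g)
    have eq: "f + g - mconst (peval (f + g) p) = (f - mconst (peval f p)) + (g - mconst (peval g p))"
      by (simp add: hom_distribs)
    show ?case unfolding eq by (rule R_add[OF add.IH])
  next
    case (mult f g)
    have eq: "f * g - mconst (peval (f * g) p) = g * (f - mconst (peval f p)) + mconst (peval f p) * (g - mconst (peval g p))"
      by (simp add: hom_distribs algebra_simps)
    show ?case unfolding eq by (rule R_add[OF R_mult[OF mult.IH(1)] R_mult[OF mult.IH(2)]])
  qed
  from this[of u] show ?thesis using assms by (simp add: R_def)
qed

section \<open>Chinese remaindering for finitely many points\<close>

definition sep_index :: "real ^ 'd \<Rightarrow> real ^ 'd \<Rightarrow> 'd" where
  "sep_index p q = (SOME i. p $ i \<noteq> q $ i)"

text \<open>A Lagrange factor, affine in one coordinate that distinguishes the points. As a multiple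
  of a generator at \<open>q\<close>, it has its \<open>M\<close>-th power in the local ideal of
  \<open>q\<close> without further estimates.\<close>

definition sep_factor :: "real ^ 'd \<Rightarrow> real ^ 'd \<Rightarrow> ('d::finite, real) mpoly" where
  "sep_factor p q = mconst (1 / (p $ sep_index p q - q $ sep_index p q)) * shifted_var q (sep_index p q)"

definition separator :: "(real ^ 'd) set \<Rightarrow> real ^ 'd \<Rightarrow> ('d::finite, real) mpoly" where
  "separator Z p = (\<Prod>q\<in>Z - {p}. sep_factor p q)"

lemma peval_separator: "peval (separator Z p) p = 1"
proof -
  have "peval (sep_factor p q) p = 1" if "q \<noteq> p" for q
  proof -
    have "\<exists>i. p $ i \<noteq> q $ i" using that Finite_Cartesian_Product.vec_eq_iff[of p q] by auto
    then have "p $ sep_index p q \<noteq> q $ sep_index p q" unfolding sep_index_def by (rule someI_ex)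
    then show ?thesis by (simp add: sep_factor_def hom_distribs)
  qed
  then show ?thesis by (simp add: separator_def peval.hom_prod)
qed

lemma sep_factor_power: "sep_factor p q ^ M \<in> local_ideal M q"
proof -
  have eq: "sep_factor p q ^ M = mconst (1 / (p $ sep_index p q - q $ sep_index p q)) ^ M * (shifted_var q (sep_index p q) ^ M * 1)"
    by (simp add: sep_factor_def power_mult_distrib)
  show ?thesis unfolding eq by (rule local_ideal_mult[OF local_ideal_gen])
qed

text \<open>An approximate idempotent. The inner \<open>1 - separator^M\<close> vanishes at
  \<open>p\<close>, so a high power of it lies in the local ideal there; the whole expression is
  divisible by \<open>separator^M\<close>, which lies in the local ideals of all other points of
  \<open>Z\<close>.\<close>

definition bump :: "nat \<Rightarrow> (real ^ 'd) set \<Rightarrow> real ^ 'd \<Rightarrow> ('d::finite, real) mpoly" where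
  "bump M Z p = 1 - (1 - separator Z p ^ M) ^ (SOME N. (1 - separator Z p ^ M) ^ N \<in> local_ideal M p)"

lemma bump_at: "1 - bump M Z p \<in> local_ideal M p"
proof -
  have "peval (1 - separator Z p ^ M) p = 0" by (simp add: hom_distribs peval_separator)
  from someI_ex[OF vanishing_power_in_local_ideal[OF this]] show ?thesis by (simp add: bump_def)
qed

lemma bump_dvd:
  fixes p :: "real ^ 'd::finite"
  shows "\<exists>h. bump M Z p = h * separator Z p ^ M"
proof -
  have "\<exists>h. 1 - (1 - a) ^ N = h * a" for a :: "('d, real) mpoly" and N
    by (intro exI[of _ "\<Sum>i<N. (1 - a) ^ i"]) (simp add: one_diff_power_eq mult.commute)
  then show ?thesis unfolding bump_def .
qed

lemma bump_off:
  assumes "finite Z" "q \<in> Z" "q \<noteq> p"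
  shows "bump M Z p \<in> local_ideal M q"
proof -
  obtain h where h: "bump M Z p = h * separator Z p ^ M" using bump_dvd by blast
  have "separator Z p = (\<Prod>q\<in>Z - {p} - {q}. sep_factor p q) * sep_factor p q"
    unfolding separator_def using assms by (subst prod.remove[of _ q]) (auto simp: mult.commute)
  then have "bump M Z p = h * (\<Prod>q\<in>Z - {p} - {q}. sep_factor p q) ^ M * sep_factor p q ^ M"
    unfolding h by (simp add: power_mult_distrib mult.assoc)
  then show ?thesis using local_ideal_mult[OF sep_factor_power] by simp
qed

text \<open>Expanding the product picks one generator for each point, that is a function
  \<open>c\<close> from points to coordinates. So membership has to be known only for finitely many
  products of powers.\<close>

lemma prod_local_ideal_subset:
  fixes Z :: "(real ^ 'd::finite) set"
  assumes "finite Z" and T: "preordering T"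
    and w: "\<And>c. c \<in> Z \<rightarrow>\<^sub>E UNIV \<Longrightarrow> (\<Prod>p\<in>Z. shifted_var p (c p)) ^ M \<in> support T"
    and u: "\<And>p. p \<in> Z \<Longrightarrow> u p \<in> local_ideal M p"
  shows "prod u Z \<in> support T"
proof -
  have "\<forall>p\<in>Z. \<exists>h. u p = (\<Sum>i\<in>UNIV. shifted_var p i ^ M * h i)" 
  proof
    fix p assume "p \<in> Z"
    from u[OF this] obtain h where "u p = (\<Sum>i\<in>UNIV. shifted_var p i ^ M * h i)" by (rule local_idealE)
    then show "\<exists>h. u p = (\<Sum>i\<in>UNIV. shifted_var p i ^ M * h i)" by (rule exI[of _ h])
  qed
  then obtain h where h: "\<And>p. p \<in> Z \<Longrightarrow> u p = (\<Sum>i\<in>UNIV. shifted_var p i ^ M * h p i)" by metis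
  have "prod u Z = (\<Prod>p\<in>Z. \<Sum>i\<in>UNIV. shifted_var p i ^ M * h p i)" using h by (rule prod.cong[OF refl])
  also have "\<dots> = (\<Sum>c\<in>Z \<rightarrow>\<^sub>E UNIV. \<Prod>p\<in>Z. shifted_var p (c p) ^ M * h p (c p))"
    by (rule prod_sum_PiE) (use assms(1) in auto)
  also have "\<dots> = (\<Sum>c\<in>Z \<rightarrow>\<^sub>E UNIV. (\<Prod>p\<in>Z. h p (c p)) * (\<Prod>p\<in>Z. shifted_var p (c p)) ^ M)"
    by (simp add: prod.distrib prod_power_distrib mult.commute)
  also have "\<dots> \<in> support T" by (intro support_sum[OF T] support_mult[OF T] w)
  finally show ?thesis .
qed

text \<open>The ideal \<open>{a. a v \<in> support T}\<close> contains every \<open>bump M Z p\<close> and the product of all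
  \<open>1 - bump M Z p\<close>, hence it contains \<open>1\<close>.\<close>

lemma local_ideals_subset_support:
  fixes Z :: "(real ^ 'd::finite) set"
  assumes Z: "finite Z" and T: "preordering T"
    and w: "\<And>c. c \<in> Z \<rightarrow>\<^sub>E UNIV \<Longrightarrow> (\<Prod>p\<in>Z. shifted_var p (c p)) ^ M \<in> support T"
    and v: "\<And>p. p \<in> Z \<Longrightarrow> v \<in> local_ideal M p"
  shows "v \<in> support T"
proof -
  note prod_in = prod_local_ideal_subset[OF Z T w]
  have bump: "bump M Z p * v \<in> support T" if "p \<in> Z" for p
  proof -
    obtain h where h: "bump M Z p = h * separator Z p ^ M" using bump_dvd by blast
    \<comment> \<open>\<open>v\<close> takes the slot of \<open>p\<close> and Lagrange factors fill
      the others, so the product is \<open>v * separator^M\<close>, of which \<open>bump * v\<close>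
      is a multiple.\<close>
    define u where "u q = (if q = p then v else sep_factor p q ^ M)" for q
    have "prod u Z \<in> support T"
      by (rule prod_in) (auto simp: u_def v sep_factor_power)
    moreover have "prod u Z = v * separator Z p ^ M"
    proof -
      have "prod u Z = u p * prod u (Z - {p})" using Z that by (rule prod.remove)
      also have "prod u (Z - {p}) = (\<Prod>q\<in>Z - {p}. sep_factor p q ^ M)"
        by (rule prod.cong) (auto simp: u_def)
      also have "\<dots> = separator Z p ^ M" by (simp add: separator_def prod_power_distrib)
      finally show ?thesis by (simp add: u_def)
    qed
    ultimately have "h * (v * separator Z p ^ M) \<in> support T" using support_mult[OF T] by simp
    then show ?thesis by (simp add: h mult_ac)
  qed
  \<comment> \<open>Each further point changes the left side by a multiple of its
    \<open>bump * v\<close>.\<close>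
  have "(1 - (\<Prod>p\<in>A. 1 - bump M Z p)) * v \<in> support T" if "finite A" "A \<subseteq> Z" for A
    using that
  proof (induction A rule: finite_induct)
    case empty
    then show ?case by (simp add: support_0[OF T])
  next
    case (insert p A)
    have "(1 - (\<Prod>p\<in>insert p A. 1 - bump M Z p)) * v =
        (1 - (\<Prod>p\<in>A. 1 - bump M Z p)) * v + (\<Prod>p\<in>A. 1 - bump M Z p) * (bump M Z p * v)"
      using insert.hyps by (simp add: algebra_simps)
    also have "\<dots> \<in> support T"
      using insert.IH insert.prems by (intro support_add[OF T _ support_mult[OF T bump]]) simp_all
    finally show ?case .
  qed
  from this[OF Z order_refl] have "(1 - (\<Prod>p\<in>Z. 1 - bump M Z p)) * v \<in> support T" .
  moreover have "v * (\<Prod>p\<in>Z. 1 - bump M Z p) \<in> support T"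
    by (intro support_mult[OF T] prod_in bump_at)
  ultimately have "(1 - (\<Prod>p\<in>Z. 1 - bump M Z p)) * v + v * (\<Prod>p\<in>Z. 1 - bump M Z p) \<in> support T"
    by (rule support_add[OF T])
  then show ?thesis by (simp add: algebra_simps)
qed

theorem local_global:
  fixes G :: "('d::finite, real) mpoly set"
  assumes G: "finite G" "compact (nonneg_set G)"
    and nonneg: "\<And>x. x \<in> nonneg_set G \<Longrightarrow> 0 \<le> peval f x"
    and fin: "finite {p \<in> nonneg_set G. peval f p = 0}"
    and loc: "\<And>p. p \<in> nonneg_set G \<Longrightarrow> peval f p = 0 \<Longrightarrow> taylor p f \<in> preordering_gen (taylor p ` G)"
  shows "f \<in> preordering_gen G"
proof -
  let ?T = "preordering_gen G"
  define T' where "T' = preordering_gen (insert (- (f\<^sup>2)) G)"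
  define Z where "Z = {p \<in> nonneg_set G. peval f p = 0}"
  have T': "preordering T'" unfolding T'_def by (rule preordering_preordering_gen)
  note T = preordering_preordering_gen[of G]
  have Z: "finite Z" using fin by (simp add: Z_def)
  have nZ: "nonneg_set (insert (- (f\<^sup>2)) G) = Z"
    by (auto simp: nonneg_set_def Z_def hom_distribs)
  \<comment> \<open>One coordinate for each point of \<open>Z\<close>: such a product vanishes on
    \<open>Z\<close>, and the Positivstellensatz makes an even power of it negative in
    \<open>T'\<close>.\<close>
  define w where "w c = (\<Prod>p\<in>Z. shifted_var p (c p))" for c :: "real ^ 'd \<Rightarrow> 'd"
  have "\<exists>m. - (w c ^ (2 * m)) \<in> T'" for c
    unfolding T'_def
  proof (rule positivstellensatz)
    show "finite (insert (- f\<^sup>2) G)" using G by simp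
    fix x assume "x \<in> nonneg_set (insert (- f\<^sup>2) G)"
    then have "x \<in> Z" by (simp add: nZ)
    then show "peval (w c) x = 0" using Z unfolding w_def peval.hom_prod by (intro prod_zero) (auto intro!: bexI[of _ x])
  qed
  then obtain m where m: "\<And>c. - (w c ^ (2 * m c)) \<in> T'" by metis
  \<comment> \<open>The sum bounds all \<open>m c\<close> at once; only extensional \<open>c\<close>
    are counted, which keeps it finite.\<close>
  define M where "M = 2 * (\<Sum>c\<in>Z \<rightarrow>\<^sub>E UNIV. m c)"
  have wM: "(\<Prod>p\<in>Z. shifted_var p (c p)) ^ M \<in> support T'" if c: "c \<in> Z \<rightarrow>\<^sub>E UNIV" for c
  proof -
    have "finite (Z \<rightarrow>\<^sub>E (UNIV :: 'd set))" using Z by (intro finite_PiE) auto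
    then have "m c \<le> (\<Sum>c\<in>Z \<rightarrow>\<^sub>E UNIV. m c)" using c by (intro member_le_sum) auto
    then obtain k where k: "M = k + 2 * m c" unfolding M_def by (metis add.commute le_Suc_ex mult_le_mono2)
    have "w c ^ (2 * m c) \<in> support T'" using m preordering_even_power[OF T'] by (simp add: support_def)
    from support_mult[OF T' this, of "w c ^ k"] show ?thesis by (simp add: k power_add w_def)
  qed
  have "\<forall>p\<in>Z. \<exists>t\<in>?T. f - t \<in> local_ideal M p"
    using loc local_membership_approx unfolding Z_def by blast
  then obtain t where t: "\<And>p. p \<in> Z \<Longrightarrow> t p \<in> ?T" "\<And>p. p \<in> Z \<Longrightarrow> f - t p \<in> local_ideal M p" by metis
  \<comment> \<open>Squaring keeps the sum inside the preordering and preserves the congruences: 1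
    at \<open>p\<close>, 0 at the other points.\<close>
  define s where "s = (\<Sum>p\<in>Z. (bump M Z p)\<^sup>2 * t p)"
  have s: "s \<in> ?T" unfolding s_def
    by (intro preordering_sum[OF T] preordering_mult[OF T] preordering_square[OF T] t)
  have "f - s \<in> local_ideal M p" if p: "p \<in> Z" for p
  proof -
    let ?e = "bump M Z"
    have "f - s = (f - t p) + ((1 + ?e p) * t p) * (1 - ?e p) - (\<Sum>q\<in>Z - {p}. (?e q * t q) * ?e q)"
      unfolding s_def sum.remove[OF Z p] by (simp add: algebra_simps power2_eq_square)
    also have "\<dots> \<in> local_ideal M p"
      using Z p by (intro local_ideal_diff local_ideal_add t local_ideal_mult bump_at local_ideal_sum bump_off) auto
    finally show ?thesis .
  qed
  from local_ideals_subset_support[OF Z T' wM this] have "f - s \<in> T'" by (simp add: support_def)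
  then obtain a b where ab: "a \<in> ?T" "b \<in> ?T" "f - s = a + - (f\<^sup>2) * b"
    unfolding T'_def preordering_gen_insert by blast
  have "f + b * f\<^sup>2 = s + a" using ab(3) by (simp add: algebra_simps)
  from in_preordering_if_perturbed[OF G nonneg preordering_add[OF T s ab(1)] ab(2) this] show ?thesis .
qed

section \<open>Diagonal matrices\<close>

text \<open>A diagonal matrix unit is a symmetric idempotent, so it equals its own product
  \<open>A\<^sup>T * A\<close> and each diagonal entry can serve directly as the weight
  \<open>m\<close>.\<close>

lemma diag_mat_of_in_mat_power:
  fixes M :: "'a::comm_ring_1 set"
  assumes "length ds \<le> n" "set ds \<subseteq> M"
  shows "diag_mat_of n ds \<in> mat_power n M"
proof -
  define E :: "nat \<Rightarrow> 'a mat" where "E i = mat n n (\<lambda>(a, b). if a = i \<and> b = i then 1 else 0)" for i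
  have E: "E i \<in> carrier_mat n n" for i by (simp add: E_def)
  have EE: "(E i)\<^sup>T * E i = E i" if "i < n" for i
  proof (rule eq_matI)
    fix a b assume ab: "a < dim_row (E i)" "b < dim_col (E i)"
    then have ab: "a < n" "b < n" by (simp_all add: E_def)
    then have "((E i)\<^sup>T * E i) $$ (a, b) = (\<Sum>k = 0..<n. (if k = i \<and> a = i then 1 else 0) * (if k = i \<and> b = i then 1 else 0))"
      by (simp add: E_def scalar_prod_def)
    also have "\<dots> = (\<Sum>k = 0..<n. if k = i then (if a = i \<and> b = i then 1 else 0) else 0)"
      by (intro sum.cong) auto
    also have "\<dots> = E i $$ (a, b)" using that ab by (simp add: E_def)
    finally show "((E i)\<^sup>T * E i) $$ (a, b) = E i $$ (a, b)" .
  qed (simp_all add: E_def)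
  \<comment> \<open>Tails of the list of summands: \<open>foldr\<close> peels off the head, so the
    induction runs downwards from the empty tail.\<close>
  define F where "F k = map (\<lambda>i. (ds ! i, E i)) [k..<length ds]" for k
  have fold: "foldr (+) (map (\<lambda>(m, A). m \<cdot>\<^sub>m (A\<^sup>T * A)) (F k)) (0\<^sub>m n n) =
      mat n n (\<lambda>(a, b). if a = b \<and> k \<le> a \<and> a < length ds then ds ! a else 0)" if "k \<le> length ds" for k
    using that
  proof (induction rule: inc_induct)
    case base
    show ?case by (rule eq_matI) (auto simp: F_def)
  next
    case (step k)
    have "F k = (ds ! k, E k) # F (Suc k)" using step.hyps by (simp add: F_def upt_conv_Cons)
    moreover have "k < n" "k < length ds" using step.hyps assms by simp_all
    ultimately show ?case using step.IH EE
      by (simp add: E_def) (rule eq_matI, auto)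
  qed
  have "diag_mat_of n ds = foldr (+) (map (\<lambda>(m, A). m \<cdot>\<^sub>m (A\<^sup>T * A)) (F 0)) (0\<^sub>m n n)"
    unfolding fold[OF le0] by (rule eq_matI) (auto simp: diag_mat_of_def mat_diag_def)
  moreover have "set (F 0) \<subseteq> M \<times> carrier_mat n n"
    using assms(2) E by (auto simp: F_def)
  ultimately show ?thesis unfolding mat_power_def by blast
qed

lemma psd_diag_entry_nonneg:
  assumes "psd_at (diag_mat_of n ds) x" "i < length ds" "length ds \<le> n"
  shows "0 \<le> peval (ds ! i) x"
proof -
  let ?A = "map_mat (\<lambda>f. peval f x) (diag_mat_of n ds)"
  have A: "?A \<in> carrier_mat n n" by (simp add: diag_mat_of_def mat_diag_def)
  have i: "i < n" using assms by simp
  have "0 \<le> unit_vec n i \<bullet> (?A *\<^sub>v unit_vec n i)"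
    using assms(1) A unfolding psd_at_def psd_def by auto
  also have "\<dots> = vec_index (?A *\<^sub>v unit_vec n i) i"
    using A i by (intro scalar_prod_left_unit mult_mat_vec_carrier[OF A]) simp_all
  also have "\<dots> = ?A $$ (i, i)" using A i by simp
  also have "\<dots> = peval (ds ! i) x"
    using i assms(2) by (simp add: diag_mat_of_def mat_diag_def)
  finally show ?thesis .
qed

theorem proposition6p2:
  fixes \<G> :: "('d::finite, real) mpoly mat set"
    and G :: "('d, real) mpoly set"
    and ds :: "('d, real) mpoly list"
    and n r :: nat
  assumes "n \<ge> 1"
    and "finite \<G>" and "\<G> \<subseteq> sym_mats n"
    and "finite G"
    and "psd_set \<G> = nonneg_set G"
    and "mat_power n (preordering_gen G) \<subseteq> mat_preordering_gen n \<G>"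
    and "length ds = r" and "r \<le> n"
    and "compact (psd_set \<G>)"
    and "\<forall>x\<in>psd_set \<G>. psd_at (diag_mat_of n ds) x"
    and "\<forall>i<r. finite {p \<in> psd_set \<G>. peval (ds ! i) p = 0}"
    and "\<forall>i<r. \<forall>p\<in>psd_set \<G>. peval (ds ! i) p = 0 \<longrightarrow>
           taylor p (ds ! i) \<in> preordering_gen (taylor p ` G)"
  shows "diag_mat_of n ds \<in> mat_power n (preordering_gen G) \<and>
         mat_power n (preordering_gen G) \<subseteq> mat_preordering_gen n \<G>"
proof
  have "ds ! i \<in> preordering_gen G" if i: "i < r" for i
  proof (rule local_global[OF assms(4)])
    show "compact (nonneg_set G)" using assms(5,9) by simp
    show "0 \<le> peval (ds ! i) x" if "x \<in> nonneg_set G" for x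
      using assms(5,7,8,10) i that psd_diag_entry_nonneg by metis
    show "finite {p \<in> nonneg_set G. peval (ds ! i) p = 0}" using assms(5,11) i by simp
    show "taylor p (ds ! i) \<in> preordering_gen (taylor p ` G)"
      if "p \<in> nonneg_set G" "peval (ds ! i) p = 0" for p
      using assms(5,12) i that by simp
  qed
  then have "set ds \<subseteq> preordering_gen G" using assms(7) by (auto simp: in_set_conv_nth)
  then show "diag_mat_of n ds \<in> mat_power n (preordering_gen G)"
    using assms(7,8) by (intro diag_mat_of_in_mat_power) auto
qed (rule assms(6))

end
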